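(* Let $d\ge2$, let $\lambda\in\Lambda$, let $D$ be an open bounded domain in $\mathbb{R}^d$ with $D\cap\mathbb{Z}^d\neq\emptyset$, and let $\mathcal{N}\subseteq\Gamma(\lambda)\times\mathbb{S}^{d-1}$ be an open nonempty neighbourhood of some fixed pair $(k,\omega)\in\Gamma(\lambda)\times\mathbb{S}^{d-1}$, with closure satisfying $\overline{\mathcal{N}}\subset\bigcup_{\zeta\in\Lambda}\Gamma(\zeta)\times\mathbb{S}^{d-1}$. Then there exists a positive constant $C_{D,\mathcal{N}}$, depending on $D$ and $\mathcal{N}$ only, such that for all $v_1,v_2:\mathbb{Z}^d\to\mathbb{C}$ with $\operatorname{supp}v_1,\operatorname{supp}v_2\subset D$, $$\|v_2-v_1\|_{\ell_2(D\cap\mathbb{Z}^d)}\le C_{D,\mathcal{N}}\,\|A_2-A_1\|_{L_2(\mathcal{N})},$$ where $A_1,A_2$ are the Born-approximation scattering amplitudes at $\lambda$ of $v_1,v_2$, respectively.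
   Context: $\Lambda=\{\zeta\in\mathbb{R}:2d-4<|\zeta|<2d\}$, $T^d=\mathbb{R}^d/2\pi\mathbb{Z}^d$, $\phi(k)=2\sum_{i=1}^d\cos k_i$, $\Gamma(\lambda)=\{k\in T^d:\phi(k)=\lambda\}$. For $\lambda\in\Lambda$ the surface $\Gamma(\lambda)$ is smooth and strictly convex with non-zero principal curvatures, and for $\omega\in\mathbb{S}^{d-1}$, $\kappa(\omega,\lambda)$ denotes the unique point of $\Gamma(\lambda)$ with $\nabla\phi(\kappa)/|\nabla\phi(\kappa)|=\omega$. $K(\omega,\lambda)$ is the total curvature (product of principal curvatures) of $\Gamma(\lambda)$ at $\kappa(\omega,\lambda)$, and $\sigma=d-1$. Discrete Fourier transform: $\hat v(p)=(2\pi)^{-d/2}\sum_{x\in\mathbb{Z}^d}v(x)e^{-ip\cdot x}$, $p\in T^d$. The discrete Schrödinger equation is $\Delta\psi+v\psi-\lambda\psi=0$ on $\mathbb{Z}^d$, with $\Delta\psi(x)=\sum_{|x'-x|=1}\psi(x')$. Its scattering amplitude in the Born approximation (for small $v$) is the function $$A(k,\omega)=-\frac{\sqrt{2\pi}\,\hat v\big(\kappa(-\omega,\lambda)-k\big)\,e^{-i(\sigma+2)\pi/4}}{\sqrt{|K(\omega,\lambda)|}\,|\nabla\phi(\kappa(\omega,\lambda))|},\qquad k\in\Gamma(\lambda),\ \omega\in\mathbb{S}^{d-1}.$$ In the statement, scattering amplitudes mean these functions. $L_2(\mathcal{N})$ is with respect to the product of the surface measures on $\Gamma(\lambda)$ and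 $\mathbb{S}^{d-1}$. *)

theory Defs
  imports "HOL-Analysis.Analysis"
begin

section \<open>Integer lattice and torus\<close>

definition ivec :: "int^'n \<Rightarrow> real^'n" where
  "ivec m = (\<chi> i. of_int (m $ i))"

lemma ivec_simps: "ivec 0 = 0" "ivec (a + b) = ivec a + ivec b" "ivec (- a) = - ivec a"
  by (simp_all add: ivec_def vec_eq_iff)

definition torus_rel :: "real^'n \<Rightarrow> real^'n \<Rightarrow> bool" where
  "torus_rel x y \<longleftrightarrow> (\<exists>m. x = y + (2 * pi) *\<^sub>R ivec m)"

quotient_type 'n torus = "real^'n" / "torus_rel :: real^'n::finite \<Rightarrow> real^'n \<Rightarrow> bool"
proof (rule equivpI)
  show "reflp (torus_rel :: real^'n \<Rightarrow> real^'n \<Rightarrow> bool)"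
    unfolding reflp_def torus_rel_def by (metis add.right_neutral ivec_simps(1) scaleR_zero_right)
  show "symp (torus_rel :: real^'n \<Rightarrow> real^'n \<Rightarrow> bool)"
    unfolding symp_def torus_rel_def
  proof clarify
    fix y :: "real^'n" and m
    have "y = y + (2 * pi) *\<^sub>R ivec m + (2 * pi) *\<^sub>R ivec (- m)"
      by (simp add: ivec_simps)
    then show "\<exists>n. y = y + (2 * pi) *\<^sub>R ivec m + (2 * pi) *\<^sub>R ivec n" by blast
  qed
  show "transp (torus_rel :: real^'n \<Rightarrow> real^'n \<Rightarrow> bool)"
    unfolding transp_def torus_rel_def
  proof clarify
    fix z :: "real^'n" and m n
    have "z + (2 * pi) *\<^sub>R ivec m + (2 * pi) *\<^sub>R ivec n = z + (2 * pi) *\<^sub>R ivec (m + n)"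
      by (simp add: ivec_simps algebra_simps)
    then show "\<exists>k. z + (2 * pi) *\<^sub>R ivec m + (2 * pi) *\<^sub>R ivec n = z + (2 * pi) *\<^sub>R ivec k" by blast
  qed
qed

instantiation torus :: (finite) ab_group_add
begin

lift_definition zero_torus :: "'a torus" is 0 .

lift_definition plus_torus :: "'a torus \<Rightarrow> 'a torus \<Rightarrow> 'a torus" is "(+)"
proof -
  fix a b c d :: "real^'a" assume "torus_rel a b" "torus_rel c d"
  then obtain m n where "a = b + (2 * pi) *\<^sub>R ivec m" "c = d + (2 * pi) *\<^sub>R ivec n"
    unfolding torus_rel_def by blast
  then have "a + c = (b + d) + (2 * pi) *\<^sub>R ivec (m + n)"
    by (simp add: ivec_simps algebra_simps)
  then show "torus_rel (a + c) (b + d)" unfolding torus_rel_def by blast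
qed

lift_definition uminus_torus :: "'a torus \<Rightarrow> 'a torus" is uminus
proof -
  fix a b :: "real^'a" assume "torus_rel a b"
  then obtain m where "a = b + (2 * pi) *\<^sub>R ivec m" unfolding torus_rel_def by blast
  then have "- a = - b + (2 * pi) *\<^sub>R ivec (- m)" by (simp add: ivec_simps algebra_simps)
  then show "torus_rel (- a) (- b)" unfolding torus_rel_def by blast
qed

definition minus_torus :: "'a torus \<Rightarrow> 'a torus \<Rightarrow> 'a torus" where
  "minus_torus x y = x + (- y)"

instance
proof
  fix a b c :: "'a torus"
  have R: "torus_rel x x" for x :: "real^'a" using torus.abs_eq_iff by blast
  show "a + b + c = a + (b + c)" by transfer (simp add: add.assoc R)
  show "a + b = b + a" by transfer (simp add: add.commute R)
  show "0 + a = a" by transfer (simp add: R)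
  show "- a + a = 0" by transfer (simp add: R)
  show "a - b = a + - b" by (rule minus_torus_def)
qed

end

instantiation torus :: (finite) topological_space
begin

text \<open>The quotient topology.\<close>
definition open_torus :: "'a torus set \<Rightarrow> bool" where
  "open_torus U \<longleftrightarrow> open (abs_torus -` U)"

instance
  by standard (auto simp: open_torus_def vimage_Union)

end

definition fundamental_cell :: "(real^'n) set" where
  "fundamental_cell = {q. \<forall>i. - pi \<le> q $ i \<and> q $ i < pi}"


section \<open>Total curvature of level sets\<close>

definition grad :: "('a::real_inner \<Rightarrow> real) \<Rightarrow> 'a \<Rightarrow> 'a" where
  "grad f x = (THE g. GDERIV f x :> g)"

definition unit_normal :: "('a::real_inner \<Rightarrow> real) \<Rightarrow> 'a \<Rightarrow> 'a" where
  "unit_normal f x = grad f x /\<^sub>R norm (grad f x)"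

text \<open>
  The Weingarten map of the level set of \<open>f\<close> through a regular point \<open>x\<close> is the derivative of the
  unit normal restricted to the tangent space.  The set below is its eigenspace for \<open>\<mu>\<close>.  As the
  Weingarten map is self-adjoint, the multiplicity of a principal curvature is the dimension of
  its eigenspace.
\<close>
definition curvature_space :: "('a::euclidean_space \<Rightarrow> real) \<Rightarrow> 'a \<Rightarrow> real \<Rightarrow> 'a set" where
  "curvature_space f x \<mu> =
     {u. u \<bullet> grad f x = 0 \<and> frechet_derivative (unit_normal f) (at x) u = \<mu> *\<^sub>R u}"

definition principal_curvatures :: "('a::euclidean_space \<Rightarrow> real) \<Rightarrow> 'a \<Rightarrow> real set" where
  "principal_curvatures f x = {\<mu>. \<exists>u \<in> curvature_space f x \<mu>. u \<noteq> 0}"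

definition total_curvature :: "('a::euclidean_space \<Rightarrow> real) \<Rightarrow> 'a \<Rightarrow> real" where
  "total_curvature f x = (\<Prod>\<mu> \<in> principal_curvatures f x. \<mu> ^ dim (curvature_space f x \<mu>))"

lemma has_derivative_periodic:
  fixes f :: "'a::real_normed_vector \<Rightarrow> 'b::real_normed_vector"
  assumes "\<And>y. f (y + p) = f y"
  shows "(f has_derivative D) (at (x + p)) \<longleftrightarrow> (f has_derivative D) (at x)"
proof -
  have A: "(h has_derivative D) (at y)"
    if "\<And>y. h (y + q) = h y" "(h has_derivative D) (at (y + q))" for h :: "'a \<Rightarrow> 'b" and q y
  proof -
    have "((\<lambda>z. z + q) has_derivative (\<lambda>z. z)) (at y)"
      by (auto intro!: derivative_eq_intros)
    from has_derivative_compose[OF this that(2)] show ?thesis by (simp add: that(1))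
  qed
  have "f (y + - p) = f y" for y using assms[of "y + - p"] by simp
  from A[of f "- p" "x + p", OF this] A[of f p x, OF assms] show ?thesis by auto
qed

lemma grad_periodic:
  assumes "\<And>y. f (y + p) = f y"
  shows "grad f (x + p) = grad f x"
  unfolding grad_def gderiv_def using has_derivative_periodic[of f p, OF assms] by simp

lemma total_curvature_periodic:
  assumes "\<And>y. f (y + p) = f y"
  shows "total_curvature f (x + p) = total_curvature f x"
proof -
  have "unit_normal f (y + p) = unit_normal f y" for y
    unfolding unit_normal_def by (simp add: grad_periodic[of f p, OF assms])
  from has_derivative_periodic[of "unit_normal f" p, OF this]
  have "frechet_derivative (unit_normal f) (at (x + p)) = frechet_derivative (unit_normal f) (at x)"
    unfolding frechet_derivative_def by simp
  then show ?thesis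
    unfolding total_curvature_def principal_curvatures_def curvature_space_def
    by (simp add: grad_periodic[of f p, OF assms])
qed


section \<open>Surface measure and \<open>L\<^sub>2\<close> norm\<close>

text \<open>
  Hausdorff measure, normalised so that it agrees with \<open>n\<close>-dimensional surface area on smooth
  \<open>n\<close>-dimensional submanifolds.  The supremum below is a metric outer measure, hence countably
  additive on the Borel sets, so it is the value of the constructed measure there.
\<close>
definition hausdorff_pre :: "nat \<Rightarrow> real \<Rightarrow> 'a::metric_space set \<Rightarrow> ennreal" where
  "hausdorff_pre n \<delta> A =
     (INF U \<in> {U :: nat \<Rightarrow> 'a set. A \<subseteq> (\<Union>i. U i) \<and> (\<forall>i. bounded (U i) \<and> diameter (U i) \<le> \<delta>)}.
        \<Sum>i. if U i = {} then 0 else ennreal (unit_ball_vol (real n) * (diameter (U i) / 2) ^ n))"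

definition hausdorff_measure :: "nat \<Rightarrow> 'a::metric_space measure" where
  "hausdorff_measure n = measure_of UNIV (sets borel) (\<lambda>A. SUP \<delta> \<in> {0<..}. hausdorff_pre n \<delta> A)"

definition sphere_measure :: "(real^'n) measure" where
  "sphere_measure = restrict_space (hausdorff_measure (CARD('n) - 1)) (sphere 0 1)"

text \<open>The norm takes values in \<open>[0, \<infinity>]\<close>.\<close>
definition L2_norm_on :: "'a measure \<Rightarrow> 'a set \<Rightarrow> ('a \<Rightarrow> complex) \<Rightarrow> ennreal" where
  "L2_norm_on M N f =
     (let I = (\<integral>\<^sup>+ z \<in> N. ennreal ((cmod (f z))\<^sup>2) \<partial>M)
      in if I = \<infinity> then \<infinity> else ennreal (sqrt (enn2real I)))"


section \<open>The discrete Schroedinger operator: level surfaces and Born amplitude\<close>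

definition Lam :: "nat \<Rightarrow> real set" where
  "Lam d = {\<zeta>. 2 * real d - 4 < \<bar>\<zeta>\<bar> \<and> \<bar>\<zeta>\<bar> < 2 * real d}"

definition phi :: "real^'n \<Rightarrow> real" where
  "phi k = 2 * (\<Sum>i\<in>UNIV. cos (k $ i))"

lemma phi_periodic: "phi (y + (2 * pi) *\<^sub>R ivec m) = phi y"
proof -
  have "cos (a + 2 * pi * real_of_int j) = cos a" for a j
    by (metis cos_add cos_int_2pin sin_int_2pin diff_zero mult.right_neutral mult_zero_right)
  then show ?thesis by (simp add: phi_def ivec_def)
qed

lift_definition torus_phi :: "'n::finite torus \<Rightarrow> real" is phi
  by (auto simp: torus_rel_def phi_periodic)

lift_definition torus_grad_phi :: "'n::finite torus \<Rightarrow> real^'n" is "grad phi"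
  by (auto simp: torus_rel_def grad_periodic[where f = phi, OF phi_periodic])

lift_definition torus_total_curvature :: "'n::finite torus \<Rightarrow> real" is "total_curvature phi"
  by (auto simp: torus_rel_def total_curvature_periodic[where f = phi, OF phi_periodic])

definition Gam :: "real \<Rightarrow> 'n::finite torus set" where
  "Gam lam = {k. torus_phi k = lam}"

text \<open>
  The projection to the torus is a bijective local isometry from the fundamental cell (with
  opposite faces identified), so surface measure may be computed there and pushed forward.
\<close>
definition Gam_measure :: "real \<Rightarrow> 'n::finite torus measure" where
  "Gam_measure lam =
     distr (restrict_space (hausdorff_measure (CARD('n) - 1)) {q \<in> fundamental_cell. phi q = lam})
       borel abs_torus"

text \<open>Well-defined for \<open>\<omega>\<close> a unit vector, \<open>lam \<in> Lam CARD('n)\<close> and \<open>CARD('n) \<ge> 2\<close>.\<close>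
definition kappa :: "real^'n \<Rightarrow> real \<Rightarrow> 'n::finite torus" where
  "kappa \<omega> lam = (THE k. k \<in> Gam lam \<and> torus_grad_phi k /\<^sub>R norm (torus_grad_phi k) = \<omega>)"

definition curv :: "real^'n::finite \<Rightarrow> real \<Rightarrow> real" where
  "curv \<omega> lam = torus_total_curvature (kappa \<omega> lam)"

lift_definition vhat :: "(int^'n::finite \<Rightarrow> complex) \<Rightarrow> 'n torus \<Rightarrow> complex" is
  "\<lambda>v p. of_real ((2 * pi) powr (- (real CARD('n) / 2))) *
          (\<Sum>\<^sub>\<infinity>x. v x * exp (- (\<i> * of_real (p \<bullet> ivec x))))"
proof -
  fix v :: "int^'n \<Rightarrow> complex" and p q :: "real^'n"
  assume "torus_rel p q"
  then obtain m where p: "p = q + (2 * pi) *\<^sub>R ivec m" unfolding torus_rel_def by blast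
  have "exp (- (\<i> * of_real (p \<bullet> ivec x))) = exp (- (\<i> * of_real (q \<bullet> ivec x)))" for x :: "int^'n"
  proof -
    have "ivec m \<bullet> ivec x = of_int (\<Sum>i\<in>UNIV. m $ i * x $ i)"
      by (simp add: ivec_def inner_vec_def)
    then have "- (\<i> * of_real (p \<bullet> ivec x)) = - (\<i> * of_real (q \<bullet> ivec x))
        + of_real (of_int (2 * (- (\<Sum>i\<in>UNIV. m $ i * x $ i))) * pi) * \<i>"
      by (simp add: p inner_add_left algebra_simps)
    then show ?thesis unfolding exp_eq by blast
  qed
  then show "of_real ((2 * pi) powr (- (real CARD('n) / 2))) *
          (\<Sum>\<^sub>\<infinity>x. v x * exp (- (\<i> * of_real (p \<bullet> ivec x)))) =
        of_real ((2 * pi) powr (- (real CARD('n) / 2))) *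
          (\<Sum>\<^sub>\<infinity>x. v x * exp (- (\<i> * of_real (q \<bullet> ivec x))))"
    by simp
qed

definition born_amplitude ::
    "real \<Rightarrow> (int^'n::finite \<Rightarrow> complex) \<Rightarrow> 'n torus \<times> (real^'n) \<Rightarrow> complex" where
  "born_amplitude lam v = (\<lambda>(k, \<omega>).
     let \<sigma> = real CARD('n) - 1 in
     - (of_real (sqrt (2 * pi)) * vhat v (kappa (- \<omega>) lam - k)
          * exp (- (\<i> * of_real ((\<sigma> + 2) * pi / 4))))
       / of_real (sqrt \<bar>curv \<omega> lam\<bar> * norm (torus_grad_phi (kappa \<omega> lam))))"

end

theory Submission
  imports Defs
begin

text \<open>
  The amplitude depends linearly on the potential, and potentials supported in \<open>D\<close> form a
  finite-dimensional space.  So the estimate is injectivity made quantitative: the amplitude on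
  \<open>N\<close> must determine the potential, and the \<open>L\<^sub>2\<close> norm over \<open>N\<close> must notice it.

  Injectivity.  Up to a factor without zeros, the amplitude at \<open>(k, \<omega>)\<close> is \<open>f (q - k)\<close>, where \<open>f\<close> is
  a trigonometric polynomial with the values of the potential as coefficients and \<open>q
      = \<kappa>(- \<omega>)\<close>.  As
  \<open>\<omega>\<close> varies, \<open>q\<close> sweeps out a piece of the level surface.  Suppose that \<open>f (q - k)\<close> vanishes for
  \<open>q\<close> and \<open>k\<close> in pieces of the surface, and that the normals at \<open>q\<close> and \<open>k\<close> are not parallel.  Moving \<open>q\<close>
  along the surface shows that the derivative of \<open>f\<close> at \<open>q - k\<close> kills the tangent space at \<open>q\<close>;
  moving \<open>k\<close> shows that it kills the tangent space at \<open>k\<close>.  The two together span everything, so all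
  first derivatives of \<open>f\<close> vanish at \<open>q - k\<close> as well.  Differentiating multiplies the coefficient at
  \<open>x\<close> by a coordinate of \<open>x\<close>, so the argument can be iterated and the coefficients may be multiplied
  by any polynomial in \<open>x\<close>; a polynomial that singles out one point of the support shows that the
  coefficient there is zero (\<open>vanishes_on_coordinate\<close>, \<open>vanishes_on_imp_zero\<close>,
  \<open>amplitude_determines_potential\<close>).  The dimension being at least 2 enters when a pair with
  non-parallel normals is chosen.

  Stability.  By compactness of the unit sphere of coefficient families, finitely many points of \<open>N\<close>
  already detect every potential (\<open>finite_sampling_set\<close>).  Around each of them there is a box in \<open>N\<close> on
  which the characters hardly change (\<open>uniform_box\<close>).  On one of these boxes the amplitude is bounded below
    by a
  multiple of the norm of the potential, and it remains to see that the boxes have positive measure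
  and that the denominator of the amplitude is bounded.

  Geometry.  All facts about the surface come from one inequality, \<open>negative_cosine_bound\<close>: on a level
  \<open>\<lambda>\<close> with \<open>2 d - 4 < \<bar>\<lambda>\<bar>\<close>, after adjusting the sign, at most one cosine of a coordinate is not
  positive, and the others outweigh it.  It gives definiteness of the second fundamental form, hence
  non-zero curvature (\<open>tangential_hessian_pos\<close>), and injectivity of the Gauss map
  (\<open>cosines_unique\<close>).  Continuity of \<open>\<kappa>\<close> then follows from its graph being closed.

  Measure.  The Hausdorff set function is a metric outer measure, so it is countably additive on the
  Borel sets.  A piece of surface has positive measure because thickening it by a segment in a
  transversal coordinate direction yields a set with interior (\<open>negligible_slab\<close>,
  \<open>slab_level_set_neighbourhood\<close>).  The sphere has finite measure, which makes the product measure
  multiplicative on boxes.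
\<close>

section \<open>Hausdorff measure on the Borel sets\<close>

definition cover_term :: "nat \<Rightarrow> 'a::metric_space set \<Rightarrow> ennreal" where
  "cover_term n S = (if S = {} then 0 else ennreal (unit_ball_vol (real n) * (diameter S / 2) ^ n))"

definition hausdorff_outer :: "nat \<Rightarrow> 'a::metric_space set \<Rightarrow> ennreal" where
  "hausdorff_outer n A = (SUP \<delta> \<in> {0<..}. hausdorff_pre n \<delta> A)"

lemma cover_term_empty [simp]: "cover_term n {} = 0"
  by (simp add: cover_term_def)

lemma hausdorff_pre_le:
  assumes "A \<subseteq> (\<Union>i. U i)" "\<And>i. bounded (U i)" "\<And>i. diameter (U i) \<le> \<delta>"
  shows "hausdorff_pre n \<delta> A \<le> (\<Sum>i. cover_term n (U i))"
  unfolding hausdorff_pre_def cover_term_def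
  by (rule INF_lower2[where i = U]) (use assms in auto)

lemma hausdorff_pre_cover:
  assumes "hausdorff_pre n \<delta> A < c"
  obtains U where "A \<subseteq> (\<Union>i. U i)" "\<And>i. bounded (U i)" "\<And>i. diameter (U i) \<le> \<delta>"
    "(\<Sum>i. cover_term n (U i)) < c"
proof -
  from assms[unfolded hausdorff_pre_def INF_less_iff] obtain U
    where "U \<in> {U. A \<subseteq> (\<Union>i. U i) \<and> (\<forall>i. bounded (U i) \<and> diameter (U i) \<le> \<delta>)}"
      "(\<Sum>i. cover_term n (U i)) < c"
    unfolding cover_term_def by blast
  then show thesis using that by auto
qed

lemma hausdorff_pre_greatest:
  assumes "\<And>U. A \<subseteq> (\<Union>i. U i) \<Longrightarrow>
      (\<And>i. bounded (U i)) \<Longrightarrow> (\<And>i. diameter (U i) \<le> \<delta>)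
    \<Longrightarrow> c \<le> (\<Sum>i. cover_term n (U i))"
  shows "c \<le> hausdorff_pre n \<delta> A"
  using hausdorff_pre_cover assms by (metis not_le)

lemma hausdorff_pre_mono: "A \<subseteq> B \<Longrightarrow>
    hausdorff_pre n \<delta> A \<le> hausdorff_pre n \<delta> B"
  by (rule hausdorff_pre_greatest, rule hausdorff_pre_le) auto

lemma hausdorff_pre_antimono: "\<delta> \<le> \<epsilon> \<Longrightarrow>
    hausdorff_pre n \<epsilon> A \<le> hausdorff_pre n \<delta> A"
  by (rule hausdorff_pre_greatest, rule hausdorff_pre_le) (auto intro: order_trans)

lemma hausdorff_pre_empty: "0 \<le> \<delta> \<Longrightarrow> hausdorff_pre n \<delta> {} = 0"
  using hausdorff_pre_le[of "{}" "\<lambda>_. {}" \<delta> n] by simp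

text \<open>
  Covers of the sets \<open>A i\<close> that are optimal up to \<open>e / 2 ^ (i
      + 1)\<close> combine into a cover of the union.
\<close>
lemma hausdorff_pre_countably_subadditive:
  "hausdorff_pre n \<delta> (\<Union>i. A i) \<le> (\<Sum>i. hausdorff_pre n \<delta> (A i))"
proof (rule ennreal_le_epsilon)
  fix e :: real assume fin: "(\<Sum>i. hausdorff_pre n \<delta> (A i)) < top" and e: "0 < e"
  have "\<exists>U. A i \<subseteq> (\<Union>j. U j) \<and> (\<forall>j. bounded (U j)) \<and> (\<forall>j. diameter (U j) \<le> \<delta>) \<and>
     (\<Sum>j. cover_term n (U j)) \<le> hausdorff_pre n \<delta> (A i) + ennreal (e * (1/2) ^ Suc i)" for i
  proof -
    have "hausdorff_pre n \<delta> (A i) < top"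
      using fin ennreal_suminf_lessD by blast
    then have "hausdorff_pre n \<delta> (A i) < hausdorff_pre n \<delta> (A i)
        + ennreal (e * (1/2) ^ Suc i)"
      using e by (cases "hausdorff_pre n \<delta> (A i)" rule: ennreal_cases)
        (auto simp: ennreal_less_iff simp flip: ennreal_plus)
    then show ?thesis by (rule hausdorff_pre_cover) (blast intro: less_imp_le)
  qed
  then obtain U where U: "\<And>i. A i \<subseteq> (\<Union>j. U i j)" "\<And>i j. bounded (U i j)"
    "\<And>i j. diameter (U i j) \<le> \<delta>"
    "\<And>i. (\<Sum>j. cover_term n (U i j))
        \<le> hausdorff_pre n \<delta> (A i) + ennreal (e * (1/2) ^ Suc i)"
    by metis
  have "hausdorff_pre n \<delta> (\<Union>i. A i)
      \<le> (\<Sum>k. cover_term n (case_prod U (prod_decode k)))"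
  proof (rule hausdorff_pre_le)
    show "(\<Union>i. A i) \<subseteq> (\<Union>k. case_prod U (prod_decode k))"
    proof
      fix x assume "x \<in> (\<Union>i. A i)"
      then obtain i j where "x \<in> U i j" using U(1) by blast
      then have "x \<in> case_prod U (prod_decode (prod_encode (i, j)))" by simp
      then show "x \<in> (\<Union>k. case_prod U (prod_decode k))" by (rule UN_I[OF UNIV_I])
    qed
  qed (use U(2,3) in \<open>auto split: prod.split\<close>)
  also have "\<dots> = (\<Sum>k. (\<lambda>(i, j). cover_term n (U i j)) (prod_decode k))"
    by (simp add: case_prod_unfold)
  also have "\<dots> = (\<Sum>i. \<Sum>j. cover_term n (U i j))"
    by (rule suminf_ennreal_2dimen) (simp add: case_prod_unfold)
  also have "\<dots> \<le> (\<Sum>i. hausdorff_pre n \<delta> (A i) + ennreal (e * (1/2) ^ Suc i))"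
    by (intro suminf_le U summableI)
  also have "\<dots> = (\<Sum>i. hausdorff_pre n \<delta> (A i)) + (\<Sum>i. ennreal (e * (1/2) ^ Suc i))"
    by (rule suminf_add[symmetric]) (auto intro: summableI)
  also have "(\<Sum>i. ennreal (e * (1/2) ^ Suc i)) = ennreal e"
    using e sums_mult[OF power_half_series, of e] by (intro suminf_ennreal_eq) auto
  finally show "hausdorff_pre n \<delta> (\<Union>i. A i)
      \<le> (\<Sum>i. hausdorff_pre n \<delta> (A i)) + ennreal e" .
qed

text \<open>
  A set of diameter less than \<open>d\<close> cannot meet both \<open>A\<close> and \<open>B\<close>, so a cover of the union splits into a
  cover of \<open>A\<close> and a cover of \<open>B\<close>.
\<close>
lemma hausdorff_pre_separated:
  assumes sep: "\<And>a b. a \<in> A \<Longrightarrow> b \<in> B \<Longrightarrow>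
      d \<le> dist a b" and d: "\<delta> < d"
  shows "hausdorff_pre n \<delta> A + hausdorff_pre n \<delta> B
      \<le> hausdorff_pre n \<delta> (A \<union> B)"
proof (rule hausdorff_pre_greatest)
  fix U :: "nat \<Rightarrow> 'a set"
  assume U: "A \<union> B \<subseteq> (\<Union>i. U i)" "\<And>i. bounded (U i)" "\<And>i. diameter (U i) \<le> \<delta>"
  define U1 where "U1 i = (if U i \<inter> A \<noteq> {} then U i else {})" for i
  define U2 where "U2 i = (if U i \<inter> A \<noteq> {} then {} else U i)" for i
  have no: "U i \<inter> A = {}" if "b \<in> U i" "b \<in> B" for i b
  proof (rule ccontr)
    assume "U i \<inter> A \<noteq> {}"
    then obtain a where a: "a \<in> U i" "a \<in> A" by blast
    have "dist a b \<le> \<delta>"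
      using diameter_bounded_bound[OF U(2) a(1) that(1)] U(3)[of i] by linarith
    then show False using sep[OF a(2) that(2)] d by linarith
  qed
  have "0 \<le> diameter (U 0)" using diameter_ge_0[OF U(2)] .
  then have "0 \<le> \<delta>" using U(3)[of 0] by linarith
  have 1: "hausdorff_pre n \<delta> A \<le> (\<Sum>i. cover_term n (U1 i))"
  proof (rule hausdorff_pre_le)
    show "A \<subseteq> (\<Union>i. U1 i)"
    proof
      fix a assume "a \<in> A"
      then obtain i where "a \<in> U i" using U(1) by blast
      then have "a \<in> U1 i" using \<open>a \<in> A\<close> by (auto simp: U1_def)
      then show "a \<in> (\<Union>i. U1 i)" by blast
    qed
  qed (use U \<open>0 \<le> \<delta>\<close> in \<open>auto simp: U1_def\<close>)
  have 2: "hausdorff_pre n \<delta> B \<le> (\<Sum>i. cover_term n (U2 i))"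
  proof (rule hausdorff_pre_le)
    show "B \<subseteq> (\<Union>i. U2 i)"
    proof
      fix b assume "b \<in> B"
      then obtain i where "b \<in> U i" using U(1) by blast
      then have "b \<in> U2 i" using no \<open>b \<in> B\<close> by (simp add: U2_def)
      then show "b \<in> (\<Union>i. U2 i)" by blast
    qed
  qed (use U \<open>0 \<le> \<delta>\<close> in \<open>auto simp: U2_def\<close>)
  have "(\<Sum>i. cover_term n (U1 i)) + (\<Sum>i. cover_term n (U2 i))
      = (\<Sum>i. cover_term n (U1 i) + cover_term n (U2 i))"
    by (rule suminf_add) (auto intro: summableI)
  also have "\<dots> = (\<Sum>i. cover_term n (U i))"
    by (intro suminf_cong) (simp add: U1_def U2_def)
  finally show "hausdorff_pre n \<delta> A + hausdorff_pre n \<delta> B \<le> (\<Sum>i. cover_term n (U i))"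
    using add_mono[OF 1 2] by simp
qed

lemma hausdorff_outer_separated:
  assumes "\<And>a b. a \<in> A \<Longrightarrow> b \<in> B \<Longrightarrow> d \<le> dist a b" and "0 < d"
  shows "hausdorff_outer n A + hausdorff_outer n B \<le> hausdorff_outer n (A \<union> B)"
proof -
  have "hausdorff_outer n A + hausdorff_outer n B
      = (SUP \<delta>\<in>{0<..}. hausdorff_pre n \<delta> A + hausdorff_pre n \<delta> B)"
    unfolding hausdorff_outer_def
  proof (rule SUP_add_directed_ennreal[symmetric])
    fix \<delta> \<epsilon> :: real assume "\<delta> \<in> {0<..}" "\<epsilon> \<in> {0<..}"
    then show "\<exists>k\<in>{0<..}. hausdorff_pre n \<delta> A + hausdorff_pre n \<epsilon> B
         \<le> hausdorff_pre n k A + hausdorff_pre n k B"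
      by (intro bexI[of _ "min \<delta> \<epsilon>"] add_mono hausdorff_pre_antimono) auto
  qed
  also have "\<dots> \<le> hausdorff_outer n (A \<union> B)"
  proof (rule SUP_least)
    fix \<delta> :: real assume "\<delta> \<in> {0<..}"
    then have "0 < min \<delta> (d/2)" using assms(2) by auto
    have "hausdorff_pre n \<delta> A + hausdorff_pre n \<delta> B
        \<le> hausdorff_pre n (min \<delta> (d/2)) A + hausdorff_pre n (min \<delta> (d/2)) B"
      by (intro add_mono hausdorff_pre_antimono) auto
    also have "\<dots> \<le> hausdorff_pre n (min \<delta> (d/2)) (A \<union> B)"
      by (rule hausdorff_pre_separated[where d = d]) (use assms in auto)
    also have "\<dots> \<le> hausdorff_outer n (A \<union> B)"
      unfolding hausdorff_outer_def using \<open>0 < min \<delta> (d/2)\<close> by (intro SUP_upper) auto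
    finally show "hausdorff_pre n \<delta> A + hausdorff_pre n \<delta> B
        \<le> hausdorff_outer n (A \<union> B)" .
  qed
  finally show ?thesis .
qed

lemma hausdorff_outer_empty: "hausdorff_outer n {} = 0"
  unfolding hausdorff_outer_def by (simp add: hausdorff_pre_empty)

lemma hausdorff_outer_mono: "A \<subseteq> B \<Longrightarrow>
    hausdorff_outer n A \<le> hausdorff_outer n B"
  unfolding hausdorff_outer_def by (auto intro!: SUP_mono' hausdorff_pre_mono)

lemma hausdorff_outer_countably_subadditive:
  "hausdorff_outer n (\<Union>i. A i) \<le> (\<Sum>i. hausdorff_outer n (A i))"
  unfolding hausdorff_outer_def
proof (rule SUP_least)
  fix \<delta> :: real assume "\<delta> \<in> {0<..}"
  have "hausdorff_pre n \<delta> (\<Union>i. A i) \<le> (\<Sum>i. hausdorff_pre n \<delta> (A i))"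
    by (rule hausdorff_pre_countably_subadditive)
  also have "\<dots> \<le> (\<Sum>i. SUP \<delta>\<in>{0<..}. hausdorff_pre n \<delta> (A i))"
    using \<open>\<delta> \<in> {0<..}\<close> by (intro suminf_le SUP_upper summableI) auto
  finally show "hausdorff_pre n \<delta> (\<Union>i. A i)
      \<le> (\<Sum>i. SUP \<delta>\<in>{0<..}. hausdorff_pre n \<delta> (A i))" .
qed

text \<open>
  Caratheodory's criterion for metric outer measures.  The points of \<open>X\<close> at distance at least
  \<open>1 / (k + 1)\<close> from \<open>C\<close> form a set \<open>A k\<close> that is separated from \<open>C\<close>, so only the remainder of \<open>X - C\<close>
  has to be shown to be small.  It is a union of annuli \<open>R j\<close>.  Annuli whose indices differ
    by at
  least 2 are separated, so the even ones and the odd ones each have total measure at most \<open>f X\<close>; the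
  measures of all annuli are therefore summable and their tails tend to zero.
\<close>
lemma metric_outer_measure_closed:
  fixes f :: "'a::metric_space set \<Rightarrow> ennreal"
  assumes f0: "f {} = 0" and mono: "\<And>A B. A \<subseteq> B \<Longrightarrow> f A \<le> f B"
    and csub: "\<And>A :: nat \<Rightarrow> 'a set. f (\<Union>i. A i) \<le> (\<Sum>i. f (A i))"
    and sep: "\<And>A B d. (\<And>a b. a \<in> A \<Longrightarrow> b \<in> B \<Longrightarrow>
        d \<le> dist a b) \<Longrightarrow> 0 < d \<Longrightarrow> f A + f B \<le> f (A \<union> B)"
    and C: "closed C"
  shows "f (X \<inter> C) + f (X - C) = f X"
proof -
  have sub2: "f (A \<union> B) \<le> f A + f B" for A B
  proof -
    have "f (A \<union> B) = f (\<Union>i. binaryset A B i)" by (simp add: UN_binaryset_eq)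
    also have "\<dots> \<le> (\<Sum>i. f (binaryset A B i))" by (rule csub)
    also have "\<dots> = f A + f B" by (rule suminf_binaryset_eq) (rule f0)
    finally show ?thesis .
  qed
  have "f (X \<inter> C) + f (X - C) \<le> f X"
  proof (cases "C = {} \<or> f X = top")
    case True then show ?thesis by (auto simp: f0)
  next
    case False
    then have Cne: "C \<noteq> {}" and fin: "f X < top" by (auto simp: top.not_eq_extremum)
    define A where "A k = {x \<in> X. 1 / real (Suc k) \<le> infdist x C}" for k
    define R where "R k = A (Suc k) - A k" for k
    have AX: "A k \<subseteq> X" for k by (auto simp: A_def)
    have Amono: "A j \<subseteq> A k" if "j \<le> k" for j k
    proof -
      have "1 / real (Suc k) \<le> 1 / real (Suc j)" using that by (simp add: frac_le)
      then show ?thesis by (auto simp: A_def)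
    qed
    have Asep: "f S + f T \<le> f (S \<union> T)"
      if "S \<subseteq> A k" "T \<subseteq> X - A (Suc k)" for S T k
    proof (rule sep)
      fix a b assume "a \<in> S" "b \<in> T"
      then have "1 / real (Suc k) \<le> infdist a C" "infdist b C \<le> 1 / real (Suc (Suc k))"
        using that by (auto simp: A_def)
      then show "1 / real (Suc k) - 1 / real (Suc (Suc k)) \<le> dist a b"
        using infdist_triangle[of a C b] by linarith
    next
      show "0 < 1 / real (Suc k) - 1 / real (Suc (Suc k))" by (simp add: frac_less2)
    qed
    have alt: "(\<Sum>j<m. f (R (2 * j + p))) \<le> f (\<Union>j<m. R (2 * j + p))" for m p
    proof (induction m)
      case (Suc m)
      have "f (\<Union>j<m. R (2 * j + p)) + f (R (2 * m + p))
          \<le> f ((\<Union>j<m. R (2 * j + p)) \<union> R (2 * m + p))"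
      proof (cases m)
        case (Suc m')
        show ?thesis
        proof (rule Asep)
          show "(\<Union>j<m. R (2 * j + p)) \<subseteq> A (2 * m' + 1 + p)"
          proof (rule UN_least)
            fix j assume "j \<in> {..<m}"
            then have "Suc (2 * j + p) \<le> 2 * m' + 1 + p" using Suc by simp
            from Amono[OF this] show "R (2 * j + p) \<subseteq> A (2 * m' + 1 + p)" by (auto simp: R_def)
          qed
          show "R (2 * m + p) \<subseteq> X - A (Suc (2 * m' + 1 + p))"
            using AX Suc by (auto simp: R_def)
        qed
      qed (simp add: f0)
      also have "(\<Union>j<m. R (2 * j + p)) \<union> R (2 * m + p) = (\<Union>j<Suc m. R (2 * j + p))"
        by (auto simp: lessThan_Suc)
      finally have "f (\<Union>j<m. R (2 * j + p)) + f (R (2 * m + p))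
          \<le> f (\<Union>j<Suc m. R (2 * j + p))" .
      then have "(\<Sum>j<m. f (R (2 * j + p))) + f (R (2 * m + p))
          \<le> f (\<Union>j<Suc m. R (2 * j + p))"
        by (rule order_trans[OF add_right_mono[OF Suc.IH]])
      then show ?case by simp
    qed (simp add: f0)
    have half: "(\<Sum>j<m. f (R (2 * j + p))) \<le> f X" for m p
      by (rule order_trans[OF alt mono]) (use AX in \<open>auto simp: R_def\<close>)
    have "(\<Sum>j. f (R j)) \<le> f X + f X"
    proof (rule suminf_le_const[OF summableI])
      fix m :: nat
      have "(\<Sum>j<m. f (R j)) \<le> (\<Sum>j<2*m. f (R j))"
        by (rule sum_mono2) auto
      also have "\<dots> = (\<Sum>j<m. f (R (2 * j + 0))) + (\<Sum>j<m. f (R (2 * j + 1)))"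
        by (induction m) (auto simp: algebra_simps)
      also have "\<dots> \<le> f X + f X" by (intro add_mono half)
      finally show "(\<Sum>j<m. f (R j)) \<le> f X + f X" .
    qed
    also have "\<dots> < top" using fin by simp
    finally have sfin: "(\<Sum>j. f (R j)) < top" .
    define r where "r j = enn2real (f (R j))" for j
    have "f (R j) < top" for j using sfin ennreal_suminf_lessD by blast
    then have fr: "f (R j) = ennreal (r j)" and r0: "0 \<le> r j" for j by (simp_all add: r_def)
    have sr: "summable r"
      by (rule summable_suminf_not_top) (use sfin in \<open>auto simp: r0 fr\<close>)
    show ?thesis
    proof (rule ennreal_le_epsilon)
      fix e :: real assume "0 < e"
      from suminf_exist_split[OF this sr] obtain k where k: "norm (\<Sum>j. r (j + k)) < e" by blast
      have "X - C \<subseteq> A k \<union> (\<Union>j. R (j + k))"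
      proof
        fix x assume x: "x \<in> X - C"
        then have "0 < infdist x C"
          using C Cne by (simp add: infdist_pos_not_in_closed)
        then obtain m where "1 / real (Suc m) < infdist x C"
          using reals_Archimedean[of "infdist x C"] by (auto simp: inverse_eq_divide)
        then have "\<exists>m. x \<in> A m" using x by (auto simp: A_def intro!: exI[of _ m])
        then obtain m where m: "x \<in> A m" "\<And>j. j < m \<Longrightarrow> x \<notin> A j"
          using exists_least_iff[of "\<lambda>m. x \<in> A m"] by blast
        show "x \<in> A k \<union> (\<Union>j. R (j + k))"
        proof (cases "m \<le> k")
          case True then show ?thesis using Amono m(1) by blast
        next
          case False
          then have "x \<in> R ((m - 1 - k) + k)" using m by (auto simp: R_def)
          then show ?thesis by blast
        qed
      qed
      then have "f (X - C) \<le> f (A k) + f (\<Union>j. R (j + k))"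
        using mono sub2 order_trans by blast
      also have "f (\<Union>j. R (j + k)) \<le> (\<Sum>j. f (R (j + k)))" by (rule csub)
      also have "\<dots> = ennreal (\<Sum>j. r (j + k))"
        unfolding fr using r0 sr by (intro suminf_ennreal2) (auto simp: summable_iff_shift)
      also have "\<dots> \<le> ennreal e" using k by (intro ennreal_leI) simp
      finally have 1: "f (X - C) \<le> f (A k) + ennreal e" by (simp add: add_left_mono)
      have 2: "f (X \<inter> C) + f (A k) \<le> f (X \<inter> C \<union> A k)"
      proof (rule sep)
        fix a b assume "a \<in> X \<inter> C" "b \<in> A k"
        then have "1 / real (Suc k) \<le> infdist b C" by (simp add: A_def)
        also have "\<dots> \<le> dist b a" using \<open>a \<in> X \<inter> C\<close>
          by (auto intro: infdist_le)
        finally show "1 / real (Suc k) \<le> dist a b" by (simp add: dist_commute)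
      qed simp
      have 3: "f (X \<inter> C \<union> A k) \<le> f X" using AX by (intro mono) auto
      have "f (X \<inter> C) + f (X - C) \<le> f (X \<inter> C) + f (A k) + ennreal e"
        using add_left_mono[OF 1, of "f (X \<inter> C)"] by (simp add: add.assoc)
      also have "\<dots> \<le> f X + ennreal e" using 2 3 by (intro add_right_mono) simp
      finally show "f (X \<inter> C) + f (X - C) \<le> f X + ennreal e" .
    qed
  qed
  moreover have "f X \<le> f (X \<inter> C) + f (X - C)"
    using sub2[of "X \<inter> C" "X - C"] by (simp add: Int_Diff_Un)
  ultimately show ?thesis by (rule antisym)
qed

text \<open>
  A measure built from a set function that is not countably additive would be zero by convention; it is
  Caratheodory's theorem that makes the set function the actual measure on the Borel sets.
\<close>
lemma emeasure_hausdorff_measure: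
  assumes "A \<in> sets borel"
  shows "emeasure (hausdorff_measure n) A = hausdorff_outer n (A :: 'a::metric_space set)"
proof -
  let ?f = "hausdorff_outer n :: 'a set \<Rightarrow> ennreal"
  interpret P: sigma_algebra "UNIV :: 'a set" UNIV
    using sigma_algebra_Pow[of "UNIV :: 'a set"] by simp
  have oms: "outer_measure_space UNIV ?f" 
    unfolding outer_measure_space_def positive_def increasing_def countably_subadditive_def
    by (auto intro: hausdorff_outer_empty hausdorff_outer_mono hausdorff_outer_countably_subadditive)
  have ms: "measure_space UNIV (lambda_system UNIV UNIV ?f) ?f"
    by (rule P.caratheodory_lemma[OF oms])
  then interpret L: sigma_algebra "UNIV :: 'a set" "lambda_system UNIV UNIV ?f"
    by (simp add: measure_space_def)
  have "C \<in> lambda_system UNIV UNIV ?f" if "closed C" for C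
  proof -
    have "?f (X \<inter> C) + ?f (X - C) = ?f X" for X
    proof (rule metric_outer_measure_closed)
      show "?f A + ?f B \<le> ?f (A \<union> B)"
        if "\<And>a b. a \<in> A \<Longrightarrow> b \<in> B \<Longrightarrow>
            d \<le> dist a b" "0 < d" for A B d
        using that by (rule hausdorff_outer_separated)
    qed (use that in \<open>auto intro: hausdorff_outer_empty hausdorff_outer_mono
        hausdorff_outer_countably_subadditive\<close>)
    then show ?thesis by (simp add: P.lambda_system_eq)
  qed
  then have "sigma_sets UNIV (Collect closed) \<subseteq> lambda_system UNIV UNIV ?f"
    by (intro L.sigma_sets_subset) auto
  then have sub: "sets borel \<subseteq> lambda_system UNIV UNIV ?f"
    by (simp add: borel_eq_closed)
  have ca: "countably_additive (sets borel) ?f"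
    using ms sub unfolding measure_space_def countably_additive_def by blast
  have M: "sets (hausdorff_measure n :: 'a measure) = sets borel"
    unfolding hausdorff_measure_def using sets.sigma_sets_eq[of "borel :: 'a measure"] by simp
  show ?thesis
  proof (rule emeasure_measure_of[of _ UNIV "sets borel"])
    show "hausdorff_measure n = measure_of UNIV (sets borel) ?f"
      unfolding hausdorff_measure_def hausdorff_outer_def ..
    show "positive (sets (hausdorff_measure n)) ?f"
      by (simp add: positive_def hausdorff_outer_empty)
    show "countably_additive (sets (hausdorff_measure n)) ?f" using ca M by simp
    show "A \<in> sets (hausdorff_measure n)" using assms M by simp
  qed simp
qed

lemma sets_hausdorff_measure [simp]:
  "sets (hausdorff_measure n :: 'a::metric_space measure) = sets borel"
  "space (hausdorff_measure n :: 'a::metric_space measure) = UNIV"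
  unfolding hausdorff_measure_def using sets.sigma_sets_eq[of "borel :: 'a measure"] by simp_all


section \<open>Measure of pieces of level sets and of the sphere\<close>

text \<open>
  Thickening by a segment in a coordinate direction turns statements about \<open>(n - 1)\<close>-dimensional Hausdorff
  measure into statements about \<open>n\<close>-dimensional Lebesgue measure, without charts.
\<close>
definition slab :: "'n \<Rightarrow> (real^'n) set \<Rightarrow> (real^'n::finite) set" where
  "slab i A = {x + t *\<^sub>R axis i 1 | x t. x \<in> A \<and> \<bar>t\<bar> \<le> 1}"

text \<open>
  A set of diameter \<open>D\<close>, thickened in one direction, fits into a box whose sides in all other directions
  are \<open>2 D\<close>; so its volume is at most a multiple of \<open>D ^ (n - 1)\<close>, the term that it contributes to a
  Hausdorff sum.
\<close>
lemma slab_piece_box: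
  fixes S :: "(real^'n::finite) set"
  assumes "bounded S" "diameter S \<le> 1"
  obtains a b where "slab i S \<subseteq> cbox a b"
    "emeasure lborel (cbox a b)
      \<le> ennreal (4 ^ CARD('n) / unit_ball_vol (real (CARD('n) - 1))) * cover_term (CARD('n) - 1) S"
proof (cases "S = {}")
  case True
  then show thesis by (intro that[of "axis i 1" 0]) (auto simp: slab_def emeasure_lborel_cbox_eq Basis_vec_def inner_axis_axis)
next
  case False
  then obtain p where p: "p \<in> S" by blast
  define D where "D = diameter S"
  have D: "0 \<le> D" "D \<le> 1" using assms diameter_ge_0 by (auto simp: D_def)
  \<comment> \<open>In direction \<open>i\<close> the deviation from \<open>p\<close> is at most \<open>D + 1 \<le> 2\<close>.\<close>
  define h :: "real^'n" where "h = (\<chi> l. if l = i then 2 else D)"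
  let ?n = "CARD('n) - 1"
  define c where "c = unit_ball_vol (real ?n)"
  have c: "0 < c" unfolding c_def by (rule unit_ball_vol_pos) simp
  have sub: "slab i S \<subseteq> cbox (p - h) (p + h)"
  proof
    fix z assume "z \<in> slab i S"
    then obtain x t where z: "z = x + t *\<^sub>R axis i 1" "x \<in> S" "\<bar>t\<bar> \<le> 1"
      by (auto simp: slab_def)
    have "\<bar>x $ l - p $ l\<bar> \<le> D" for l
    proof -
      have "\<bar>x $ l - p $ l\<bar> \<le> norm (x - p)" using component_le_norm_cart[of "x - p" l] by simp
      also have "\<dots> \<le> D"
        using diameter_bounded_bound[OF assms(1) z(2) p] by (simp add: D_def dist_norm)
      finally show ?thesis .
    qed
    then have "\<bar>z $ l - p $ l\<bar> \<le> h $ l" for l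
    proof (cases "l = i")
      case True
      have "\<bar>z $ i - p $ i\<bar> \<le> \<bar>x $ i - p $ i\<bar> + \<bar>t\<bar>"
        by (simp add: z axis_def)
      then show ?thesis using \<open>\<bar>x $ l - p $ l\<bar> \<le> D\<close> D z(3) True
        by (simp add: h_def)
    qed (simp add: z h_def axis_def)
    then show "z \<in> cbox (p - h) (p + h)" by (simp add: mem_box_cart abs_le_iff algebra_simps)
  qed
  have ne: "cbox (p - h) (p + h) \<noteq> {}" using D by (simp add: interval_ne_empty_cart h_def)
  have "measure lborel (cbox (p - h) (p + h)) = (\<Prod>l\<in>UNIV. 2 * h $ l)"
    by (simp add: content_cbox_cart[OF ne])
  also have "\<dots> = (2 * h $ i) * (\<Prod>l\<in>UNIV - {i}. 2 * h $ l)" by (rule prod.remove) auto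
  also have "(\<Prod>l\<in>UNIV - {i}. 2 * h $ l) = (\<Prod>l\<in>UNIV - {i}. 2 * D)"
    by (rule prod.cong) (auto simp: h_def)
  also have "\<dots> = (2 * D) ^ ?n" by (simp add: card_Diff_singleton)
  also have "2 * h $ i * (2 * D) ^ ?n = 4 * 4 ^ ?n * (D / 2) ^ ?n"
    using power_mult_distrib[of 4 "D / 2" ?n] by (simp add: h_def)
  also have "(4::real) * 4 ^ ?n = 4 ^ CARD('n)"
    using power_Suc[of "4::real" ?n] by (simp del: power_Suc)
  finally have "measure lborel (cbox (p - h) (p + h)) = (4 ^ CARD('n) / c) * (c * (D / 2) ^ ?n)"
    using c by simp
  then have "emeasure lborel (cbox (p - h) (p + h)) = ennreal ((4 ^ CARD('n) / c) * (c * (D / 2) ^ ?n))"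
    using emeasure_eq_ennreal_measure[of lborel "cbox (p - h) (p
        + h)"] emeasure_lborel_cbox_finite[of "p - h" "p + h"]
    by (simp add: less_top)
  also have "\<dots> = ennreal (4 ^ CARD('n) / c) * cover_term ?n S"
    unfolding cover_term_def c_def[symmetric] D_def[symmetric]
    using False D c by (simp add: ennreal_mult[symmetric] del: times_divide_eq_left)
  finally show thesis using sub unfolding c_def by (intro that) auto
qed

lemma negligible_slab:
  fixes A :: "(real^'n::finite) set"
  assumes "hausdorff_outer (CARD('n) - 1) A = 0"
  shows "negligible (slab i A)"
  unfolding negligible_outer
proof (intro allI impI)
  fix e :: real assume e: "0 < e"
  let ?n = "CARD('n) - 1"
  define K where "K = (4 ^ CARD('n) / unit_ball_vol (real ?n) :: real)"
  have K: "0 < K" by (simp add: K_def)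
  have "hausdorff_pre ?n 1 A \<le> hausdorff_outer ?n A"
    unfolding hausdorff_outer_def by (rule SUP_upper) simp
  also have "\<dots> < ennreal (e / (2 * K))" using assms e K by simp
  finally obtain U where U: "A \<subseteq> (\<Union>k. U k)" "\<And>k. bounded (U k)" "\<And>k. diameter (U k) \<le> 1"
    "(\<Sum>k. cover_term ?n (U k)) < ennreal (e / (2 * K))" by (rule hausdorff_pre_cover) auto
  have "\<exists>a b. slab i (U k) \<subseteq> cbox a b \<and>
      emeasure lborel (cbox a b) \<le> ennreal K * cover_term ?n (U k)" for k
    using slab_piece_box[OF U(2,3), of i] unfolding K_def by metis
  then obtain a b where ab: "\<And>k. slab i (U k) \<subseteq> cbox (a k) (b k)"
    "\<And>k. emeasure lborel (cbox (a k) (b k)) \<le> ennreal K * cover_term ?n (U k)" by metis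
  define T where "T = (\<Union>k. cbox (a k) (b k))"
  have "slab i A \<subseteq> (\<Union>k. slab i (U k))" using U(1) by (force simp: slab_def)
  then have 1: "slab i A \<subseteq> T" using ab(1) unfolding T_def by blast
  have "emeasure lborel T \<le> (\<Sum>k. emeasure lborel (cbox (a k) (b k)))"
    unfolding T_def by (rule emeasure_subadditive_countably) auto
  also have "\<dots> \<le> (\<Sum>k. ennreal K * cover_term ?n (U k))"
    by (intro suminf_le ab summableI)
  also have "\<dots> = ennreal K * (\<Sum>k. cover_term ?n (U k))" by simp
  also have "\<dots> \<le> ennreal K * ennreal (e / (2 * K))" using U(4) by (intro mult_left_mono) auto
  also have "\<dots> = ennreal (e / 2)" using K e by (simp flip: ennreal_mult)
  finally have T: "emeasure lborel T \<le> ennreal (e / 2)" .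
  have Tb: "T \<in> sets lborel" unfolding T_def by auto
  have 2: "T \<in> lmeasurable"
    using T Tb by (intro fmeasurableI) (auto intro: le_less_trans)
  have "measure lebesgue T \<le> e / 2"
    using T Tb e enn2real_mono[OF T] by (simp add: measure_def)
  then show "\<exists>T. slab i A \<subseteq> T \<and> T \<in> lmeasurable \<and> measure lebesgue T < e"
    using 1 2 e by (intro exI[of _ T]) auto
qed

text \<open>
  Near \<open>x0\<close> every line in direction \<open>i\<close> crosses the level set, because \<open>f - f x0\<close> changes sign along it.
  The intermediate value theorem does the work of the implicit function theorem here.
\<close>
lemma slab_level_set_neighbourhood:
  fixes f :: "real^'n::finite \<Rightarrow> real"
  assumes cont: "continuous_on UNIV f" and der: "(f has_derivative (\<lambda>h. g \<bullet> h)) (at x0)"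
    and gi: "g $ i \<noteq> 0" and W: "open W" "x0 \<in> W"
  obtains V where "open V" "x0 \<in> V" "V \<subseteq> slab i (W \<inter> {x. f x = f x0})"
proof -
  let ?e = "axis i 1 :: real^'n"
  obtain r where r: "0 < r" "ball x0 r \<subseteq> W" using W by (metis open_contains_ball)
  have d: "((\<lambda>t. f (x0 + t *\<^sub>R ?e)) has_real_derivative g $ i) (at 0)"
  proof -
    have "((\<lambda>t. x0 + t *\<^sub>R ?e) has_derivative (\<lambda>t. t *\<^sub>R ?e)) (at 0)"
      by (auto intro!: derivative_eq_intros)
    from has_derivative_compose[OF this, of f "\<lambda>h. g \<bullet> h"] der
    have "((\<lambda>t. f (x0 + t *\<^sub>R ?e)) has_derivative (\<lambda>t. g \<bullet> (t *\<^sub>R ?e))) (at 0)"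
      by simp
    then show ?thesis
      by (simp add: has_field_derivative_def inner_axis mult.commute[of _ "g $ i"])
  qed
  define s where "s = sgn (g $ i)"
  have s: "s = 1 \<or> s = -1" using gi by (auto simp: s_def sgn_if)
  have d': "((\<lambda>t. s * f (x0 + t *\<^sub>R ?e)) has_real_derivative \<bar>g $ i\<bar>) (at 0)"
    using DERIV_cmult[OF d, of s] by (simp add: s_def abs_sgn mult.commute)
  from DERIV_pos_inc_right[OF d'] gi obtain d1 where
    d1: "0 < d1" "\<And>h. 0 < h \<Longrightarrow> h < d1 \<Longrightarrow> s * f x0 < s * f (x0 + h *\<^sub>R ?e)"
      by auto
  from DERIV_pos_inc_left[OF d'] gi obtain d2 where
    d2: "0 < d2" "\<And>h. 0 < h \<Longrightarrow> h < d2 \<Longrightarrow> s * f (x0 - h *\<^sub>R ?e) < s * f x0"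
      by auto
  define \<tau> where "\<tau> = min (min (d1/2) (d2/2)) (min (r/2) 1)"
  have \<tau>: "0 < \<tau>" "\<tau> < d1" "\<tau> < d2" "\<tau> \<le> r/2" "\<tau> \<le> 1" using d1 d2 r
    by (auto simp: \<tau>_def)
  define V where "V = ball x0 (r/2) \<inter> {x. s * f (x - \<tau> *\<^sub>R ?e) < s * f x0} \<inter> {x. s * f x0 < s * f (x + \<tau> *\<^sub>R ?e)}"
  show thesis
  proof
    show "open V" unfolding V_def
      by (intro open_Int open_ball open_Collect_less continuous_intros continuous_on_compose2[OF cont]) auto
    show "x0 \<in> V" using r \<tau> d1 d2 by (auto simp: V_def)
    show "V \<subseteq> slab i (W \<inter> {x. f x = f x0})"
    proof
      fix x assume x: "x \<in> V"
      have "\<exists>t. -\<tau> \<le> t \<and> t \<le> \<tau> \<and> s * f (x + t *\<^sub>R ?e) = s * f x0"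
        using x \<tau> by (intro IVT') (auto simp: V_def intro!: continuous_intros continuous_on_compose2[OF cont])
      then obtain t where t: "-\<tau> \<le> t" "t \<le> \<tau>" "f (x + t *\<^sub>R ?e) = f x0" using s
        by auto
      have "dist x0 (x + t *\<^sub>R ?e) \<le> dist x0 x + \<bar>t\<bar>"
        using norm_triangle_ineq[of "x0 - x" "- t *\<^sub>R ?e"] by (simp add: dist_norm algebra_simps)
      then have "x + t *\<^sub>R ?e \<in> ball x0 r" using x t \<tau> by (auto simp: V_def)
      then show "x \<in> slab i (W \<inter> {x. f x = f x0})"
        unfolding slab_def using r t \<tau>
        by (intro CollectI exI[of _ "x + t *\<^sub>R ?e"] exI[of _ "-t"]) (auto simp: algebra_simps)
    qed
  qed
qed

lemma not_negligible_slab_level_set: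
  fixes f :: "real^'n::finite \<Rightarrow> real"
  assumes "continuous_on UNIV f" "(f has_derivative (\<lambda>h. g \<bullet> h)) (at x0)" "g $ i \<noteq> 0" "open W" "x0 \<in> W"
  shows "\<not> negligible (slab i (W \<inter> {x. f x = f x0}))"
proof -
  obtain V where "open V" "x0 \<in> V" "V \<subseteq> slab i (W \<inter> {x. f x = f x0})"
    using slab_level_set_neighbourhood[OF assms] .
  then show ?thesis using open_not_negligible negligible_subset by blast
qed

lemma sphere_measure_pos:
  fixes V :: "(real^'n::finite) set"
  assumes "open V" "V \<inter> sphere 0 1 \<noteq> {}"
  shows "emeasure sphere_measure (V \<inter> sphere 0 1) > 0"
proof -
  let ?n = "CARD('n) - 1"
  obtain x0 where x0: "x0 \<in> V" "norm x0 = 1" using assms(2) by auto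
  then have "x0 \<noteq> 0" by auto
  then obtain i where i: "x0 $ i \<noteq> 0" by (auto simp: vec_eq_iff)
  have "\<not> negligible (slab i (V \<inter> {x. x \<bullet> x = x0 \<bullet> x0}))"
  proof (rule not_negligible_slab_level_set)
    show "((\<lambda>x. x \<bullet> x) has_derivative (\<lambda>h. (2 *\<^sub>R x0) \<bullet> h)) (at x0)"
      by (auto intro!: derivative_eq_intros simp: inner_commute)
  qed (use i x0 assms in \<open>auto intro!: continuous_intros\<close>)
  moreover have "{x. x \<bullet> x = x0 \<bullet> x0} = sphere 0 1"
    using x0 by (auto simp: norm_eq_sqrt_inner)
  ultimately have "hausdorff_outer ?n (V \<inter> sphere 0 1) \<noteq> 0" using negligible_slab by metis
  moreover have b: "V \<inter> sphere 0 1 \<in> sets borel" using assms by auto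
  ultimately have "0 < emeasure (hausdorff_measure ?n) (V \<inter> sphere 0 1)"
    by (simp add: emeasure_hausdorff_measure zero_less_iff_neq_zero)
  then show ?thesis unfolding sphere_measure_def
    by (subst emeasure_restrict_space) auto
qed

lemma hausdorff_pre_finite_cover:
  fixes U :: "'i \<Rightarrow> 'a::metric_space set"
  assumes I: "finite I" and "A \<subseteq> (\<Union>i\<in>I. U i)" and b: "\<And>i. i \<in> I \<Longrightarrow> bounded (U i)"
    and d: "\<And>i. i \<in> I \<Longrightarrow> diameter (U i) \<le> r" and "0 \<le> r" "r \<le> \<delta>"
  shows "hausdorff_pre n \<delta> A \<le> of_nat (card I) * ennreal (unit_ball_vol (real n) * (r / 2) ^ n)"
proof -
  obtain h where h: "bij_betw h {0..<card I} I" using ex_bij_betw_nat_finite[OF I] by blast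
  define V where "V k = (if k < card I then U (h k) else {})" for k
  have hI: "h k \<in> I" if "k < card I" for k using h that by (auto simp: bij_betw_def)
  have "hausdorff_pre n \<delta> A \<le> (\<Sum>k. cover_term n (V k))"
  proof (rule hausdorff_pre_le)
    show "A \<subseteq> (\<Union>k. V k)"
    proof
      fix x assume "x \<in> A"
      then obtain i where i: "i \<in> I" "x \<in> U i" using assms(2) by blast
      then have "i \<in> h ` {0..<card I}" using h by (simp add: bij_betw_imp_surj_on)
      then obtain k where "k < card I" "h k = i" by auto
      then have "x \<in> V k" using i by (simp add: V_def)
      then show "x \<in> (\<Union>k. V k)" by blast
    qed
    show "bounded (V k)" for k using b hI by (simp add: V_def)
    show "diameter (V k) \<le> \<delta>" for k using d[OF hI] assms(5,6) by (fastforce simp: V_def)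
  qed
  also have "\<dots> = (\<Sum>k<card I. cover_term n (V k))"
    by (rule suminf_finite) (auto simp: V_def)
  also have "\<dots> \<le> (\<Sum>k<card I. ennreal (unit_ball_vol (real n) * (r / 2) ^ n))"
  proof (rule sum_mono)
    fix k assume k: "k \<in> {..<card I}"
    then have "diameter (V k) \<le> r" "bounded (V k)" using d b hI by (auto simp: V_def)
    then show "cover_term n (V k) \<le> ennreal (unit_ball_vol (real n) * (r / 2) ^ n)"
      unfolding cover_term_def
      by (auto intro!: ennreal_leI mult_left_mono power_mono divide_right_mono diameter_ge_0)
  qed
  also have "\<dots> = of_nat (card I) * ennreal (unit_ball_vol (real n) * (r / 2) ^ n)" by simp
  finally show ?thesis .
qed


text \<open>
  Outside the unit ball the radial projection is the nearest-point map of the ball, hence 1-Lipschitz.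
\<close>
lemma closest_point_cball_scaled:
  fixes x :: "'a::euclidean_space"
  assumes "norm x = 1" "1 \<le> s"
  shows "closest_point (cball 0 1) (s *\<^sub>R x) = x"
proof (rule closest_point_unique[symmetric])
  show "\<forall>z\<in>cball 0 1. dist (s *\<^sub>R x) x \<le> dist (s *\<^sub>R x) z"
  proof
    fix z :: 'a assume "z \<in> cball 0 1"
    have "dist (s *\<^sub>R x) x = norm ((s - 1) *\<^sub>R x)" by (simp add: dist_norm algebra_simps)
    also have "\<dots> = s - 1" using assms by simp
    also have "\<dots> \<le> norm (s *\<^sub>R x) - norm z" using assms \<open>z \<in> cball 0 1\<close>
      by simp
    also have "\<dots> \<le> dist (s *\<^sub>R x) z" unfolding dist_norm by (rule norm_triangle_ineq2)
    finally show "dist (s *\<^sub>R x) x \<le> dist (s *\<^sub>R x) z" .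
  qed
qed (use assms in auto)

text \<open>
  Radial projection maps the boundary of the cube \<open>[-1, 1] ^ n\<close> onto the sphere without increasing
  distances.  Cutting each of the \<open>2 n\<close> faces into \<open>m ^ (n - 1)\<close> small cubes gives pieces of diameter
  at most \<open>2 n / m\<close>, and the resulting Hausdorff sum does not depend on \<open>m\<close>.
\<close>
lemma hausdorff_outer_sphere_finite:
  "hausdorff_outer (CARD('n) - 1) (sphere 0 1 :: (real^'n::finite) set) < top"
proof -
  let ?n = "CARD('n) - 1" and ?d = "CARD('n)"
  define C where "C = real (2 * ?d) * (unit_ball_vol (real ?n) * real ?d ^ ?n)"
  have "hausdorff_outer ?n (sphere 0 1 :: (real^'n) set) \<le> ennreal C"
    unfolding hausdorff_outer_def
  proof (rule SUP_least)
    fix \<delta> :: real assume "\<delta> \<in> {0<..}"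
    then have \<delta>: "0 < \<delta>" by simp
    obtain m :: nat where m: "2 * real ?d / \<delta> < real m" using reals_Archimedean2 by blast
    have "0 < 2 * real ?d / \<delta>" using \<delta> by simp
    then have m0: "0 < real m" using m by linarith
    define r where "r = 2 * real ?d / real m"
    have r: "0 \<le> r" "r \<le> \<delta>" using m m0 \<delta> by (auto simp: r_def field_simps)
    define J :: "'n \<Rightarrow> ('n \<Rightarrow> nat) set" where "J i = PiE UNIV (\<lambda>l. if l
        = i then {0} else {..<m})" for i
    define I where "I = {-1, 1 :: real} \<times> (SIGMA i : UNIV. J i)"
    define Q :: "real \<times> 'n \<times> ('n \<Rightarrow> nat) \<Rightarrow> (real^'n) set" where
      "Q = (\<lambda>(b, i, j). {y. y $ i = b \<and>
          (\<forall>l. l \<noteq> i \<longrightarrow> -1 + 2 * real (j l) / real m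
              \<le> y $ l \<and> y $ l \<le> -1 + 2 * (real (j l) + 1) / real m)})"
    define U where "U z = closest_point (cball 0 1) ` Q z" for z
    have finJ: "finite (J i)" for i unfolding J_def by (rule finite_PiE) auto
    have cardJ: "card (J i) = m ^ ?n" for i
    proof -
      have "card (J i) = (\<Prod>l\<in>UNIV. card (if l = i then {0} else {..<m}))"
        unfolding J_def by (rule card_PiE) simp
      also have "\<dots> = card (if i
          = i then {0::nat} else {..<m}) * (\<Prod>l\<in>UNIV - {i}. card (if l = i then {0} else {..<m}))"
        by (rule prod.remove) auto
      also have "(\<Prod>l\<in>UNIV - {i}. card (if l = i then {0} else {..<m}))
          = (\<Prod>l\<in>UNIV - {i}. m)"
        by (rule prod.cong) auto
      finally show ?thesis by (simp add: card_Diff_singleton)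
    qed
    have cardI: "card I = 2 * (?d * m ^ ?n)"
      unfolding I_def by (simp add: card_cartesian_product card_SigmaI finJ cardJ)
    have "finite I" unfolding I_def by (intro finite_cartesian_product finite_SigmaI finJ) auto
    have Qd: "norm (x - y) \<le> r" if "x \<in> Q z" "y \<in> Q z" for x y z
    proof -
      obtain b i j where z: "z = (b, i, j)" by (cases z) auto
      have "\<bar>(x - y) $ l\<bar> \<le> 2 / real m" for l
      proof (cases "l = i")
        case False
        have "-1 + 2 * (real (j l) + 1) / real m = (-1 + 2 * real (j l) / real m) + 2 / real m"
          by (simp add: add_divide_distrib distrib_left)
        moreover have "-1 + 2 * real (j l) / real m \<le> x $ l" "x $ l
            \<le> -1 + 2 * (real (j l) + 1) / real m"
          "-1 + 2 * real (j l) / real m \<le> y $ l" "y $ l \<le> -1 + 2 * (real (j l) + 1) / real m"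
          using that False by (auto simp: Q_def z)
        ultimately show ?thesis by (simp add: abs_le_iff)
      qed (use that m0 in \<open>auto simp: Q_def z\<close>)
      then have "(\<Sum>l\<in>UNIV. \<bar>(x - y) $ l\<bar>) \<le> (\<Sum>l\<in>(UNIV::'n set). 2 / real m)"
        by (intro sum_mono)
      also have "\<dots> = r" by (simp add: r_def)
      finally show ?thesis using norm_le_l1_cart[of "x - y"] by linarith
    qed
    have Ud: "dist x y \<le> r" if "x \<in> U z" "y \<in> U z" for x y z
    proof -
      obtain x' y' where x': "x' \<in> Q z" "y' \<in> Q z" "x = closest_point (cball 0 1) x'" "y
          = closest_point (cball 0 1) y'"
        using \<open>x \<in> U z\<close> \<open>y \<in> U z\<close> by (auto simp: U_def)
      then have "dist x y \<le> dist x' y'" using closest_point_lipschitz[of "cball 0 1" x' y'] by simp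
      then show ?thesis using Qd x' by (simp add: dist_norm order_trans)
    qed
    have "sphere 0 1 \<subseteq> (\<Union>z\<in>I. U z)"
    proof
      fix x :: "real^'n" assume "x \<in> sphere 0 1"
      then have nx: "norm x = 1" by simp
      obtain i where i: "\<And>l. \<bar>x $ l\<bar> \<le> \<bar>x $ i\<bar>"
      proof -
        have "Max (range (\<lambda>l. \<bar>x $ l\<bar>)) \<in> range (\<lambda>l. \<bar>x $ l\<bar>)"
          by (rule Max_in) auto
        then obtain i where "Max (range (\<lambda>l. \<bar>x $ l\<bar>)) = \<bar>x $ i\<bar>"
          by (rule imageE)
        then have "\<bar>x $ l\<bar> \<le> \<bar>x $ i\<bar>" for l
          by (metis Max_ge finite finite_imageI rangeI)
        then show thesis by (rule that)
      qed
      have xi: "x $ i \<noteq> 0"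
      proof
        assume "x $ i = 0"
        then have "x = 0" using i by (auto simp: vec_eq_iff)
        then show False using nx by simp
      qed
      have "\<bar>x $ i\<bar> \<le> 1" using component_le_norm_cart[of x i] nx by simp
      define s where "s = 1 / \<bar>x $ i\<bar>"
      have s: "1 \<le> s" using xi \<open>\<bar>x $ i\<bar> \<le> 1\<close> by (simp add: s_def)
      define y where "y = s *\<^sub>R x"
      have y1: "\<bar>y $ l\<bar> \<le> 1" for l using i[of l] xi
        by (simp add: y_def s_def abs_mult field_simps)
      define j where "j l = (if l = i then 0 else min (nat \<lfloor>(y $ l
          + 1) * real m / 2\<rfloor>) (m - 1))" for l
      have "j \<in> J i" using m0 by (auto simp: J_def j_def)
      moreover have "sgn (x $ i) \<in> {-1, 1}" using xi by (auto simp: sgn_if)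
      ultimately have zI: "(sgn (x $ i), i, j) \<in> I" by (simp add: I_def)
      have jl: "-1 + 2 * real (j l) / real m \<le> y $ l \<and> y $ l \<le> -1 + 2 * (real (j l) + 1) / real m"
        if "l \<noteq> i" for l
      proof -
        define q where "q = (y $ l + 1) * real m / 2"
        have y: "0 \<le> y $ l + 1" "y $ l + 1 \<le> 2" using y1[of l] by (auto simp: abs_le_iff)
        have q: "0 \<le> q" "q \<le> real m"
          using mult_right_mono[OF y(2), of "real m"] y(1) m0 by (auto simp: q_def)
        have "real (j l) \<le> q \<and> q \<le> real (j l) + 1"
        proof (cases "nat \<lfloor>q\<rfloor> \<le> m - 1")
          case True
          then have "real (j l) = of_int \<lfloor>q\<rfloor>" using that q by (simp add: j_def q_def)
          then show ?thesis by linarith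
        next
          case False
          then have "j l = m - 1" "m \<le> nat \<lfloor>q\<rfloor>" using that by (auto simp: j_def q_def)
          then have "real m \<le> real (nat \<lfloor>q\<rfloor>)" by linarith
          then have "real m \<le> q" using q of_int_floor_le[of q] by linarith
          then show ?thesis using q m0 \<open>j l = m - 1\<close> by (auto simp: of_nat_diff)
        qed
        moreover have "y $ l = -1 + 2 * q / real m" using m0 by (simp add: q_def)
        ultimately show ?thesis using m0 by (auto intro!: divide_right_mono)
      qed
      have "y $ i = sgn (x $ i)" by (simp add: y_def s_def sgn_real_def abs_if)
      then have "y \<in> Q (sgn (x $ i), i, j)" using jl by (simp add: Q_def)
      moreover have "closest_point (cball 0 1) y = x"
        unfolding y_def by (rule closest_point_cball_scaled[OF nx s])
      ultimately have "x \<in> U (sgn (x $ i), i, j)" unfolding U_def by force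
      then show "x \<in> (\<Union>z\<in>I. U z)" using zI by blast
    qed
    then have "hausdorff_pre ?n \<delta> (sphere 0 1 :: (real^'n) set)
        \<le> of_nat (card I) * ennreal (unit_ball_vol (real ?n) * (r / 2) ^ ?n)"
    proof (rule hausdorff_pre_finite_cover[OF \<open>finite I\<close>])
      show "bounded (U z)" for z
        unfolding bounded_two_points using Ud by blast
      show "diameter (U z) \<le> r" for z
        using Ud r by (intro diameter_le) (auto simp: dist_norm)
    qed (use r in auto)
    also have "\<dots> = ennreal (real (card I) * (unit_ball_vol (real ?n) * (r / 2) ^ ?n))"
      using r by (simp add: ennreal_of_nat_eq_real_of_nat ennreal_mult)
    also have "real (card I) * (unit_ball_vol (real ?n) * (r / 2) ^ ?n) = C"
      using m0 by (simp add: cardI r_def C_def power_divide)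
    finally show "hausdorff_pre ?n \<delta> (sphere 0 1 :: (real^'n) set) \<le> ennreal C" .
  qed
  also have "\<dots> < top" by simp
  finally show ?thesis .
qed

lemma finite_sphere_measure: "finite_measure (sphere_measure :: (real^'n::finite) measure)"
proof
  have "emeasure (sphere_measure :: (real^'n) measure) (sphere 0 1)
      = emeasure (hausdorff_measure (CARD('n) - 1)) (sphere 0 1 :: (real^'n) set)"
    unfolding sphere_measure_def by (subst emeasure_restrict_space) auto
  also have "\<dots> < top" using hausdorff_outer_sphere_finite by (simp add: emeasure_hausdorff_measure)
  finally show "emeasure (sphere_measure :: (real^'n) measure) (space sphere_measure) \<noteq> \<infinity>"
    by (simp add: sphere_measure_def space_restrict_space)
qed


section \<open>Inequalities for the cosines of a point of a level surface\<close>

lemma abs_le_1_if_square_add_eq_1: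
  fixes x y :: real
  assumes "x\<^sup>2 + y = 1" "0 \<le> y"
  shows "\<bar>x\<bar> \<le> 1"
  using assms by (simp flip: abs_square_le_1)

text \<open>
  The deficits \<open>1 - c j\<close> sum to less than 2.  If \<open>c i
      = - a\<close> with \<open>a \<ge> 0\<close>, the deficit at \<open>i\<close> uses up \<open>1
          + a\<close>
  of this, and the others together have less than \<open>1 - a\<close>; in particular \<open>a < c j\<close>.  For \<open>a \<le> c j\<close> the quantity
  \<open>a (1 - (c j)\<^sup>2) / c j\<close> is at most \<open>(1
      + a) (1 - c j)\<close>, and summing gives the second claim.
\<close>
lemma negative_cosine_bound:
  fixes c :: "'n::finite \<Rightarrow> real"
  assumes c1: "\<And>j. \<bar>c j\<bar>
      \<le> 1" and S: "real CARD('n) - 2 < (\<Sum>j\<in>UNIV. c j)" and i: "c i \<le> 0"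
  shows "j \<noteq> i \<Longrightarrow> - c i < c j"
    and "- c i * (\<Sum>j\<in>UNIV - {i}. (1 - (c j)\<^sup>2) / c j) < 1 - (c i)\<^sup>2"
proof -
  define a where "a = - c i"
  have a: "0 \<le> a" "a \<le> 1" using i c1[of i] by (auto simp: a_def abs_le_iff)
  have "(\<Sum>j\<in>UNIV. 1 - c j) = real CARD('n) - (\<Sum>j\<in>UNIV. c j)" by (simp add: sum_subtractf)
  moreover have "(\<Sum>j\<in>UNIV. 1 - c j) = (1 - c i) + (\<Sum>j\<in>UNIV - {i}. 1 - c j)"
    by (rule sum.remove) auto
  ultimately have sm: "(\<Sum>j\<in>UNIV - {i}. 1 - c j) < 1 - a" using S by (simp add: a_def)
  have gt: "a < c j" if "j \<noteq> i" for j
  proof -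
    have "1 - c j \<le> (\<Sum>j\<in>UNIV - {i}. 1 - c j)"
      using that c1 by (intro member_le_sum) (auto simp: abs_le_iff)
    then show ?thesis using sm by simp
  qed
  then show "j \<noteq> i \<Longrightarrow> - c i < c j" by (simp add: a_def)
  have "a * (\<Sum>j\<in>UNIV - {i}. (1 - (c j)\<^sup>2) / c j)
      = (\<Sum>j\<in>UNIV - {i}. a * ((1 - (c j)\<^sup>2) / c j))"
    by (rule sum_distrib_left)
  also have "\<dots> \<le> (\<Sum>j\<in>UNIV - {i}. (1 + a) * (1 - c j))"
  proof (rule sum_mono)
    fix j assume "j \<in> UNIV - {i}"
    then have j: "a < c j" "c j \<le> 1" using gt c1[of j] by (auto simp: abs_le_iff)
    have "a * (1 + c j) \<le> (1 + a) * c j" using j by (simp add: algebra_simps)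
    then have "a * (1 + c j) * (1 - c j) \<le> (1 + a) * c j * (1 - c j)"
      using j by (intro mult_right_mono) auto
    moreover have "1 - (c j)\<^sup>2 = (1 + c j) * (1 - c j)" by (simp add: power2_eq_square algebra_simps)
    ultimately show "a * ((1 - (c j)\<^sup>2) / c j) \<le> (1 + a) * (1 - c j)"
      using j a by (simp add: divide_le_eq mult_ac)
  qed
  also have "\<dots> = (1 + a) * (\<Sum>j\<in>UNIV - {i}. 1 - c j)" by (rule sum_distrib_left[symmetric])
  also have "\<dots> < (1 + a) * (1 - a)" using sm a by (intro mult_strict_left_mono) auto
  also have "\<dots> = 1 - (c i)\<^sup>2" by (simp add: a_def power2_eq_square algebra_simps)
  finally show "- c i * (\<Sum>j\<in>UNIV - {i}. (1 - (c j)\<^sup>2) / c j) < 1 - (c i)\<^sup>2"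
    by (simp add: a_def)
qed

text \<open>
  If some \<open>c i\<close> is not positive, tangency expresses \<open>s i * u i\<close> through the other coordinates, and the
  Cauchy-Schwarz inequality with weights \<open>c j\<close> bounds the negative term
    by the positive ones; the
  constant is good enough by \<open>negative_cosine_bound\<close>.
\<close>
lemma tangential_hessian_pos:
  fixes c s u :: "'n::finite \<Rightarrow> real"
  assumes cs: "\<And>j. (c j)\<^sup>2 + (s j)\<^sup>2
      = 1" and S: "real CARD('n) - 2 < (\<Sum>j\<in>UNIV. c j)"
    and tan: "(\<Sum>j\<in>UNIV. s j * u j) = 0" and u: "u k \<noteq> 0"
  shows "0 < (\<Sum>j\<in>UNIV. c j * (u j)\<^sup>2)"
proof (cases "\<forall>j. 0 < c j")
  case True
  then show ?thesis using u by (intro sum_pos2[of _ k]) (auto intro!: mult_nonneg_nonneg simp: less_imp_le)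
next
  case False
  then obtain i where i: "c i \<le> 0" by (auto simp: not_less)
  have c1: "\<bar>c j\<bar> \<le> 1" for j using abs_le_1_if_square_add_eq_1[OF cs[of j]] by simp
  note key = negative_cosine_bound[of c i, OF c1 S i]
  have pos: "0 < c j" if "j \<noteq> i" for j using key(1)[OF that] i by simp
  define B where "B = (\<Sum>j\<in>UNIV - {i}. (1 - (c j)\<^sup>2) / c j)"
  define T where "T = (\<Sum>j\<in>UNIV - {i}. c j * (u j)\<^sup>2)"
  have s2: "(s j)\<^sup>2 = 1 - (c j)\<^sup>2" for j using cs[of j] by simp
  have B0: "0 \<le> B" unfolding B_def
    by (intro sum_nonneg divide_nonneg_nonneg) (auto simp: pos less_imp_le s2[symmetric])
  have si: "- c i * B < (s i)\<^sup>2" using key(2) by (simp add: B_def s2)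
  have si0: "0 < (s i)\<^sup>2" using si B0 i by (smt (verit) mult_nonneg_nonneg)
  have "(\<Sum>j\<in>UNIV. s j * u j) = s i * u i + (\<Sum>j\<in>UNIV - {i}. s j * u j)"
    by (rule sum.remove) auto
  then have "(s i * u i)\<^sup>2 = (\<Sum>j\<in>UNIV - {i}. s j * u j)\<^sup>2" using tan
    by (simp add: power2_eq_iff)
  also have "(\<Sum>j\<in>UNIV - {i}. s j * u j)
      = (\<Sum>j\<in>UNIV - {i}. (s j / sqrt (c j)) * (sqrt (c j) * u j))"
    using pos by (intro sum.cong) (auto simp: less_imp_neq[THEN not_sym])
  also have "\<dots>\<^sup>2 \<le> (\<Sum>j\<in>UNIV - {i}. (s j / sqrt (c j))\<^sup>2) * (\<Sum>j\<in>UNIV - {i}. (sqrt (c j) * u j)\<^sup>2)"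
    by (rule Cauchy_Schwarz_ineq_sum)
  also have "(\<Sum>j\<in>UNIV - {i}. (s j / sqrt (c j))\<^sup>2) = B"
    unfolding B_def using pos by (intro sum.cong) (auto simp: power_divide s2 less_imp_le)
  also have "(\<Sum>j\<in>UNIV - {i}. (sqrt (c j) * u j)\<^sup>2) = T"
    unfolding T_def using pos by (intro sum.cong) (auto simp: power_mult_distrib less_imp_le)
  finally have CS: "(s i)\<^sup>2 * (u i)\<^sup>2 \<le> B * T" by (simp add: power_mult_distrib)
  have T0: "0 < T"
  proof (cases "k = i")
    case True
    then have "0 < (s i)\<^sup>2 * (u i)\<^sup>2" using u si0 by simp
    then have "0 < B * T" using CS by linarith
    then show ?thesis using B0 by (simp add: zero_less_mult_iff)
  next
    case False
    then show ?thesis unfolding T_def using u pos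
      by (intro sum_pos2[of _ k]) (auto intro!: mult_nonneg_nonneg simp: less_imp_le)
  qed
  have "(s i)\<^sup>2 * (- c i * (u i)\<^sup>2) = - c i * ((s i)\<^sup>2 * (u i)\<^sup>2)" by simp
  also have "\<dots> \<le> - c i * (B * T)" using CS i by (intro mult_left_mono) auto
  also have "\<dots> = (- c i * B) * T" by simp
  also have "\<dots> < (s i)\<^sup>2 * T" using si T0 by (rule mult_strict_right_mono)
  finally have "- c i * (u i)\<^sup>2 < T" using si0 by (elim mult_left_less_imp_less) simp
  moreover have "(\<Sum>j\<in>UNIV. c j * (u j)\<^sup>2) = c i * (u i)\<^sup>2 + T" unfolding T_def
    by (rule sum.remove) auto
  ultimately show ?thesis by simp
qed

text \<open>
  A point with unit normal \<open>w\<close> has sines proportional to \<open>w\<close>; the factor is \<open>t\<close> up to sign.  A larger factor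
  increases no \<open>\<bar>c j\<bar>\<close>.  If no cosine is negative, the sum can only stay the same when nothing changes.
  If \<open>c i = - a\<close> is negative, then \<open>c i\<close> grows and the other cosines fall; if \<open>t < t'\<close>, the
  equality of the sums would force the losses to balance the gain, whereas \<open>negative_cosine_bound\<close> says that
  the losses are strictly smaller.
\<close>
lemma cosines_unique_ordered:
  fixes c c' w :: "'n::finite \<Rightarrow> real"
  assumes c: "\<And>j. (c j)\<^sup>2 + t\<^sup>2 * (w j)\<^sup>2
      = 1" and c': "\<And>j. (c' j)\<^sup>2 + t'\<^sup>2 * (w j)\<^sup>2 = 1"
    and S: "real CARD('n) - 2 < (\<Sum>j\<in>UNIV. c j)" and eq: "(\<Sum>j\<in>UNIV. c j)
        = (\<Sum>j\<in>UNIV. c' j)"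
    and t: "0 < t" "t \<le> t'"
  shows "c = c'"
proof -
  have tt: "t\<^sup>2 \<le> t'\<^sup>2" using t by (intro power_mono) auto
  have c1: "\<bar>c j\<bar> \<le> 1" for j using abs_le_1_if_square_add_eq_1[OF c[of j]] by simp
  have c1': "\<bar>c' j\<bar> \<le> 1" for j using abs_le_1_if_square_add_eq_1[OF c'[of j]] by simp
  have "(c' j)\<^sup>2 \<le> (c j)\<^sup>2" for j
    using mult_right_mono[OF tt, of "(w j)\<^sup>2"] c[of j] c'[of j] by simp
  then have abs: "\<bar>c' j\<bar> \<le> \<bar>c j\<bar>" for j by (simp add: abs_le_square_iff)
  show ?thesis
  proof (cases "\<forall>j. 0 \<le> c j")
    case True
    then have "c' j \<le> c j" for j using abs[of j] abs_ge_self[of "c' j"] by simp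
    show ?thesis
      by (rule ext, rule sum_mono_inv[OF eq[symmetric], symmetric])
        (use \<open>\<And>j. c' j \<le> c j\<close> in auto)
  next
    case False
    then obtain i where i: "c i < 0" by (auto simp: not_le)
    define a b where "a = - c i" and "b = - c' i"
    have a: "0 < a" using i by (simp add: a_def)
    note key = negative_cosine_bound[of c i, OF c1 S less_imp_le[OF i]]
    have gt: "a < c j" if "j \<noteq> i" for j using key(1)[OF that] by (simp add: a_def)
    have wi: "(w j)\<^sup>2 \<le> (w i)\<^sup>2" if "j \<noteq> i" for j
    proof -
      have "a\<^sup>2 \<le> (c j)\<^sup>2" using gt[OF that] a by (intro power_mono) auto
      then have "t\<^sup>2 * (w j)\<^sup>2 \<le> t\<^sup>2 * (w i)\<^sup>2" using c[of i] c[of j]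
        by (simp add: a_def)
      then show ?thesis using t by (simp add: mult_le_cancel_left)
    qed
    have c'0: "0 \<le> c' j" if "j \<noteq> i" for j
    proof (rule ccontr)
      assume "\<not> 0 \<le> c' j"
      then have neg: "c' j < 0" by simp
      have "- c' j < c' i"
        using negative_cosine_bound(1)[of c' j i] c1' S eq neg that by auto
      then have "(c' j)\<^sup>2 < (c' i)\<^sup>2" using neg power_strict_mono[of "- c' j" "c' i" 2] by simp
      then have "t'\<^sup>2 * (w i)\<^sup>2 < t'\<^sup>2 * (w j)\<^sup>2" using c'[of i] c'[of j]
        by linarith
      then show False using mult_left_mono[OF wi[OF that], of "t'\<^sup>2"] by simp
    qed
    define \<tau> where "\<tau> = t'\<^sup>2 - t\<^sup>2"
    have diff: "(\<Sum>j\<in>UNIV - {i}. c j - c' j) = a - b"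
    proof -
      have "(\<Sum>j\<in>UNIV. c j - c' j) = (c i - c' i) + (\<Sum>j\<in>UNIV - {i}. c j - c' j)"
        by (rule sum.remove) auto
      then show ?thesis using eq by (simp add: sum_subtractf a_def b_def)
    qed
    have "\<not> 0 < \<tau>"
    proof
      assume \<tau>: "0 < \<tau>"
      have sqd: "(c j)\<^sup>2 - (c' j)\<^sup>2 = \<tau> * (w j)\<^sup>2" for j
        using c[of j] c'[of j] by (simp add: \<tau>_def algebra_simps)
      \<comment> \<open>The factor \<open>a
          + b\<close> turns the gain \<open>a - b\<close> at \<open>i\<close> into \<open>\<tau> * (w i)\<^sup>2\<close>.\<close>
      have summand: "(c j - c' j) * (a + b) \<le> \<tau> * (a * ((w j)\<^sup>2 / c j))"
        if "j \<noteq> i" for j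
      proof -
        have cj: "0 < c j" using gt[OF that] a by simp
        have "b * c j \<le> a * c' j"
        proof (cases "b \<le> 0")
          case True
          then have "b * c j \<le> 0" using cj by (simp add: mult_le_0_iff)
          also have "0 \<le> a * c' j" using a c'0[OF that] by simp
          finally show ?thesis .
        next
          case False
          have sq: "a\<^sup>2 = 1 - t\<^sup>2 * (w i)\<^sup>2" "(c j)\<^sup>2
              = 1 - t\<^sup>2 * (w j)\<^sup>2"
            "b\<^sup>2 = 1 - t'\<^sup>2 * (w i)\<^sup>2" "(c' j)\<^sup>2 = 1 - t'\<^sup>2 * (w j)\<^sup>2"
            using c[of i] c[of j] c'[of i] c'[of j] by (auto simp: a_def b_def)
          have "(a * c' j)\<^sup>2 - (b * c j)\<^sup>2 = \<tau> * ((w i)\<^sup>2 - (w j)\<^sup>2)"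
            unfolding power_mult_distrib sq \<tau>_def by (simp add: algebra_simps)
          moreover have "0 \<le> \<tau> * ((w i)\<^sup>2 - (w j)\<^sup>2)"
            using \<tau> wi[OF that] by (intro mult_nonneg_nonneg) auto
          ultimately have "(b * c j)\<^sup>2 \<le> (a * c' j)\<^sup>2" by linarith
          moreover have "0 \<le> a * c' j" using a c'0[OF that] by simp
          ultimately show ?thesis by (rule power2_le_imp_le)
        qed
        then have "(a + b) * c j \<le> a * (c j + c' j)" by (simp add: algebra_simps)
        moreover have "0 \<le> c j - c' j" using abs[of j] cj c'0[OF that] by simp
        ultimately have "(c j - c' j) * ((a + b) * c j) \<le> (c j - c' j) * (a * (c j + c' j))"
          by (rule mult_left_mono)
        also have "\<dots> = a * ((c j)\<^sup>2 - (c' j)\<^sup>2)"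
          by (simp add: power2_eq_square algebra_simps)
        finally have "(c j - c' j) * (a + b) * c j \<le> \<tau> * (a * (w j)\<^sup>2)"
          by (simp add: sqd mult_ac)
        then show ?thesis using cj by (simp add: le_divide_eq)
      qed
      have "\<tau> * (w i)\<^sup>2 = (a - b) * (a + b)"
        using sqd[of i] by (simp add: a_def b_def power2_eq_square algebra_simps)
      also have "\<dots> = (\<Sum>j\<in>UNIV - {i}. (c j - c' j) * (a + b))"
        unfolding diff[symmetric] by (rule sum_distrib_right)
      also have "\<dots> \<le> (\<Sum>j\<in>UNIV - {i}. \<tau> * (a * ((w j)\<^sup>2 / c j)))"
        by (rule sum_mono, rule summand) simp
      also have "\<dots> = \<tau> * (a * (\<Sum>j\<in>UNIV - {i}. (w j)\<^sup>2 / c j))"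
        by (simp add: sum_distrib_left)
      finally have "(w i)\<^sup>2 \<le> a * (\<Sum>j\<in>UNIV - {i}. (w j)\<^sup>2 / c j)" using \<tau>
        by simp
      then have "t\<^sup>2 * (w i)\<^sup>2 \<le> t\<^sup>2 * (a * (\<Sum>j\<in>UNIV - {i}. (w j)\<^sup>2 / c j))"
        by (intro mult_left_mono) auto
      also have "\<dots> = a * (\<Sum>j\<in>UNIV - {i}. (t\<^sup>2 * (w j)\<^sup>2) / c j)"
        by (simp add: sum_distrib_left mult_ac)
      also have "\<dots> = a * (\<Sum>j\<in>UNIV - {i}. (1 - (c j)\<^sup>2) / c j)"
        using c by (intro arg_cong2[where f = "(*)"] sum.cong) (auto simp: eq_diff_eq add.commute)
      also have "\<dots> < 1 - (c i)\<^sup>2" using key(2) by (simp add: a_def)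
      finally show False using c[of i] by simp
    qed
    then have "t\<^sup>2 = t'\<^sup>2" using tt by (simp add: \<tau>_def)
    then have sq: "(c j)\<^sup>2 = (c' j)\<^sup>2" for j using c[of j] c'[of j] by simp
    have "c j = c' j" if "j \<noteq> i" for j
      using gt[OF that] a c'0[OF that] power2_eq_iff_nonneg[of "c j" "c' j"] sq[of j] by simp
    then show ?thesis
    proof -
      have "(\<Sum>j\<in>UNIV - {i}. c j - c' j) = 0"
        using \<open>\<And>j. j \<noteq> i \<Longrightarrow> c j = c' j\<close> by (intro sum.neutral) auto
      then have "c i = c' i" using diff by (simp add: a_def b_def)
      then show ?thesis using \<open>\<And>j. j \<noteq> i \<Longrightarrow> c j = c' j\<close>
        by (intro ext) metis
    qed
  qed
qed

lemma cosines_unique: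
  fixes c c' w :: "'n::finite \<Rightarrow> real"
  assumes "\<And>j. (c j)\<^sup>2 + t\<^sup>2 * (w j)\<^sup>2
      = 1" "\<And>j. (c' j)\<^sup>2 + t'\<^sup>2 * (w j)\<^sup>2 = 1"
    and "real CARD('n) - 2 < (\<Sum>j\<in>UNIV. c j)" "(\<Sum>j\<in>UNIV. c j) = (\<Sum>j\<in>UNIV. c' j)"
    and "0 < t" "0 < t'" and w: "w k \<noteq> 0"
  shows "c = c'" "t = t'"
proof -
  show cc: "c = c'"
  proof (cases "t \<le> t'")
    case True
    show ?thesis by (rule cosines_unique_ordered[OF assms(1-5) True])
  next
    case False
    then have "c' = c" using assms by (intro cosines_unique_ordered[of c' t' w c t]) auto
    then show ?thesis ..
  qed
  have "t\<^sup>2 * (w k)\<^sup>2 = t'\<^sup>2 * (w k)\<^sup>2" using assms(1)[of k] assms(2)[of k] unfolding cc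
    by linarith
  then show "t = t'" using w assms(5,6) by (simp add: power2_eq_iff)
qed

text \<open>
  Let \<open>t\<close> grow from 0 to the value \<open>T\<close> where the largest \<open>\<bar>t w i\<bar>\<close> reaches 1.  The sum of the non-negative roots
  falls continuously from \<open>n\<close>.  If it does not reach \<open>S\<close> before \<open>T\<close>, the root at \<open>i\<close>, which is 0 at \<open>T\<close>, changes
  its sign, and \<open>t\<close> moves back to 0, where the sum is then \<open>n - 2\<close>.
\<close>
lemma cosines_exist:
  fixes w :: "'n::finite \<Rightarrow> real"
  assumes S: "real CARD('n) - 2 < S" "S < real CARD('n)" and w: "w k \<noteq> 0"
  obtains t c where "0 < t" "\<And>j. (c j)\<^sup>2 + t\<^sup>2 * (w j)\<^sup>2
      = 1" "(\<Sum>j\<in>UNIV. c j) = S"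
proof -
  obtain i where i: "\<And>j. \<bar>w j\<bar> \<le> \<bar>w i\<bar>"
  proof -
    have "Max (range (\<lambda>l. \<bar>w l\<bar>)) \<in> range (\<lambda>l. \<bar>w l\<bar>)"
      by (rule Max_in) auto
    then obtain i where "Max (range (\<lambda>l. \<bar>w l\<bar>)) = \<bar>w i\<bar>" by (rule imageE)
    then have "\<bar>w l\<bar> \<le> \<bar>w i\<bar>" for l by (metis Max_ge finite finite_imageI rangeI)
    then show thesis by (rule that)
  qed
  have wi: "0 < \<bar>w i\<bar>" using i[of k] w by linarith
  define T where "T = 1 / \<bar>w i\<bar>"
  have T: "0 < T" using wi by (simp add: T_def)
  define r where "r j t = sqrt (1 - t\<^sup>2 * (w j)\<^sup>2)" for j t
  have rsq: "(r j t)\<^sup>2 + t\<^sup>2 * (w j)\<^sup>2 = 1" if "0 \<le> t" "t \<le> T" for j t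
  proof -
    have "\<bar>t * w j\<bar> \<le> T * \<bar>w i\<bar>" unfolding abs_mult using that i[of j]
      by (intro mult_mono) auto
    then have "\<bar>t * w j\<bar> \<le> 1" using wi by (simp add: T_def)
    then have "(t * w j)\<^sup>2 \<le> 1" by (simp add: abs_square_le_1)
    then show ?thesis by (simp add: r_def power_mult_distrib)
  qed
  define F where "F t = (\<Sum>j\<in>UNIV. r j t)" for t
  have rT: "r i T = 0" using wi by (simp add: r_def T_def power_divide)
  have F0: "F 0 = real CARD('n)" by (simp add: F_def r_def)
  have contr: "continuous_on A (r j)" for A j unfolding r_def by (intro continuous_intros)
  have contF: "continuous_on A F" for A unfolding F_def by (intro continuous_intros contr)
  show thesis
  proof (cases "F T \<le> S")
    case True
    then obtain t where t: "0 \<le> t" "t \<le> T" "F t = S"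
      using IVT2'[of F T S 0] F0 S T contF by auto
    moreover have "t \<noteq> 0" using t F0 S by auto
    ultimately show thesis using rsq by (intro that[of t "\<lambda>j. r j t"]) (auto simp: F_def)
  next
    case False
    define G where "G t = F t - 2 * r i t" for t
    have "continuous_on {0..T} G" unfolding G_def by (intro continuous_intros contr contF)
    then obtain t where t: "0 \<le> t" "t \<le> T" "G t = S"
      using IVT'[of G 0 S T] F0 S T False rT by (auto simp: G_def r_def)
    have "t \<noteq> 0" using t F0 S by (auto simp: G_def r_def)
    define c where "c j = (if j = i then - r j t else r j t)" for j
    have "(\<Sum>j\<in>UNIV. c j) = c i + (\<Sum>j\<in>UNIV - {i}. c j)" by (rule sum.remove) auto
    also have "(\<Sum>j\<in>UNIV - {i}. c j) = (\<Sum>j\<in>UNIV - {i}. r j t)"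
      by (rule sum.cong) (auto simp: c_def)
    also have "\<dots> = F t - r i t" unfolding F_def using sum.remove[of UNIV i "\<lambda>j. r j t"]
      by simp
    finally have "(\<Sum>j\<in>UNIV. c j) = S" using t by (simp add: c_def G_def)
    then show thesis using t \<open>t \<noteq> 0\<close> rsq by (intro that[of t c]) (auto simp: c_def)
  qed
qed


section \<open>Gradient and curvature of the level surfaces\<close>

definition sinv :: "real^'n \<Rightarrow> real^'n" where
  "sinv x = (\<chi> i. sin (x $ i))"

lemma sinv_nth [simp]: "sinv x $ i = sin (x $ i)"
  by (simp add: sinv_def)

lemma has_derivative_vec_nth [derivative_intros]:
  "(f has_derivative D) F \<Longrightarrow> ((\<lambda>x. f x $ i) has_derivative (\<lambda>h. D h $ i)) F"
  by (rule bounded_linear.has_derivative[OF bounded_linear_vec_nth])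

lemma has_derivative_phi:
  fixes x :: "real^'n::finite"
  shows "(phi has_derivative (\<lambda>h. (-2 *\<^sub>R sinv x) \<bullet> h)) (at x)"
proof -
  have "((\<lambda>y :: real^'n. 2 * (\<Sum>i\<in>UNIV. cos (y $ i))) has_derivative
      (\<lambda>h. 2 * (\<Sum>i\<in>UNIV. - (sin (x $ i) * h $ i)))) (at x)"
    by (auto intro!: derivative_eq_intros simp: mult.commute)
  moreover have "(\<lambda>h. 2 * (\<Sum>i\<in>UNIV. - (sin (x $ i) * h $ i)))
      = (\<lambda>h. (-2 *\<^sub>R sinv x) \<bullet> h)"
    by (rule ext) (simp add: inner_vec_def sum_distrib_left sum_negf mult_ac)
  moreover have "(phi :: real^'n \<Rightarrow> real) = (\<lambda>y. 2 * (\<Sum>i\<in>UNIV. cos (y $ i)))"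
    by (rule ext) (simp add: phi_def)
  ultimately show ?thesis by simp
qed

lemma grad_phi: "grad phi (x :: real^'n::finite) = -2 *\<^sub>R sinv x"
  unfolding grad_def gderiv_def
proof (rule the_equality)
  show "(phi has_derivative (\<lambda>h. h \<bullet> (-2 *\<^sub>R sinv x))) (at x)"
    using has_derivative_phi[of x] by (simp add: inner_commute)
  fix g assume "(phi has_derivative (\<lambda>h. h \<bullet> g)) (at x)"
  from has_derivative_unique[OF this has_derivative_phi]
  have "\<forall>h. h \<bullet> g = h \<bullet> (-2 *\<^sub>R sinv x)"
    by (simp add: fun_eq_iff inner_commute)
  then show "g = -2 *\<^sub>R sinv x" unfolding vector_eq_ldot .
qed

lemma continuous_on_phi: "continuous_on A (phi :: real^'n::finite \<Rightarrow> real)"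
  by (rule has_derivative_continuous_on) (rule has_derivative_at_withinI[OF has_derivative_phi])

text \<open>
  Shifting all coordinates
    by \<open>\<pi>\<close> changes the sign of \<open>phi\<close>, so negative levels behave like positive
  ones; \<open>s\<close> records the sign.
\<close>
lemma phi_signed:
  fixes x :: "real^'n::finite"
  assumes "phi x \<in> Lam CARD('n)"
  obtains s :: real where "s = 1 \<or> s = -1"
    "real CARD('n) - 2 < (\<Sum>j\<in>UNIV. s * cos (x $ j))" "(\<Sum>j\<in>UNIV. s * cos (x $ j))
        = \<bar>phi x\<bar> / 2"
proof (cases "0 \<le> phi x")
  case True
  then show thesis using assms by (intro that[of 1]) (auto simp: phi_def Lam_def)
next
  case False
  then show thesis using assms by (intro that[of "-1"]) (auto simp: phi_def Lam_def sum_negf)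
qed

text \<open>
  With \<open>c j = s cos (x j)\<close> the deficits \<open>1 - c j\<close> sum to \<open>e < 2\<close>, so each of them is at most \<open>e\<close>, and
  \<open>1 - (c j)\<^sup>2 = (1 - c j) (1 + c j) \<ge> (1 - c j) (2 - e)\<close>.
\<close>
lemma norm_grad_phi_lower:
  fixes x :: "real^'n::finite"
  assumes "phi x \<in> Lam CARD('n)"
  defines "e \<equiv> real CARD('n) - \<bar>phi x\<bar> / 2"
  shows "4 * e * (2 - e) \<le> (norm (grad phi x))\<^sup>2"
proof -
  obtain s where s: "s = 1 \<or> s = -1" "real CARD('n) - 2 < (\<Sum>j\<in>UNIV. s * cos (x $ j))"
    "(\<Sum>j\<in>UNIV. s * cos (x $ j)) = \<bar>phi x\<bar> / 2" using phi_signed[OF assms(1)] .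
  define c where "c j = s * cos (x $ j)" for j
  have c1: "c j \<le> 1" "c j \<ge> -1" for j using s(1) by (auto simp: c_def abs_le_iff minus_le_iff)
  have sum: "(\<Sum>j\<in>UNIV. 1 - c j) = e" using s(3) by (simp add: e_def c_def sum_subtractf)
  have "(2 - e) * e = (\<Sum>j\<in>UNIV. (2 - e) * (1 - c j))"
    unfolding sum[symmetric] by (rule sum_distrib_left)
  also have "\<dots> \<le> (\<Sum>j\<in>UNIV. (sin (x $ j))\<^sup>2)"
  proof (rule sum_mono)
    fix j
    have "1 - c j \<le> (\<Sum>j\<in>UNIV. 1 - c j)" using c1 by (intro member_le_sum) auto
    then have "2 - e \<le> 1 + c j" using sum by simp
    then have "(2 - e) * (1 - c j) \<le> (1 + c j) * (1 - c j)" using c1 by (intro mult_right_mono) auto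
    also have "\<dots> = 1 - (cos (x $ j))\<^sup>2" using s(1)
      by (auto simp: c_def power2_eq_square algebra_simps)
    finally show "(2 - e) * (1 - c j) \<le> (sin (x $ j))\<^sup>2" by (simp add: sin_squared_eq)
  qed
  also have "\<dots> = (norm (sinv x))\<^sup>2"
    unfolding power2_norm_eq_inner inner_vec_def by (simp add: power2_eq_square)
  also have "(norm (sinv x))\<^sup>2 = (norm (grad phi x))\<^sup>2 / 4"
    by (simp add: grad_phi power_mult_distrib)
  finally have "4 * ((2 - e) * e) \<le> (norm (grad phi x))\<^sup>2" by linarith
  moreover have "4 * e * (2 - e) = 4 * ((2 - e) * e)" by (simp only: mult.assoc mult.commute[of e])
  ultimately show ?thesis by (simp only:)
qed

lemma Lam_gap:
  assumes "lam \<in> Lam d"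
  shows "0 < (real d - \<bar>lam\<bar> / 2) * (2 - (real d - \<bar>lam\<bar> / 2))"
  using assms by (intro mult_pos_pos) (auto simp: Lam_def)

lemma sinv_nonzero:
  fixes x :: "real^'n::finite"
  assumes "phi x \<in> Lam CARD('n)"
  shows "sinv x \<noteq> 0"
proof
  assume "sinv x = 0"
  then have 0: "norm (grad phi x) = 0" by (simp add: grad_phi)
  define e where "e = real CARD('n) - \<bar>phi x\<bar> / 2"
  have "4 * e * (2 - e) \<le> 0" using norm_grad_phi_lower[OF assms] 0 by (simp add: e_def)
  moreover have "0 < e * (2 - e)" using Lam_gap[OF assms] by (simp add: e_def)
  moreover have "4 * e * (2 - e) = 4 * (e * (2 - e))" by (rule mult.assoc)
  ultimately show False by linarith
qed

definition hess_phi :: "real^'n \<Rightarrow> real^'n \<Rightarrow> real^'n" where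
  "hess_phi x u = (\<chi> i. -2 * cos (x $ i) * u $ i)"

lemma inner_hess_phi: "hess_phi x u \<bullet> v = -2 * (\<Sum>i\<in>UNIV. cos (x $ i) * (u $ i * v $ i))"
  by (simp add: hess_phi_def inner_vec_def sum_distrib_left mult_ac sum_negf)

lemma hess_phi_tangent_nonzero:
  fixes x :: "real^'n::finite"
  assumes "phi x \<in> Lam CARD('n)" "u \<bullet> grad phi x = 0" "u \<noteq> 0"
  shows "hess_phi x u \<bullet> u \<noteq> 0"
proof -
  obtain s where s: "s = 1 \<or> s = -1" "real CARD('n) - 2 < (\<Sum>j\<in>UNIV. s * cos (x $ j))"
    using phi_signed[OF assms(1)] by metis
  obtain k where k: "u $ k \<noteq> 0" using assms(3) by (auto simp: vec_eq_iff)
  have "0 < (\<Sum>j\<in>UNIV. (s * cos (x $ j)) * (u $ j)\<^sup>2)"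
  proof (rule tangential_hessian_pos[where s = "\<lambda>j. sin (x $ j)"])
    show "(s * cos (x $ j))\<^sup>2 + (sin (x $ j))\<^sup>2 = 1" for j using s(1)
      by (auto simp: power_mult_distrib)
    show "(\<Sum>j\<in>UNIV. sin (x $ j) * u $ j) = 0"
    proof -
      have "sinv x \<bullet> u = 0" using assms(2) by (simp add: grad_phi inner_commute)
      then show ?thesis by (simp add: inner_vec_def)
    qed
  qed (use s k in auto)
  also have "\<dots> = s * (\<Sum>j\<in>UNIV. cos (x $ j) * (u $ j)\<^sup>2)"
    by (simp add: sum_distrib_left mult_ac)
  finally show ?thesis by (auto simp: inner_hess_phi power2_eq_square)
qed

lemma abs_inner_hess_phi_le: "\<bar>hess_phi x u \<bullet> u\<bar>
    \<le> 2 * (u \<bullet> u)" for x :: "real^'n::finite"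
proof -
  have "\<bar>\<Sum>i\<in>UNIV. cos (x $ i) * (u $ i * u $ i)\<bar> \<le> (\<Sum>i\<in>UNIV. \<bar>cos (x $ i) * (u $ i * u $ i)\<bar>)"
    by (rule sum_abs)
  also have "\<dots> \<le> (\<Sum>i\<in>UNIV. u $ i * u $ i)"
    by (rule sum_mono) (simp add: abs_mult mult_left_le_one_le)
  also have "\<dots> = u \<bullet> u" by (simp add: inner_vec_def)
  finally show ?thesis by (simp add: inner_hess_phi abs_mult)
qed

text \<open>
  Differentiating the normalising factor \<open>1 / \<bar>grad phi\<bar>\<close> only produces a multiple of the gradient, which
  is orthogonal to \<open>v\<close>.
\<close>
lemma weingarten_inner:
  fixes x u v :: "real^'n::finite"
  assumes "grad phi x \<noteq> 0" "v \<bullet> grad phi x = 0"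
  shows "frechet_derivative (unit_normal phi) (at x) u \<bullet> v
      = hess_phi x u \<bullet> v / norm (grad phi x)"
proof -
  have G: "(grad phi has_derivative hess_phi x) (at x)"
  proof -
    have "((\<lambda>y. -2 *\<^sub>R sinv y) has_derivative hess_phi x) (at x)"
      unfolding has_derivative_componentwise_within[of "\<lambda>y. -2 *\<^sub>R sinv y"]
    proof
      fix b :: "real^'n" assume "b \<in> Basis"
      then obtain i where b: "b = axis i 1" by (auto simp: Basis_vec_def)
      have "((\<lambda>y :: real^'n. -2 * sin (y $ i)) has_derivative (\<lambda>u. -2 * cos (x $ i) * u $ i)) (at x)"
        by (auto intro!: derivative_eq_intros)
      then show "((\<lambda>y. (-2 *\<^sub>R sinv y) \<bullet> b) has_derivative (\<lambda>u. hess_phi x u \<bullet> b)) (at x)"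
        by (simp add: b inner_axis hess_phi_def)
    qed
    then show ?thesis by (simp add: grad_phi[abs_def])
  qed
  from Deriv.has_derivative_inverse[OF _ has_derivative_compose[OF G has_derivative_norm[OF assms(1)]]] assms(1)
  obtain D where D: "((\<lambda>y. inverse (norm (grad phi y))) has_derivative D) (at x)" by auto
  have "(unit_normal phi has_derivative (\<lambda>u. inverse (norm (grad phi x)) *\<^sub>R hess_phi x u + D u *\<^sub>R grad phi x)) (at x)"
    unfolding unit_normal_def[abs_def] by (rule has_derivative_scaleR[OF D G])
  then have "frechet_derivative (unit_normal phi) (at x) =
      (\<lambda>u. inverse (norm (grad phi x)) *\<^sub>R hess_phi x u + D u *\<^sub>R grad phi x)"
    by (rule frechet_derivative_at[symmetric])
  then show ?thesis using assms(2)
    by (simp add: inner_add_left inner_add_right inner_commute divide_inverse)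
qed

lemma curvature_space_inner:
  fixes x u v :: "real^'n::finite"
  assumes "grad phi x \<noteq> 0" "u \<in> curvature_space phi x \<mu>" "v \<bullet> grad phi x = 0"
  shows "\<mu> * (u \<bullet> v) = hess_phi x u \<bullet> v / norm (grad phi x)"
  using weingarten_inner[OF assms(1,3), of u] assms(2) by (simp add: curvature_space_def)

lemma principal_curvature_bounds:
  fixes x :: "real^'n::finite"
  assumes x: "phi x \<in> Lam CARD('n)" and \<mu>: "\<mu> \<in> principal_curvatures phi x"
  shows "\<mu> \<noteq> 0" "\<bar>\<mu>\<bar> \<le> 2 / norm (grad phi x)"
proof -
  have g: "grad phi x \<noteq> 0" using sinv_nonzero[OF x] by (simp add: grad_phi)
  obtain u where u: "u \<in> curvature_space phi x \<mu>" "u \<noteq> 0" using \<mu>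
    by (auto simp: principal_curvatures_def)
  have tan: "u \<bullet> grad phi x = 0" using u by (simp add: curvature_space_def)
  have eq: "\<mu> * (u \<bullet> u) = hess_phi x u \<bullet> u / norm (grad phi x)"
    by (rule curvature_space_inner[OF g u(1) tan])
  then show "\<mu> \<noteq> 0" using hess_phi_tangent_nonzero[OF x tan u(2)] g by auto
  have "\<bar>\<mu>\<bar> * (u \<bullet> u) = \<bar>hess_phi x u \<bullet> u\<bar> / norm (grad phi x)"
    using arg_cong[OF eq, of abs] by (simp add: abs_mult)
  also have "\<dots> \<le> 2 * (u \<bullet> u) / norm (grad phi x)"
    by (intro divide_right_mono abs_inner_hess_phi_le) simp
  also have "\<dots> = (2 / norm (grad phi x)) * (u \<bullet> u)" by simp
  finally show "\<bar>\<mu>\<bar> \<le> 2 / norm (grad phi x)" using u(2)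
    by (elim mult_right_le_imp_le) simp
qed

text \<open>
  The Hessian is symmetric, so eigenvectors of the Weingarten map for different curvatures are orthogonal.
\<close>
lemma card_principal_curvatures_le:
  fixes x :: "real^'n::finite"
  assumes x: "phi x \<in> Lam CARD('n)"
  shows "card (principal_curvatures phi x) \<le> CARD('n)"
proof -
  let ?P = "principal_curvatures phi x"
  have g: "grad phi x \<noteq> 0" using sinv_nonzero[OF x] by (simp add: grad_phi)
  have "\<forall>\<mu>\<in>?P. \<exists>u. u \<in> curvature_space phi x \<mu> \<and> u \<noteq> 0"
    by (auto simp: principal_curvatures_def)
  then obtain u where u: "\<And>\<mu>. \<mu> \<in> ?P \<Longrightarrow> u \<mu> \<in> curvature_space phi x \<mu>" "\<And>\<mu>. \<mu> \<in> ?P \<Longrightarrow> u \<mu> \<noteq> 0"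
    by metis
  have orth: "u \<mu> \<bullet> u \<nu> = 0"
    if "\<mu> \<in> ?P" "\<nu> \<in> ?P" "\<mu> \<noteq> \<nu>" for \<mu> \<nu>
  proof -
    have tan: "u \<mu> \<bullet> grad phi x = 0" "u \<nu> \<bullet> grad phi x = 0" using u(1) that
      by (auto simp: curvature_space_def)
    have "\<mu> * (u \<mu> \<bullet> u \<nu>) = hess_phi x (u \<mu>) \<bullet> u \<nu> / norm (grad phi x)"
      by (rule curvature_space_inner[OF g u(1) tan(2)]) fact
    also have "hess_phi x (u \<mu>) \<bullet> u \<nu> = hess_phi x (u \<nu>) \<bullet> u \<mu>"
      by (simp add: inner_hess_phi mult_ac)
    also have "\<dots> / norm (grad phi x) = \<nu> * (u \<nu> \<bullet> u \<mu>)"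
      by (rule curvature_space_inner[OF g u(1) tan(1), symmetric]) fact
    finally show ?thesis using that(3) by (simp add: inner_commute)
  qed
  have "inj_on u ?P"
  proof (rule inj_onI, rule ccontr)
    fix \<mu> \<nu> assume "\<mu> \<in> ?P" "\<nu> \<in> ?P" "u \<mu> = u \<nu>" "\<mu> \<noteq> \<nu>"
    with orth[of \<mu> \<nu>] u(2)[of \<mu>] show False by simp
  qed
  moreover have "independent (u ` ?P)"
  proof (rule pairwise_orthogonal_independent)
    show "pairwise orthogonal (u ` ?P)"
      unfolding pairwise_image pairwise_def orthogonal_def using orth by blast
    show "0 \<notin> u ` ?P" using u(2) by force
  qed
  ultimately show ?thesis using independent_bound[of "u ` ?P"] by (simp add: card_image)
qed

lemma total_curvature_phi_nonzero:
  fixes x :: "real^'n::finite"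
  assumes x: "phi x \<in> Lam CARD('n)"
  shows "total_curvature phi x \<noteq> 0"
proof (cases "finite (principal_curvatures phi x)")
  case True
  then show ?thesis using principal_curvature_bounds(1)[OF x] by (auto simp: total_curvature_def)
qed (simp add: total_curvature_def)

lemma total_curvature_phi_le:
  fixes x :: "real^'n::finite"
  assumes x: "phi x \<in> Lam CARD('n)" and L: "2 / norm (grad phi x) \<le> L" "1 \<le> L"
  shows "\<bar>total_curvature phi x\<bar> \<le> (L ^ CARD('n)) ^ CARD('n)"
proof -
  let ?P = "principal_curvatures phi x"
  have "\<bar>total_curvature phi x\<bar>
      = (\<Prod>\<mu>\<in>?P. \<bar>\<mu>\<bar> ^ dim (curvature_space phi x \<mu>))"
    by (simp add: total_curvature_def abs_prod power_abs)
  also have "\<dots> \<le> (\<Prod>\<mu>\<in>?P. L ^ CARD('n))"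
  proof (rule prod_mono, intro conjI)
    fix \<mu> assume "\<mu> \<in> ?P"
    then have "\<bar>\<mu>\<bar> \<le> L" using principal_curvature_bounds(2)[OF x] L by (meson order_trans)
    then have "\<bar>\<mu>\<bar> ^ dim (curvature_space phi x \<mu>)
        \<le> L ^ dim (curvature_space phi x \<mu>)"
      by (intro power_mono) auto
    also have "\<dots> \<le> L ^ CARD('n)"
      using dim_subset_UNIV[of "curvature_space phi x \<mu>"] L by (intro power_increasing) auto
    finally show "\<bar>\<mu>\<bar> ^ dim (curvature_space phi x \<mu>) \<le> L ^ CARD('n)" .
  qed simp
  also have "\<dots> = (L ^ CARD('n)) ^ card ?P" by simp
  also have "\<dots> \<le> (L ^ CARD('n)) ^ CARD('n)"
    using L card_principal_curvatures_le[OF x] by (intro power_increasing one_le_power) auto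
  finally show ?thesis .
qed

text \<open>
  The amplitude is a quotient with this denominator, and a quotient by 0 is 0; so a lower bound for the
  amplitude needs the denominator to be both bounded and non-zero.
\<close>
lemma amplitude_denominator_bounded:
  assumes "lam \<in> Lam CARD('n)"
  obtains B where "0 < B" "\<And>x :: real^'n::finite. phi x = lam \<Longrightarrow>
    0 < sqrt \<bar>total_curvature phi x\<bar> * norm (grad phi x) \<and>
    sqrt \<bar>total_curvature phi x\<bar> * norm (grad phi x) \<le> B"
proof -
  define e where "e = real CARD('n) - \<bar>lam\<bar> / 2"
  define m where "m = sqrt (4 * e * (2 - e))"
  have e: "0 < e * (2 - e)" using Lam_gap[OF assms] by (simp add: e_def)
  then have m: "0 < m" by (simp add: m_def mult.assoc)
  define L where "L = max 1 (2 / m)"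
  define B where "B = sqrt ((L ^ CARD('n)) ^ CARD('n)) * (2 * real CARD('n))"
  show thesis
  proof (rule that)
    show "0 < B" by (simp add: B_def L_def)
    fix x :: "real^'n" assume x: "phi x = lam"
    then have xL: "phi x \<in> Lam CARD('n)" using assms by simp
    have "m \<le> norm (grad phi x)"
      unfolding m_def using norm_grad_phi_lower[OF xL] by (intro real_le_lsqrt) (auto simp: e_def x)
    moreover from this have "2 / norm (grad phi x) \<le> 2 / m" using m
      by (intro divide_left_mono mult_pos_pos) auto
    ultimately have K: "\<bar>total_curvature phi x\<bar> \<le> (L ^ CARD('n)) ^ CARD('n)"
      by (intro total_curvature_phi_le[OF xL]) (auto simp: L_def)
    have "norm (sinv x) \<le> (\<Sum>i\<in>UNIV. \<bar>sinv x $ i\<bar>)" by (rule norm_le_l1_cart)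
    also have "\<dots> \<le> (\<Sum>i\<in>(UNIV::'n set). 1)" by (rule sum_mono) simp
    finally have G: "norm (grad phi x) \<le> 2 * real CARD('n)" by (simp add: grad_phi)
    have "0 < norm (grad phi x)" using m \<open>m \<le> norm (grad phi x)\<close> by linarith
    then show "0 < sqrt \<bar>total_curvature phi x\<bar> * norm (grad phi x) \<and>
      sqrt \<bar>total_curvature phi x\<bar> * norm (grad phi x) \<le> B"
      unfolding B_def using total_curvature_phi_nonzero[OF xL] K G
      by (intro conjI mult_pos_pos mult_mono) auto
  qed
qed


section \<open>The torus, the Gauss map and the characters\<close>

lemma abs_torus_surj: obtains q where "k = abs_torus (q :: real^'n::finite)"
  by (metis Quotient_torus Quotient_abs_rep)

lemma abs_torus_eq_iff:
  "abs_torus (p :: real^'n::finite) = abs_torus q \<longleftrightarrow> (\<forall>i. cos (p $ i)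
      = cos (q $ i) \<and> sin (p $ i) = sin (q $ i))"
proof -
  have "abs_torus p = abs_torus q \<longleftrightarrow> (\<exists>m :: int^'n. p
      = q + (2 * pi) *\<^sub>R ivec m)"
    by (simp add: torus.abs_eq_iff torus_rel_def)
  also have "\<dots> \<longleftrightarrow> (\<exists>m :: int^'n. \<forall>i. p $ i
      = q $ i + 2 * pi * of_int (m $ i))"
    by (simp add: vec_eq_iff ivec_def)
  also have "\<dots> \<longleftrightarrow> (\<forall>i. \<exists>n :: int. p $ i
      = q $ i + 2 * pi * of_int n)"
    by (metis (no_types, lifting) vec_lambda_beta)
  also have "\<dots> \<longleftrightarrow> (\<forall>i. cos (p $ i) = cos (q $ i) \<and> sin (p $ i)
      = sin (q $ i))"
    by (metis sin_cos_eq_iff)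
  finally show ?thesis .
qed

lemma abs_torus_periodic: "abs_torus (q + (2 * pi) *\<^sub>R ivec m) = abs_torus (q :: real^'n::finite)"
  by (auto simp: torus.abs_eq_iff torus_rel_def)

lemma continuous_on_abs_torus: "continuous_on A (abs_torus :: real^'n::finite \<Rightarrow> 'n torus)"
proof -
  have "continuous_on UNIV (abs_torus :: real^'n \<Rightarrow> 'n torus)"
    by (simp add: continuous_on_open_vimage open_torus_def)
  then show ?thesis by (rule continuous_on_subset) simp
qed

lemma continuous_on_torusI:
  fixes f :: "'n::finite torus \<Rightarrow> 'b::topological_space"
  assumes "continuous_on UNIV (\<lambda>q. f (abs_torus q))"
  shows "continuous_on UNIV f"
  using assms by (simp add: continuous_on_open_vimage open_torus_def vimage_def)

lemma fundamental_cell_representative: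
  fixes q :: "real^'n::finite"
  obtains m where "q + (2 * pi) *\<^sub>R ivec m \<in> fundamental_cell"
proof
  have pi2: "0 < 2 * pi" by simp
  define m :: "int^'n" where "m = (\<chi> i. - \<lfloor>(q $ i + pi) / (2 * pi)\<rfloor>)"
  have "- pi \<le> q $ i - 2 * pi * of_int \<lfloor>(q $ i
      + pi) / (2 * pi)\<rfloor> \<and> q $ i - 2 * pi * of_int \<lfloor>(q $ i
          + pi) / (2 * pi)\<rfloor> < pi" for i
  proof -
    have "of_int \<lfloor>(q $ i + pi) / (2 * pi)\<rfloor> \<le> (q $ i + pi) / (2 * pi)"
      "(q $ i + pi) / (2 * pi) < of_int \<lfloor>(q $ i + pi) / (2 * pi)\<rfloor> + 1" by linarith+
    then have "of_int \<lfloor>(q $ i + pi) / (2 * pi)\<rfloor> * (2 * pi) \<le> q $ i + pi"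
      "q $ i + pi < (of_int \<lfloor>(q $ i + pi) / (2 * pi)\<rfloor> + 1) * (2 * pi)"
      unfolding pos_le_divide_eq[OF pi2] pos_divide_less_eq[OF pi2] .
    moreover have "a * (2 * pi) \<le> b \<Longrightarrow> b < (a + 1) * (2 * pi) \<Longrightarrow>
        - pi \<le> b - pi - 2 * pi * a \<and> b - pi - 2 * pi * a < pi" for a b
      by (simp add: algebra_simps)
    ultimately show ?thesis by force
  qed
  then show "q + (2 * pi) *\<^sub>R ivec m \<in> fundamental_cell"
    by (simp add: fundamental_cell_def ivec_def m_def)
qed

lemma fundamental_cell_borel: "(fundamental_cell :: (real^'n::finite) set) \<in> sets borel"
proof -
  have "fundamental_cell = (\<Inter>i. {q :: real^'n. - pi \<le> q $ i} \<inter> {q. q $ i < pi})"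
    by (auto simp: fundamental_cell_def)
  also have "\<dots> \<in> sets borel"
    by (intro sets.countable_INT'' sets.Int borel_closed borel_open closed_Collect_le open_Collect_less continuous_intros) auto
  finally show ?thesis .
qed

lemma closed_Gam: "closed (Gam lam :: 'n::finite torus set)"
proof -
  have "continuous_on UNIV (torus_phi :: 'n torus \<Rightarrow> real)"
    by (rule continuous_on_torusI) (simp add: torus_phi.abs_eq continuous_on_phi)
  then have "closed (torus_phi -` {lam} :: 'n torus set)" by (intro closed_vimage) auto
  then show ?thesis by (simp add: Gam_def vimage_def)
qed

text \<open>
  A lift of the piece may cross the faces of the fundamental cell.  Therefore the slab over the lift is only
  covered by countably many translates of the slab over the part in the cell; since the former is
  not negligible, neither is the latter.
\<close>
lemma Gam_measure_pos:
  fixes U :: "'n::finite torus set"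
  assumes "open U" "k \<in> U" "k \<in> Gam lam" and lam: "lam \<in> Lam CARD('n)"
  shows "emeasure (Gam_measure lam) (U \<inter> Gam lam) > 0"
proof -
  let ?n = "CARD('n) - 1"
  define S where "S = {q \<in> fundamental_cell. phi q = lam} \<inter> abs_torus -` U"
  obtain q where q: "k = abs_torus q" by (rule abs_torus_surj)
  then have phq: "phi q = lam" using assms(3) by (simp add: Gam_def torus_phi.abs_eq)
  then have "sinv q \<noteq> 0" using sinv_nonzero lam by metis
  then obtain i where i: "sin (q $ i) \<noteq> 0" by (auto simp: vec_eq_iff)
  define W where "W = (abs_torus -` U :: (real^'n) set)"
  have "\<not> negligible (slab i (W \<inter> {x. phi x = phi q}))"
    by (rule not_negligible_slab_level_set[OF continuous_on_phi has_derivative_phi])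
      (use i q assms(1,2) in \<open>auto simp: W_def open_torus_def\<close>)
  moreover have "slab i (W \<inter> {x. phi x
      = phi q}) \<subseteq> (\<Union>m. (+) ((2 * pi) *\<^sub>R ivec m) ` slab i S)"
  proof
    fix z assume "z \<in> slab i (W \<inter> {x. phi x = phi q})"
    then obtain x t where x: "z = x + t *\<^sub>R axis i 1" "\<bar>t\<bar>
        \<le> 1" "x \<in> W" "phi x = lam"
      by (auto simp: slab_def phq)
    obtain m where m: "x + (2 * pi) *\<^sub>R ivec m \<in> fundamental_cell"
      by (rule fundamental_cell_representative)
    then have "x + (2 * pi) *\<^sub>R ivec m \<in> S"
      using x by (simp add: S_def phi_periodic abs_torus_periodic W_def)
    then have "x + (2 * pi) *\<^sub>R ivec m + t *\<^sub>R axis i 1 \<in> slab i S"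
      using x(2) by (auto simp: slab_def)
    moreover have "z = (2 * pi) *\<^sub>R ivec (- m) + (x + (2 * pi) *\<^sub>R ivec m
        + t *\<^sub>R axis i 1)"
      by (simp add: x ivec_simps)
    ultimately show "z \<in> (\<Union>m. (+) ((2 * pi) *\<^sub>R ivec m) ` slab i S)" by blast
  qed
  ultimately have "\<not> negligible (\<Union>m. (+) ((2 * pi) *\<^sub>R ivec m) ` slab i S)"
    using negligible_subset by blast
  then have "\<not> negligible (slab i S)"
    by (auto intro!: negligible_countable_Union negligible_translation)
  then have pos: "hausdorff_outer ?n S \<noteq> 0" using negligible_slab by metis
  have L: "{q :: real^'n. phi q = lam} \<in> sets borel"
    by (intro borel_closed closed_Collect_eq continuous_on_phi continuous_intros)
  have cell: "{q \<in> fundamental_cell. phi q = lam} \<in> sets (borel :: (real^'n) measure)"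
    using sets.Int[OF fundamental_cell_borel L] by (simp add: Int_def)
  have W: "abs_torus -` U \<in> sets (borel :: (real^'n) measure)" using assms(1)
    by (simp add: open_torus_def)
  have S: "S \<in> sets borel" unfolding S_def by (intro sets.Int cell W)
  let ?R = "restrict_space (hausdorff_measure ?n) {q \<in> fundamental_cell. phi q
      = lam} :: (real^'n) measure"
  have "emeasure (Gam_measure lam) (U \<inter> Gam lam)
      = emeasure ?R (abs_torus -` (U \<inter> Gam lam) \<inter> space ?R)"
    unfolding Gam_measure_def
  proof (rule emeasure_distr)
    have "abs_torus \<in> measurable (borel :: (real^'n) measure) borel"
      by (intro borel_measurable_continuous_onI continuous_on_abs_torus)
    then show "abs_torus \<in> measurable ?R borel"
      by (intro measurable_restrict_space1) (simp add: measurable_def)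
    show "U \<inter> Gam lam \<in> sets borel" using assms(1) closed_Gam[of lam]
      by (intro sets.Int borel_open borel_closed)
  qed
  also have "abs_torus -` (U \<inter> Gam lam) \<inter> space ?R = S"
    by (auto simp: S_def space_restrict_space Gam_def torus_phi.abs_eq)
  also have "emeasure ?R S = emeasure (hausdorff_measure ?n) S"
    using cell by (intro emeasure_restrict_space) (auto simp: S_def)
  also have "\<dots> = hausdorff_outer ?n S" by (rule emeasure_hausdorff_measure[OF S])
  finally show ?thesis using pos by (simp add: zero_less_iff_neq_zero)
qed

lemma sets_Gam_measure [simp]: "sets (Gam_measure lam) = sets borel" "space (Gam_measure lam) = UNIV"
  by (simp_all add: Gam_measure_def)

definition normal_at :: "'n::finite torus \<Rightarrow> real^'n" where
  "normal_at k = torus_grad_phi k /\<^sub>R norm (torus_grad_phi k)"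

lemma normal_at_abs_torus: "normal_at (abs_torus q) = - sinv q /\<^sub>R norm (sinv q)"
  by (simp add: normal_at_def torus_grad_phi.abs_eq grad_phi)

lemma normal_at_eq_iff:
  fixes q :: "real^'n::finite"
  assumes "phi q \<in> Lam CARD('n)"
  shows "normal_at (abs_torus q) = \<omega> \<longleftrightarrow> sinv q
      = - norm (sinv q) *\<^sub>R \<omega>"
proof -
  have "norm (sinv q) \<noteq> 0" using sinv_nonzero[OF assms] by simp
  then show ?thesis unfolding normal_at_abs_torus
    by (metis (no_types, lifting) scaleR_minus_left scaleR_minus_right minus_minus divideR_right)
qed

lemma angle_vector:
  fixes c s :: "'n::finite \<Rightarrow> real"
  assumes "\<And>i. (c i)\<^sup>2 + (s i)\<^sup>2 = 1"
  obtains q :: "real^'n" where "\<And>i. cos (q $ i) = c i" "\<And>i. sin (q $ i) = s i"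
proof -
  have "\<exists>t. c i = cos t \<and> s i = sin t" for i using sincos_total_2pi[OF assms[of i]] by metis
  then obtain t where "\<And>i. c i = cos (t i) \<and> s i = sin (t i)" by metis
  then show thesis by (intro that[of "\<chi> i. t i"]) auto
qed

text \<open>
  The normal direction fixes the sines of the coordinates up to one positive factor, and the level
  fixes the sum of the cosines; so this is \<open>cosines_exist\<close> and \<open>cosines_unique\<close>.
\<close>
lemma kappa_ex1:
  fixes \<omega> :: "real^'n::finite"
  assumes lam: "lam \<in> Lam CARD('n)" and \<omega>: "norm \<omega> = 1"
  shows "\<exists>!k. k \<in> Gam lam \<and> normal_at k = \<omega>"
proof (rule ex_ex1I)
  have "\<omega> \<noteq> 0" using \<omega> by auto
  then obtain l where l: "\<omega> $ l \<noteq> 0" by (auto simp: vec_eq_iff)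
  define s :: real where "s = (if 0 \<le> lam then 1 else -1)"
  have s: "s = 1 \<or> s = -1" "s * \<bar>lam\<bar> = lam" by (auto simp: s_def)
  show "\<exists>k. k \<in> Gam lam \<and> normal_at k = \<omega>"
  proof -
    obtain t c where tc: "0 < t" "\<And>j. (c j)\<^sup>2 + t\<^sup>2 * (\<omega> $ j)\<^sup>2
        = 1" "(\<Sum>j\<in>UNIV. c j) = \<bar>lam\<bar> / 2"
      using cosines_exist[of "\<bar>lam\<bar> / 2" "\<lambda>j. \<omega> $ j" l] l lam by (auto simp: Lam_def)
    have sq: "(s * c i)\<^sup>2 + (- t * \<omega> $ i)\<^sup>2 = 1" for i using tc(2)[of i] s(1)
      by (auto simp: power_mult_distrib)
    obtain q :: "real^'n" where q: "\<And>i. cos (q $ i) = s * c i" "\<And>i. sin (q $ i)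
        = - t * \<omega> $ i"
      using angle_vector[of "\<lambda>i. s * c i" "\<lambda>i. - t * \<omega> $ i", OF sq] by blast
    have "(\<Sum>i\<in>UNIV. cos (q $ i)) = s * (\<bar>lam\<bar> / 2)"
      by (simp add: q tc(3) flip: sum_distrib_left)
    then have ph: "phi q = lam" using s by (simp add: phi_def)
    have "sinv q = (- t) *\<^sub>R \<omega>" by (simp add: vec_eq_iff q)
    then have "sinv q = - norm (sinv q) *\<^sub>R \<omega>" using tc(1) \<omega> by simp
    then have "normal_at (abs_torus q) = \<omega>" using normal_at_eq_iff ph lam by metis
    then show ?thesis using ph by (intro exI[of _ "abs_torus q"]) (simp add: Gam_def torus_phi.abs_eq)
  qed
  fix k k' assume k: "k \<in> Gam lam \<and> normal_at k
      = \<omega>" and k': "k' \<in> Gam lam \<and> normal_at k' = \<omega>"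
  obtain p where p: "k = abs_torus p" by (rule abs_torus_surj)
  obtain q where q: "k' = abs_torus q" by (rule abs_torus_surj)
  have php: "phi p = lam" and phq: "phi q = lam" using k k' by (auto simp: p q Gam_def torus_phi.abs_eq)
  have sp: "sinv p = - norm (sinv p) *\<^sub>R \<omega>" and sq: "sinv q
      = - norm (sinv q) *\<^sub>R \<omega>"
    using k k' normal_at_eq_iff php phq lam unfolding p q by metis+
  have "sin (p $ j) = - norm (sinv p) * \<omega> $ j" for j using arg_cong[OF sp, of "\<lambda>v. v $ j"]
    by simp
  moreover have "sin (q $ j) = - norm (sinv q) * \<omega> $ j" for j using arg_cong[OF sq, of "\<lambda>v. v $ j"]
    by simp
  ultimately have sn: "sin (p $ j) = - norm (sinv p) * \<omega> $ j" "sin (q $ j) = - norm (sinv q) * \<omega> $ j" for j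
    by blast+
  have sums: "(\<Sum>j\<in>UNIV. s * cos (r $ j)) = \<bar>lam\<bar> / 2" if "phi r = lam" for r :: "real^'n"
  proof -
    have "(\<Sum>j\<in>UNIV. s * cos (r $ j)) = s * (lam / 2)" using that
      by (simp add: phi_def flip: sum_distrib_left)
    then show ?thesis using s by auto
  qed
  have sq1: "(s * cos (r $ j))\<^sup>2 + (norm (sinv r))\<^sup>2 * (\<omega> $ j)\<^sup>2 = 1"
    if "sin (r $ j) = - norm (sinv r) * \<omega> $ j" for r :: "real^'n" and j
  proof -
    have "(s * cos (r $ j))\<^sup>2 = (cos (r $ j))\<^sup>2" using s by (auto simp: power_mult_distrib)
    moreover have "(sin (r $ j))\<^sup>2 = (norm (sinv r))\<^sup>2 * (\<omega> $ j)\<^sup>2"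
      by (simp only: that) (simp add: power_mult_distrib)
    ultimately show ?thesis using sin_cos_squared_add[of "r $ j"] by linarith
  qed
  have "sinv p \<noteq> 0" "sinv q \<noteq> 0" using sinv_nonzero php phq lam by metis+
  then have pos: "0 < norm (sinv p)" "0 < norm (sinv q)" by auto
  note U = cosines_unique[of "\<lambda>j. s * cos (p $ j)" "norm (sinv p)" "\<lambda>j. \<omega> $ j" "\<lambda>j. s * cos (q $ j)" "norm (sinv q)" l]
  have "(\<lambda>j. s * cos (p $ j)) = (\<lambda>j. s * cos (q $ j))" "norm (sinv p) = norm (sinv q)"
    using lam l by (intro U sq1 sn pos; simp add: sums php phq Lam_def)+
  then have "cos (p $ j) = cos (q $ j)" "sin (p $ j) = sin (q $ j)" for j
    using s(1) by (auto simp: fun_eq_iff sn)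
  then show "k = k'" unfolding p q abs_torus_eq_iff by blast
qed

lemma kappa_spec:
  fixes \<omega> :: "real^'n::finite"
  assumes "lam \<in> Lam CARD('n)" "norm \<omega> = 1"
  shows "kappa \<omega> lam \<in> Gam lam" "normal_at (kappa \<omega> lam) = \<omega>"
  using theI'[OF kappa_ex1[OF assms]] unfolding kappa_def normal_at_def by auto

lemma kappa_eqI:
  fixes k :: "'n::finite torus"
  assumes "lam \<in> Lam CARD('n)" "k \<in> Gam lam" "normal_at k = \<omega>" "norm \<omega> = 1"
  shows "kappa \<omega> lam = k"
  using kappa_ex1[OF assms(1,4)] kappa_spec[OF assms(1,4)] assms(2,3) by blast

text \<open>
  The standard embedding of the torus into Euclidean space; closed graph arguments take place there.
\<close>
lift_definition torus_cos_sin :: "'n::finite torus \<Rightarrow> (real^'n) \<times> (real^'n)" is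
  "\<lambda>q. (\<chi> i. cos (q $ i), \<chi> i. sin (q $ i))"
  using abs_torus_eq_iff by (force simp: torus.abs_eq_iff[symmetric] vec_eq_iff)

text \<open>
  By uniqueness, the graph is the set of all \<open>(\<omega>, c, s)\<close> that satisfy the defining equations of \<open>\<kappa>\<close>, so
  it is closed; and the values lie in a compact set.
\<close>
lemma continuous_on_kappa:
  assumes lam: "lam \<in> Lam CARD('n)"
  shows "continuous_on (sphere 0 1) (\<lambda>\<omega> :: real^'n::finite. torus_cos_sin (kappa \<omega> lam))"
proof -
  let ?f = "\<lambda>\<omega> :: real^'n. torus_cos_sin (kappa \<omega> lam)"
  let ?S = "sphere 0 1 :: (real^'n) set"
  define T :: "((real^'n) \<times> (real^'n)) set" where "T = cbox (-1) 1 \<times> cbox (-1) 1"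
  have T: "compact T" unfolding T_def by (intro compact_Times compact_cbox)
  have fT: "torus_cos_sin k \<in> T" for k :: "'n torus"
  proof -
    obtain q where q: "k = abs_torus q" by (rule abs_torus_surj)
    show ?thesis by (simp add: q torus_cos_sin.abs_eq T_def mem_box_cart)
  qed
  define E :: "((real^'n) \<times> (real^'n) \<times> (real^'n)) set" where
    "E = {z. (\<forall>i. (fst (snd z) $ i)\<^sup>2 + (snd (snd z) $ i)\<^sup>2
        = 1) \<and> 2 * (\<Sum>i\<in>UNIV. fst (snd z) $ i) = lam
          \<and> snd (snd z) = - norm (snd (snd z)) *\<^sub>R fst z}"
  have "closed E" unfolding E_def
    by (intro closed_Collect_conj closed_Collect_all closed_Collect_eq continuous_intros)
  moreover have "(\<lambda>x. (x, ?f x)) ` ?S = (?S \<times> T) \<inter> E"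
  proof (intro equalityI subsetI)
    fix z assume "z \<in> (\<lambda>x. (x, ?f x)) ` ?S"
    then obtain \<omega> where \<omega>: "norm \<omega> = 1" "z = (\<omega>, ?f \<omega>)" by auto
    obtain q where q: "kappa \<omega> lam = abs_torus q" by (rule abs_torus_surj)
    have ph: "phi q = lam" using kappa_spec(1)[OF lam \<omega>(1)] by (simp add: q Gam_def torus_phi.abs_eq)
    have "sinv q = - norm (sinv q) *\<^sub>R \<omega>"
      using kappa_spec(2)[OF lam \<omega>(1)] normal_at_eq_iff[of q \<omega>] ph lam by (simp add: q)
    then show "z \<in> (?S \<times> T) \<inter> E"
      using \<omega> fT[of "abs_torus q"] ph by (simp add: E_def q torus_cos_sin.abs_eq phi_def sinv_def)
  next
    fix z assume "z \<in> (?S \<times> T) \<inter> E"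
    then obtain \<omega> c s where z: "z = (\<omega>, c, s)" "norm \<omega>
        = 1" "\<And>i. (c $ i)\<^sup>2 + (s $ i)\<^sup>2 = 1"
      "2 * (\<Sum>i\<in>UNIV. c $ i) = lam" "s = - norm s *\<^sub>R \<omega>"
        by (cases z) (auto simp: E_def)
    obtain q :: "real^'n" where q: "\<And>i. cos (q $ i) = c $ i" "\<And>i. sin (q $ i) = s $ i"
      using angle_vector[of "\<lambda>i. c $ i" "\<lambda>i. s $ i"] z(3) by blast
    have ph: "phi q = lam" using z(4) by (simp add: phi_def q)
    have s: "sinv q = s" by (simp add: vec_eq_iff q)
    have "normal_at (abs_torus q) = \<omega>" using normal_at_eq_iff[of q \<omega>] ph lam z(5) s by metis
    then have "kappa \<omega> lam = abs_torus q"
      using ph z(2) by (intro kappa_eqI[OF lam]) (auto simp: Gam_def torus_phi.abs_eq)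
    then have "?f \<omega> = (c, s)" by (simp add: torus_cos_sin.abs_eq q vec_eq_iff)
    then show "z \<in> (\<lambda>x. (x, ?f x)) ` ?S" using z(1,2)
      by (intro image_eqI[of _ _ \<omega>]) simp_all
  qed
  ultimately have "closedin (top_of_set (?S \<times> T)) ((\<lambda>x. (x, ?f x)) ` ?S)"
    by (simp add: closedin_closed_Int)
  moreover have "?f \<in> ?S \<rightarrow> T" using fT by simp
  ultimately show ?thesis by (simp only: continuous_closed_graph_eq[OF T])
qed

text \<open>
  The character \<open>p \<mapsto> exp (- i p \<bullet> x)\<close> of the torus (see \<open>chr_abs_torus\<close>), written through \<open>cis\<close> of the
  coordinates so that it visibly depends on their cosines and sines only.
\<close>
lift_definition chr :: "int^'n::finite \<Rightarrow> 'n torus \<Rightarrow> complex" is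
  "\<lambda>x p. \<Prod>i\<in>UNIV. cis (p $ i) powi (- (x $ i))"
  by (rule prod.cong) (auto simp: torus.abs_eq_iff[symmetric] abs_torus_eq_iff cis.code)

lemma chr_abs_torus: "chr x (abs_torus p) = exp (- (\<i> * of_real (p \<bullet> ivec x)))"
proof -
  have "cis (p $ i) powi (- (x $ i)) = exp (- (\<i> * of_real (p $ i * of_int (x $ i))))" for i
  proof -
    have "cis (p $ i) powi (- (x $ i)) = cis (of_int (- (x $ i)) * p $ i)" by (rule cis_power_int)
    then show ?thesis by (simp add: cis_conv_exp mult_ac)
  qed
  then show ?thesis
    by (simp add: chr.abs_eq exp_sum[symmetric] inner_vec_def ivec_def sum_distrib_left sum_negf)
qed

lemma chr_minus: "chr x (a - b) = chr x a * cnj (chr x b)"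
proof -
  obtain p where p: "a = abs_torus p" by (rule abs_torus_surj)
  obtain q where q: "b = abs_torus q" by (rule abs_torus_surj)
  have ab: "a - b = abs_torus (p - q)"
    by (simp add: p q minus_torus_def uminus_torus.abs_eq plus_torus.abs_eq)
  show ?thesis unfolding ab unfolding p q chr_abs_torus
    by (simp add: inner_diff_left exp_cnj right_diff_distrib flip: exp_add)
qed

lemma continuous_on_chr: "continuous_on A (chr x :: 'n::finite torus \<Rightarrow> complex)"
proof -
  have "continuous_on UNIV (chr x :: 'n torus \<Rightarrow> complex)"
    by (rule continuous_on_torusI) (unfold chr_abs_torus, intro continuous_intros)
  then show ?thesis by (rule continuous_on_subset) simp
qed

lemma continuous_on_chr_kappa:
  assumes lam: "lam \<in> Lam CARD('n)"
  shows "continuous_on (sphere 0 1) (\<lambda>\<omega> :: real^'n::finite. chr x (kappa \<omega> lam))"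
proof -
  define h :: "(real^'n) \<times> (real^'n) \<Rightarrow> complex" where
    "h = (\<lambda>z. \<Prod>i\<in>UNIV. (of_real (fst z $ i)
        + \<i> * of_real (snd z $ i)) powi (- (x $ i)))"
  have cis: "of_real (fst (torus_cos_sin (abs_torus q)) $ i)
      + \<i> * of_real (snd (torus_cos_sin (abs_torus q)) $ i) = cis (q $ i)"
    for q :: "real^'n" and i by (simp add: torus_cos_sin.abs_eq complex_eq_iff)
  have "chr x k = h (torus_cos_sin k)" for k
  proof -
    obtain q where q: "k = abs_torus q" by (rule abs_torus_surj)
    show ?thesis by (simp add: h_def q cis chr.abs_eq)
  qed
  moreover have "continuous_on (sphere 0 1) (\<lambda>\<omega> :: real^'n. h (torus_cos_sin (kappa \<omega> lam)))"
    unfolding h_def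
  proof (rule continuous_on_prod, rule continuous_on_power_int[OF _ disjI2])
    fix i
    show "continuous_on (sphere 0 1) (\<lambda>\<omega> :: real^'n. of_real (fst (torus_cos_sin (kappa \<omega> lam)) $ i)
        + \<i> * of_real (snd (torus_cos_sin (kappa \<omega> lam)) $ i) :: complex)"
      by (intro continuous_intros continuous_on_kappa[OF lam])
    show "\<forall>\<omega>\<in>sphere 0 1. of_real (fst (torus_cos_sin (kappa \<omega> lam)) $ i)
        + \<i> * of_real (snd (torus_cos_sin (kappa \<omega> lam)) $ i) \<noteq> (0 :: complex)"
    proof
      fix \<omega> :: "real^'n"
      obtain q where q: "kappa \<omega> lam = abs_torus q" by (rule abs_torus_surj)
      show "of_real (fst (torus_cos_sin (kappa \<omega> lam)) $ i)
          + \<i> * of_real (snd (torus_cos_sin (kappa \<omega> lam)) $ i) \<noteq> (0 :: complex)"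
        unfolding q cis by simp
    qed
  qed
  ultimately show ?thesis by simp
qed

lemma vhat_eq_sum:
  assumes "finite F" "\<And>x. v x \<noteq> 0 \<Longrightarrow> x \<in> F"
  shows "vhat v (p :: 'n::finite torus)
      = of_real ((2 * pi) powr (- (real CARD('n) / 2))) * (\<Sum>x\<in>F. v x * chr x p)"
proof -
  obtain q where q: "p = abs_torus q" by (rule abs_torus_surj)
  have "(\<Sum>\<^sub>\<infinity>x. v x * chr x p) = (\<Sum>\<^sub>\<infinity>x\<in>F. v x * chr x p)"
    by (rule infsum_cong_neutral) (use assms(2) in auto)
  also have "\<dots> = (\<Sum>x\<in>F. v x * chr x p)" using assms(1) by simp
  finally show ?thesis by (simp add: q vhat.abs_eq chr_abs_torus)
qed


section \<open>The amplitude determines the potential\<close>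

text \<open>
  The easy half of Lagrange's multiplier rule.  For small \<open>t\<close> the level set contains a point
  \<open>q + t u + r g\<close> with \<open>\<bar>r\<bar> \<le> e t\<close>,
    by the intermediate value theorem in \<open>r\<close>.  There \<open>f\<close> vanishes, so
  the first-order expansion of \<open>f\<close> bounds \<open>t D u\<close>
    by a multiple of \<open>e t\<close>.
\<close>
lemma derivative_vanishes_on_tangent:
  fixes f :: "'a::euclidean_space \<Rightarrow> 'b::real_normed_vector" and h :: "'a \<Rightarrow> real"
  assumes cont: "continuous_on UNIV h" and dh: "(h has_derivative (\<lambda>v. g \<bullet> v)) (at q)" and g: "g \<noteq> 0"
    and df: "(f has_derivative D) (at q)" and W: "open W" "q \<in> W"
    and zero: "\<And>x. x \<in> W \<Longrightarrow> h x = h q \<Longrightarrow>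
        f x = 0" and u: "u \<bullet> g = 0"
  shows "D u = 0"
proof -
  have bl: "bounded_linear D" using df by (rule has_derivative_bounded_linear)
  then obtain B where B: "0 < B" "\<And>v. norm (D v) \<le> norm v * B" using bounded_linear.pos_bounded
    by blast
  define M where "M = norm u + norm g"
  have M: "0 < M" using g by (simp add: M_def add_nonneg_pos)
  obtain r0 where r0: "0 < r0" "ball q r0 \<subseteq> W" using W by (metis open_contains_ball)
  have bound: "norm (D u) \<le> e * (M + norm g * B)" if e: "0 < e" "e \<le> 1" for e
  proof -
    \<comment> \<open>With this tolerance the error along the segment is at most half of the first-order change.\<close>
    define e1 where "e1 = e * (norm g)\<^sup>2 / (2 * M)"
    have e1: "0 < e1" using e g M by (simp add: e1_def)
    from dh[unfolded has_derivative_at_alt] e1 obtain d1 where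
      d1: "0 < d1" "\<And>y. norm (y - q) < d1 \<Longrightarrow>
          \<bar>h y - h q - g \<bullet> (y - q)\<bar> \<le> e1 * norm (y - q)"
      by (auto simp: real_norm_def)
    from df[unfolded has_derivative_at_alt] e obtain d2 where
      d2: "0 < d2" "\<And>y. norm (y - q) < d2 \<Longrightarrow>
          norm (f y - f q - D (y - q)) \<le> e * norm (y - q)"
      by auto
    define t where "t = min r0 (min d1 d2) / (2 * M)"
    have t: "0 < t" using r0 d1 d2 M by (simp add: t_def)
    have tM: "t * M < r0" "t * M < d1" "t * M < d2" using r0 d1 d2 M by (auto simp: t_def)
    have small: "norm (t *\<^sub>R u + r *\<^sub>R g) \<le> t * M" if "\<bar>r\<bar> \<le> e * t" for r
    proof -
      have "\<bar>r\<bar> \<le> t" using that e t mult_right_mono[of e 1 t] by linarith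
      then have "\<bar>r\<bar> * norm g \<le> t * norm g" by (intro mult_right_mono) auto
      then show ?thesis using norm_triangle_ineq[of "t *\<^sub>R u" "r *\<^sub>R g"] t
        by (simp add: M_def distrib_left)
    qed
    have est: "\<bar>h (q + (t *\<^sub>R u + r *\<^sub>R g)) - h q - r * (norm g)\<^sup>2\<bar>
        \<le> e * t * (norm g)\<^sup>2 / 2"
      if "\<bar>r\<bar> \<le> e * t" for r
    proof -
      let ?v = "t *\<^sub>R u + r *\<^sub>R g"
      have "\<bar>h (q + ?v) - h q - g \<bullet> ?v\<bar> \<le> e1 * norm ?v"
        using d1(2)[of "q + ?v"] small[OF that] tM by simp
      also have "\<dots> \<le> e1 * (t * M)" using small[OF that] e1 by (intro mult_left_mono) auto
      also have "\<dots> = e * t * (norm g)\<^sup>2 / 2" using M by (simp add: e1_def)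
      also have "g \<bullet> ?v = r * (norm g)\<^sup>2" using u
        by (simp add: inner_add_right inner_commute power2_norm_eq_inner)
      finally show ?thesis .
    qed
    have et: "\<bar>- (e * t)\<bar> \<le> e * t" "\<bar>e * t\<bar> \<le> e * t" using e t by auto
    have gpos: "0 < e * t * (norm g)\<^sup>2" using e t g by simp
    have "\<exists>r. - (e * t) \<le> r \<and> r
        \<le> e * t \<and> h (q + (t *\<^sub>R u + r *\<^sub>R g)) = h q"
    proof (rule IVT')
      show "h (q + (t *\<^sub>R u + (- (e * t)) *\<^sub>R g)) \<le> h q"
        using abs_le_D1[OF est[OF et(1)]] gpos by simp
      show "h q \<le> h (q + (t *\<^sub>R u + (e * t) *\<^sub>R g))"
        using abs_le_D2[OF est[OF et(2)]] gpos by simp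
      show "- (e * t) \<le> e * t" using e t by simp
      show "continuous_on {- (e * t)..e * t} (\<lambda>r. h (q + (t *\<^sub>R u + r *\<^sub>R g)))"
        by (intro continuous_on_compose2[OF cont] continuous_intros) auto
    qed
    then obtain r where "- (e * t) \<le> r" "r
        \<le> e * t" and hr: "h (q + (t *\<^sub>R u + r *\<^sub>R g)) = h q"
      by blast
    then have r: "\<bar>r\<bar> \<le> e * t" by linarith
    let ?v = "t *\<^sub>R u + r *\<^sub>R g"
    have "dist q (q + ?v) = norm (- ?v)" unfolding dist_norm by (rule arg_cong[of _ _ norm]) simp
    then have "q + ?v \<in> ball q r0" using small[OF r] tM unfolding norm_minus_cancel by simp
    then have "q + ?v \<in> W" using r0 by blast
    then have "f (q + ?v) = 0" using zero hr by blast
    moreover have "f q = 0" using zero W by blast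
    ultimately have "norm (D ?v) \<le> e * norm ?v" using d2(2)[of "q + ?v"] small[OF r] tM by simp
    also have "\<dots> \<le> e * (t * M)" using small[OF r] e by (intro mult_left_mono) auto
    finally have Dv: "norm (D ?v) \<le> e * (t * M)" .
    have "D ?v = t *\<^sub>R D u + r *\<^sub>R D g"
      using bl by (simp add: linear_simps)
    then have "t * norm (D u) = norm (D ?v - r *\<^sub>R D g)" using t by simp
    also have "\<dots> \<le> norm (D ?v) + \<bar>r\<bar> * norm (D g)" using norm_triangle_ineq4[of "D ?v" "r *\<^sub>R D g"]
      by simp
    also have "\<dots> \<le> e * (t * M) + (e * t) * (norm g * B)"
      using Dv r B(2)[of g] e t by (intro add_mono mult_mono) auto
    finally have "t * norm (D u) \<le> t * (e * (M + norm g * B))" by (simp add: algebra_simps)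
    then show ?thesis using t by simp
  qed
  define K where "K = M + norm g * B"
  have K: "0 < K" using M B by (simp add: K_def add_pos_nonneg)
  have "norm (D u) \<le> 0 + e" if "0 < e" for e
  proof -
    have "norm (D u) \<le> min 1 (e / K) * K" unfolding K_def[symmetric]
      using bound[of "min 1 (e / K)"] that K by (simp add: K_def)
    also have "\<dots> \<le> (e / K) * K" using K by (intro mult_right_mono) auto
    finally show ?thesis using K by simp
  qed
  then have "norm (D u) \<le> 0" by (rule field_le_epsilon)
  then show ?thesis by simp
qed

text \<open>
  The orthogonal complements of two non-parallel vectors together span the space.
\<close>
lemma split_along_nonparallel:
  fixes a b e :: "'a::real_inner"
  assumes "\<bar>a \<bullet> b\<bar> < norm a * norm b"
  obtains u1 u2 where "e = u1 + u2" "u1 \<bullet> a = 0" "u2 \<bullet> b = 0"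
proof -
  have "a \<noteq> 0" using assms by auto
  define v where "v = b - ((a \<bullet> b) / (a \<bullet> a)) *\<^sub>R a"
  have va: "v \<bullet> a = 0" using \<open>a \<noteq> 0\<close>
    by (simp add: v_def inner_diff_left inner_commute[of b a])
  have "\<bar>a \<bullet> b\<bar>\<^sup>2 < (norm a * norm b)\<^sup>2" using assms
    by (intro power_strict_mono) auto
  then have "(a \<bullet> b)\<^sup>2 < (a \<bullet> a) * (b \<bullet> b)"
    by (simp add: power_mult_distrib power2_norm_eq_inner)
  then have vb: "0 < v \<bullet> b"
    using \<open>a \<noteq> 0\<close> by (simp add: v_def inner_diff_left power2_eq_square divide_less_eq mult.commute)
  define u1 where "u1 = ((e \<bullet> b) / (v \<bullet> b)) *\<^sub>R v"
  show thesis
  proof (rule that[of u1 "e - u1"])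
    show "(e - u1) \<bullet> b = 0" using vb by (simp add: u1_def inner_diff_left)
  qed (simp_all add: u1_def va)
qed

text \<open>
  The lift of the character \<open>chr x\<close> to Euclidean space, where derivatives can be taken.
\<close>
definition wave :: "int^'n \<Rightarrow> real^'n \<Rightarrow> complex" where
  "wave x r = exp (- (\<i> * of_real (r \<bullet> ivec x)))"

definition vanishes_on :: "((real^'n) \<times> (real^'n)) set \<Rightarrow> (int^'n) set \<Rightarrow> (int^'n \<Rightarrow> complex) \<Rightarrow> bool" where
  "vanishes_on P F w \<longleftrightarrow> (\<forall>(q, p)\<in>P. (\<Sum>x\<in>F. w x * wave x (q - p)) = 0)"

text \<open>
  The gradient of \<open>phi\<close> is a multiple of \<open>sinv\<close>, so the last condition says that the normals at \<open>q\<close> and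
  \<open>p\<close> are not parallel.
\<close>
definition transversal_pairs :: "real \<Rightarrow> ((real^'n) \<times> (real^'n)) set \<Rightarrow> ((real^'n) \<times> (real^'n)) set" where
  "transversal_pairs lam A = {(q, p) \<in> A. phi q = lam \<and> phi p
      = lam \<and> \<bar>sinv q \<bullet> sinv p\<bar> < norm (sinv q) * norm (sinv p)}"

lemma continuous_on_sinv: "continuous_on A (sinv :: real^'n::finite \<Rightarrow> real^'n)"
  unfolding sinv_def by (intro continuous_intros)

lemma has_derivative_wave:
  fixes x :: "int^'n::finite"
  shows "((\<lambda>y. wave x (y - p)) has_derivative (\<lambda>u. wave x (q - p) * (- (\<i> * of_real (u \<bullet> ivec x))))) (at q)"
  "((\<lambda>y. wave x (q - y)) has_derivative (\<lambda>u. wave x (q - p) * (\<i> * of_real (u \<bullet> ivec x)))) (at p)"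
proof -
  have *: "((\<lambda>y. wave x (f y)) has_derivative (\<lambda>u. wave x (f r) * (- (\<i> * of_real (f' u \<bullet> ivec x))))) (at r)"
    if "(f has_derivative f') (at r)" for f f' :: "real^'n \<Rightarrow> real^'n" and r
  proof -
    have "bounded_linear (\<lambda>v :: real^'n. - (\<i> * of_real (v \<bullet> ivec x)))"
      by (intro bounded_linear_minus bounded_linear_mult_const bounded_linear_const_mult bounded_linear_of_real[THEN bounded_linear_compose] bounded_linear_inner_left)
    from bounded_linear.has_derivative[OF this that]
    have "((\<lambda>y. - (\<i> * of_real (f y \<bullet> ivec x))) has_derivative (\<lambda>u. - (\<i> * of_real (f' u \<bullet> ivec x)))) (at r)" .
    from has_derivative_compose[OF this DERIV_exp[THEN has_field_derivative_imp_has_derivative]]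
    show ?thesis unfolding wave_def .
  qed
  have "((\<lambda>y. y - p) has_derivative (\<lambda>u. u)) (at q)" by (auto intro!: derivative_eq_intros)
  from *[OF this] show "((\<lambda>y. wave x (y - p)) has_derivative (\<lambda>u. wave x (q - p) * (- (\<i> * of_real (u \<bullet> ivec x))))) (at q)" .
  have "((\<lambda>y. q - y) has_derivative (\<lambda>u. - u)) (at p)"
    by (auto intro!: derivative_eq_intros)
  from *[OF this] show "((\<lambda>y. wave x (q - y)) has_derivative (\<lambda>u. wave x (q - p) * (\<i> * of_real (u \<bullet> ivec x)))) (at p)"
    by simp
qed

text \<open>
  Varying \<open>q\<close> and varying \<open>p\<close> in the level surface differentiates the trigonometric polynomial at \<open>q - p\<close> in the
  directions tangent at \<open>q\<close> and tangent at \<open>p\<close>.  By transversality these span, so the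
  derivative along the \<open>j\<close>-th axis is zero; it has the coefficients \<open>- i w x x\<^sub>j\<close>.
\<close>
lemma vanishes_on_coordinate:
  fixes w :: "int^'n::finite \<Rightarrow> complex"
  assumes A: "open A" and lam: "lam \<in> Lam CARD('n)" and van: "vanishes_on (transversal_pairs lam A) F w"
  shows "vanishes_on (transversal_pairs lam A) F (\<lambda>x. w x * of_int (x $ j))"
  unfolding vanishes_on_def
proof clarify
  fix q p :: "real^'n" assume qp: "(q, p) \<in> transversal_pairs lam A"
  then have ph: "phi q = lam" "phi p
      = lam" and np: "\<bar>sinv q \<bullet> sinv p\<bar> < norm (sinv q) * norm (sinv p)"
    by (auto simp: transversal_pairs_def)
  define A' where "A' = A \<inter> {z. \<bar>sinv (fst z) \<bullet> sinv (snd z)\<bar> < norm (sinv (fst z)) * norm (sinv (snd z))}"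
  have A': "open A'" unfolding A'_def
    by (intro open_Int A open_Collect_less continuous_intros continuous_on_compose2[OF continuous_on_sinv]) auto
  have inP: "(y, z) \<in> transversal_pairs lam A" if "(y, z) \<in> A'" "phi y = lam" "phi z = lam" for y z
    using that by (auto simp: A'_def transversal_pairs_def)
  have qpA: "(q, p) \<in> A'" using qp by (auto simp: A'_def transversal_pairs_def)
  define D where "D u = (\<Sum>x\<in>F. w x * (wave x (q - p) * (- (\<i> * of_real (u \<bullet> ivec x)))))" for u
  have D1: "D u = 0" if "u \<bullet> sinv q = 0" for u
  proof (rule derivative_vanishes_on_tangent[OF continuous_on_phi has_derivative_phi])
    show "((\<lambda>y. \<Sum>x\<in>F. w x * wave x (y - p)) has_derivative D) (at q)"
      unfolding D_def by (intro has_derivative_sum has_derivative_mult_right has_derivative_wave)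
    show "open ((\<lambda>y. (y, p)) -` A')" by (rule open_vimage[OF A']) (intro continuous_intros)
    show "(\<Sum>x\<in>F. w x * wave x (y - p)) = 0"
      if "y \<in> (\<lambda>y. (y, p)) -` A'" "phi y = phi q" for y
      using van inP[of y p] that ph by (auto simp: vanishes_on_def)
    show "-2 *\<^sub>R sinv q \<noteq> 0" using sinv_nonzero[of q] ph lam by simp
    show "u \<bullet> (-2 *\<^sub>R sinv q) = 0" using that by simp
  qed (use qpA in auto)
  have D2: "D u = 0" if "u \<bullet> sinv p = 0" for u
  proof -
    have "(\<Sum>x\<in>F. w x * (wave x (q - p) * (\<i> * of_real (u \<bullet> ivec x)))) = 0"
    proof (rule derivative_vanishes_on_tangent[OF continuous_on_phi has_derivative_phi])
      show "((\<lambda>y. \<Sum>x\<in>F. w x * wave x (q - y)) has_derivative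
          (\<lambda>u. \<Sum>x\<in>F. w x * (wave x (q - p) * (\<i> * of_real (u \<bullet> ivec x))))) (at p)"
        by (intro has_derivative_sum has_derivative_mult_right has_derivative_wave)
      show "open ((\<lambda>y. (q, y)) -` A')" by (rule open_vimage[OF A']) (intro continuous_intros)
      show "(\<Sum>x\<in>F. w x * wave x (q - y)) = 0"
        if "y \<in> (\<lambda>y. (q, y)) -` A'" "phi y = phi p" for y
        using van inP[of q y] that ph by (auto simp: vanishes_on_def)
      show "-2 *\<^sub>R sinv p \<noteq> 0" using sinv_nonzero[of p] ph lam by simp
      show "u \<bullet> (-2 *\<^sub>R sinv p) = 0" using that by simp
    qed (use qpA in auto)
    then show ?thesis by (simp add: D_def sum_negf)
  qed
  obtain u1 u2 where u: "axis j 1 = u1 + u2" "u1 \<bullet> sinv q = 0" "u2 \<bullet> sinv p = 0"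
    using split_along_nonparallel[OF np] .
  have "D (u1 + u2) = D u1 + D u2"
    unfolding D_def sum.distrib[symmetric] by (rule sum.cong) (simp_all add: inner_add_left algebra_simps)
  then have "D (axis j 1) = 0" using D1[OF u(2)] D2[OF u(3)] by (simp add: u(1))
  moreover have "D (axis j 1) = - \<i> * (\<Sum>x\<in>F. w x * of_int (x $ j) * wave x (q - p))"
    by (simp add: D_def inner_axis_axis inner_axis' ivec_def sum_distrib_left mult_ac sum_negf)
  ultimately show "(\<Sum>x\<in>F. w x * of_int (x $ j) * wave x (q - p)) = 0" by simp
qed

lemma vanishes_on_product:
  fixes w :: "int^'n::finite \<Rightarrow> complex"
  assumes A: "open A" and lam: "lam \<in> Lam CARD('n)" and van: "vanishes_on (transversal_pairs lam A) F w"
    and "finite Y"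
  shows "vanishes_on (transversal_pairs lam A) F (\<lambda>x. w x * (\<Prod>y\<in>Y. of_int (x $ j y - y $ j y)))"
  using \<open>finite Y\<close>
proof induction
  case empty
  then show ?case using van by simp
next
  case (insert y Y)
  let ?w = "\<lambda>x. w x * (\<Prod>y\<in>Y. of_int (x $ j y - y $ j y))"
  have 1: "vanishes_on (transversal_pairs lam A) F (\<lambda>x. ?w x * of_int (x $ j y))"
    by (rule vanishes_on_coordinate[OF A lam insert.IH])
  have eq: "(\<lambda>x. w x * (\<Prod>y\<in>insert y Y. of_int (x $ j y - y $ j y)))
      = (\<lambda>x. ?w x * of_int (x $ j y) - of_int (y $ j y) * ?w x)"
    using insert.hyps by (simp add: fun_eq_iff algebra_simps)
  show ?case unfolding eq vanishes_on_def
  proof clarify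
    fix q p :: "real^'n" assume that: "(q, p) \<in> transversal_pairs lam A"
    have "(\<Sum>x\<in>F. ?w x * of_int (x $ j y) * wave x (q - p))
        = 0" "(\<Sum>x\<in>F. ?w x * wave x (q - p)) = 0"
      using 1 insert.IH that unfolding vanishes_on_def by blast+
    moreover have "(\<Sum>x\<in>F. (?w x * of_int (x $ j y) - of_int (y $ j y) * ?w x) * wave x (q - p))
      = (\<Sum>x\<in>F. ?w x * of_int (x $ j y) * wave x (q - p)) - of_int (y $ j y) * (\<Sum>x\<in>F. ?w x * wave x (q - p))"
      by (simp only: left_diff_distrib sum_subtractf sum_distrib_left mult.assoc)
    ultimately show "(\<Sum>x\<in>F. (?w x * of_int (x $ j y) - of_int (y $ j y) * ?w x) * wave x (q - p)) = 0"
      by simp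
  qed
qed

text \<open>
  Lagrange interpolation: the factors \<open>x\<^sub>j - y\<^sub>j\<close>, with a coordinate \<open>j\<close> in which \<open>y\<close> differs from \<open>x0\<close>,
  annihilate all coefficients except the one at \<open>x0\<close>.
\<close>
lemma vanishes_on_imp_zero:
  fixes w :: "int^'n::finite \<Rightarrow> complex"
  assumes A: "open A" and lam: "lam \<in> Lam CARD('n)" and van: "vanishes_on (transversal_pairs lam A) F w"
    and F: "finite F" "x0 \<in> F" and ne: "transversal_pairs lam A \<noteq> {}"
  shows "w x0 = 0"
proof -
  obtain q p where qp: "(q, p) \<in> transversal_pairs lam A" using ne by auto
  have "\<exists>j. x0 $ j \<noteq> y $ j" if "y \<noteq> x0" for y using that by (metis vec_eq_iff)
  then obtain j where j: "\<And>y. y \<noteq> x0 \<Longrightarrow> x0 $ j y \<noteq> y $ j y" by metis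
  define w' where "w' x = w x * (\<Prod>y\<in>F - {x0}. of_int (x $ j y - y $ j y))" for x
  have "(\<Sum>x\<in>F. w' x * wave x (q - p)) = 0"
    using vanishes_on_product[OF A lam van, of "F - {x0}" j] F qp by (auto simp: vanishes_on_def w'_def)
  moreover have "w' x = 0" if "x \<in> F" "x \<noteq> x0" for x
    using that F by (auto simp: w'_def intro!: bexI[of _ x])
  then have "(\<Sum>x\<in>F. w' x * wave x (q - p)) = (\<Sum>x\<in>F. if x
      = x0 then w' x * wave x (q - p) else 0)"
    by (intro sum.cong) auto
  ultimately have "w' x0 = 0" using F by (simp add: sum.delta wave_def)
  then show ?thesis using j F by (auto simp: w'_def)
qed

text \<open>
  If \<open>\<omega>\<close> itself is parallel to \<open>v\<close>, rotate it a little towards an orthogonal direction.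
\<close>
lemma nonparallel_unit_vector:
  fixes \<omega> v :: "'a::euclidean_space"
  assumes "2 \<le> DIM('a)" "norm \<omega> = 1" "norm v = 1" "open V" "\<omega> \<in> V"
  obtains \<omega>' where "\<omega>' \<in> V" "norm \<omega>' = 1" "\<bar>\<omega>' \<bullet> v\<bar> < 1"
proof (cases "\<bar>\<omega> \<bullet> v\<bar> = 1")
  case False
  then show thesis using that[of \<omega>] assms Cauchy_Schwarz_ineq2[of \<omega> v] by simp
next
  case True
  then have v: "v = \<omega> \<or> v = - \<omega>" using norm_cauchy_schwarz_abs_eq[of \<omega> v] assms
    by auto
  obtain z0 where z0: "z0 \<noteq> 0" "orthogonal \<omega> z0" using orthogonal_to_vector_exists[OF assms(1)]
    by metis
  define z where "z = z0 /\<^sub>R norm z0"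
  have z: "norm z = 1" "\<omega> \<bullet> z = 0" using z0 by (auto simp: z_def orthogonal_def)
  define \<gamma> where "\<gamma> t = cos t *\<^sub>R \<omega> + sin t *\<^sub>R z" for t
  have "open (\<gamma> -` V)" unfolding \<gamma>_def by (intro open_vimage assms continuous_intros)
  moreover have "0 \<in> \<gamma> -` V" using assms by (simp add: \<gamma>_def)
  ultimately obtain r where r: "0 < r" "ball 0 r \<subseteq> \<gamma> -` V" by (metis open_contains_ball)
  define t where "t = min (r/2) 1"
  have t: "0 < t" "t < r" "t \<le> 1" using r by (auto simp: t_def)
  show thesis
  proof (rule that[of "\<gamma> t"])
    show "\<gamma> t \<in> V" using r t by (auto simp: subset_eq)
    have "\<gamma> t \<bullet> \<gamma> t = (cos t)\<^sup>2 + (sin t)\<^sup>2"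
      using assms(2) z by (simp add: \<gamma>_def inner_add_left inner_add_right inner_commute[of z \<omega>] norm_eq_1 power2_eq_square)
    then show "norm (\<gamma> t) = 1" by (simp add: norm_eq_1)
    have "0 < cos t" using t pi_gt3 by (intro cos_gt_zero) auto
    moreover have "cos t < 1" using cos_monotone_0_pi[of 0 t] t pi_gt3 by simp
    moreover have "\<gamma> t \<bullet> \<omega> = cos t" using assms(2) z
      by (simp add: \<gamma>_def inner_add_left inner_commute[of z \<omega>] norm_eq_1)
    ultimately show "\<bar>\<gamma> t \<bullet> v\<bar> < 1" using v by auto
  qed
qed

text \<open>
  The Gauss map is continuous on lifts, and \<open>\<kappa>\<close> inverts it; so the condition on \<open>(k, \<omega>)\<close> turns into
  an open condition on pairs of points of the surface.
\<close>
lemma amplitude_determines_potential: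
  fixes w :: "int^'n::finite \<Rightarrow> complex" and Q :: "('n torus \<times> (real^'n)) set"
  assumes d: "CARD('n) \<ge> 2" and lam: "lam \<in> Lam CARD('n)" and Q: "open Q" "(k, \<omega>) \<in> Q"
    and k: "k \<in> Gam lam" and \<omega>: "norm \<omega> = 1" and F: "finite F"
    and van: "\<And>k \<omega>. (k, \<omega>) \<in> Q \<Longrightarrow>
        k \<in> Gam lam \<Longrightarrow> norm \<omega> = 1 \<Longrightarrow>
      (\<Sum>x\<in>F. w x * chr x (kappa (- \<omega>) lam - k)) = 0"
    and x0: "x0 \<in> F"
  shows "w x0 = 0"
proof -
  define S0 where "S0 = {z :: (real^'n) \<times> (real^'n). sinv (fst z) \<noteq> 0}"
  \<comment> \<open>The direction \<open>\<omega>\<close> with \<open>\<kappa>(- \<omega>)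
      = q\<close> is minus the normal at \<open>q\<close>.\<close>
  define f where "f = (\<lambda>z :: (real^'n) \<times> (real^'n). (abs_torus (snd z), sinv (fst z) /\<^sub>R norm (sinv (fst z))))"
  define A where "A = f -` Q \<inter> S0"
  have "open S0" unfolding S0_def
    by (intro open_Collect_neq continuous_intros continuous_on_compose2[OF continuous_on_sinv]) auto
  moreover have "continuous_on S0 f" unfolding f_def
    by (intro continuous_on_Pair continuous_intros continuous_on_compose2[OF continuous_on_sinv]
        continuous_on_compose2[OF continuous_on_abs_torus]) (auto simp: S0_def)
  ultimately have A: "open A" unfolding A_def using Q(1) by (simp add: continuous_on_open_vimage)
  have vanA: "vanishes_on (transversal_pairs lam A) F w"
    unfolding vanishes_on_def
  proof clarify
    fix q p :: "real^'n" assume qp: "(q, p) \<in> transversal_pairs lam A"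
    define \<omega> where "\<omega> = sinv q /\<^sub>R norm (sinv q)"
    have ph: "phi q = lam" "phi p = lam" and s: "sinv q \<noteq> 0" and inQ: "(abs_torus p, \<omega>) \<in> Q"
      using qp by (auto simp: transversal_pairs_def A_def S0_def f_def \<omega>_def)
    have n\<omega>: "norm \<omega> = 1" using s by (simp add: \<omega>_def)
    have "normal_at (abs_torus q) = - \<omega>" by (simp add: normal_at_abs_torus \<omega>_def)
    then have "kappa (- \<omega>) lam = abs_torus q"
      using ph n\<omega> by (intro kappa_eqI[OF lam]) (auto simp: Gam_def torus_phi.abs_eq)
    moreover have "abs_torus q - abs_torus p = abs_torus (q - p)"
      by (simp add: minus_torus_def uminus_torus.abs_eq plus_torus.abs_eq)
    ultimately show "(\<Sum>x\<in>F. w x * wave x (q - p)) = 0"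
      using van[OF inQ] ph n\<omega> by (simp add: Gam_def torus_phi.abs_eq chr_abs_torus wave_def)
  qed
  obtain p where p: "k = abs_torus p" by (rule abs_torus_surj)
  have php: "phi p = lam" using k by (simp add: p Gam_def torus_phi.abs_eq)
  have sp: "sinv p \<noteq> 0" using sinv_nonzero php lam by metis
  define v where "v = sinv p /\<^sub>R norm (sinv p)"
  have v: "norm v = 1" using sp by (simp add: v_def)
  have "open ((\<lambda>\<omega>. (k, \<omega>)) -` Q)"
    by (rule open_vimage[OF Q(1)]) (intro continuous_intros)
  then obtain \<omega>' where \<omega>': "(k, \<omega>') \<in> Q" "norm \<omega>'
      = 1" "\<bar>\<omega>' \<bullet> v\<bar> < 1"
    using nonparallel_unit_vector[of \<omega> v "(\<lambda>\<omega>. (k, \<omega>)) -` Q"] d \<omega> v Q(2) by auto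
  obtain q where q: "kappa (- \<omega>') lam = abs_torus q" by (rule abs_torus_surj)
  have n': "norm (- \<omega>') = 1" using \<omega>' by simp
  have phq: "phi q = lam" using kappa_spec(1)[OF lam n'] by (simp add: q Gam_def torus_phi.abs_eq)
  have sq0: "sinv q \<noteq> 0" using sinv_nonzero phq lam by metis
  have sq: "sinv q = norm (sinv q) *\<^sub>R \<omega>'"
    using kappa_spec(2)[OF lam n'] normal_at_eq_iff[of q "- \<omega>'"] phq lam by (simp add: q)
  have spv: "sinv p = norm (sinv p) *\<^sub>R v" using sp by (simp add: v_def)
  have "sinv q \<bullet> sinv p = (norm (sinv q) *\<^sub>R \<omega>') \<bullet> (norm (sinv p) *\<^sub>R v)" using sq spv
    by simp
  then have "\<bar>sinv q \<bullet> sinv p\<bar> = norm (sinv q) * norm (sinv p) * \<bar>\<omega>' \<bullet> v\<bar>"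
    by (simp add: abs_mult)
  also have "\<dots> < norm (sinv q) * norm (sinv p) * 1"
    using \<omega>'(3) sp sq0 by (intro mult_strict_left_mono) auto
  finally have "\<bar>sinv q \<bullet> sinv p\<bar> < norm (sinv q) * norm (sinv p)" by simp
  moreover have "\<omega>' = sinv q /\<^sub>R norm (sinv q)" using sq sq0
    by (metis scaleR_scaleR left_inverse norm_eq_zero scaleR_one)
  ultimately have "(q, p) \<in> transversal_pairs lam A"
    using phq php sq0 \<omega>'(1) by (simp add: transversal_pairs_def A_def S0_def f_def p[symmetric])
  then show ?thesis using vanishes_on_imp_zero[OF A lam vanA F x0] by blast
qed


section \<open>The stability estimate\<close>

lemma finite_ivec_vimage:
  assumes "bounded (D :: (real^'n::finite) set)"
  shows "finite {x :: int^'n. ivec x \<in> D}"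
proof -
  obtain B where B: "\<And>y. y \<in> D \<Longrightarrow> norm y \<le> B" using assms
    by (auto simp: bounded_iff)
  define J where "J = {- \<lfloor>B\<rfloor> .. \<lfloor>B\<rfloor>}"
  have "{x :: int^'n. ivec x \<in> D} \<subseteq> vec_lambda ` (PiE UNIV (\<lambda>_. J))"
  proof
    fix x :: "int^'n" assume "x \<in> {x. ivec x \<in> D}"
    then have "norm (ivec x) \<le> B" using B by simp
    moreover have "\<bar>ivec x $ i\<bar> \<le> norm (ivec x)" for i by (rule component_le_norm_cart)
    ultimately have "\<bar>ivec x $ i\<bar> \<le> B" for i by (rule order_trans[rotated])
    then have "of_int \<bar>x $ i\<bar> \<le> B" for i by (simp add: ivec_def)
    then have "\<bar>x $ i\<bar> \<le> \<lfloor>B\<rfloor>" for i by (simp only: le_floor_iff)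
    then have "x $ i \<in> J" for i by (simp add: J_def abs_le_iff minus_le_iff)
    then show "x \<in> vec_lambda ` (PiE UNIV (\<lambda>_. J))"
      by (intro image_eqI[of _ _ "\<lambda>i. x $ i"]) auto
  qed
  moreover have "finite (vec_lambda ` (PiE UNIV (\<lambda>_. J)) :: (int^'n) set)"
    unfolding J_def by (intro finite_imageI finite_PiE) auto
  ultimately show ?thesis by (rule finite_subset)
qed

text \<open>
  The coefficient families of \<open>\<ell>\<^sub>1\<close> norm 1 form a compact set, which is covered
    by the open sets on which
  some point of \<open>N\<close> detects the family with a given precision.  Homogeneity takes care of the other families.
\<close>
lemma finite_sampling_set:
  fixes ch :: "'x \<Rightarrow> 'z \<Rightarrow> complex"
  assumes F: "finite F"
    and inj: "\<And>w x. (\<And>z. z \<in> N \<Longrightarrow>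
        (\<Sum>x\<in>F. w x * ch x z) = 0) \<Longrightarrow> x \<in> F \<Longrightarrow> w x = 0"
    and "N \<noteq> {}"
  obtains c P where "0 < c" "finite P" "P \<subseteq> N" "P \<noteq> {}"
    "\<And>w. \<exists>z\<in>P. c * (\<Sum>x\<in>F. cmod (w x)) \<le> cmod (\<Sum>x\<in>F. w x * ch x z)"
proof -
  define K0 :: "('x \<Rightarrow> complex) set" where "K0
      = PiE UNIV (\<lambda>x. if x \<in> F then cball 0 1 else {0})"
  define K where "K = K0 \<inter> {w. (\<Sum>x\<in>F. cmod (w x)) = 1}"
  have "compactin (product_topology (\<lambda>_. euclidean) UNIV) K0"
    unfolding K0_def compactin_PiE by (auto simp: compactin_euclidean_iff)
  then have "compact K0" by (simp add: euclidean_product_topology compactin_euclidean_iff)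
  moreover have "closed {w :: 'x \<Rightarrow> complex. (\<Sum>x\<in>F. cmod (w x)) = 1}"
    by (intro closed_Collect_eq continuous_intros continuous_on_product_coordinates)
  ultimately have K: "compact K" unfolding K_def by (rule compact_Int_closed)
  define U where "U = (\<lambda>(z, n). {w :: 'x \<Rightarrow> complex. 1 / real (Suc n) < cmod (\<Sum>x\<in>F. w x * ch x z)})"
  have "open (U i)" for i unfolding U_def
    by (cases i) (auto intro!: open_Collect_less continuous_intros continuous_on_product_coordinates)
  moreover have "K \<subseteq> (\<Union>i\<in>N \<times> UNIV. U i)"
  proof
    fix w assume w: "w \<in> K"
    have "\<exists>z\<in>N. (\<Sum>x\<in>F. w x * ch x z) \<noteq> 0"
    proof (rule ccontr)
      assume "\<not> (\<exists>z\<in>N. (\<Sum>x\<in>F. w x * ch x z) \<noteq> 0)"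
      then have "w x = 0" if "x \<in> F" for x using inj[of w x] that by blast
      then have "(\<Sum>x\<in>F. cmod (w x)) = 0" by simp
      then show False using w by (simp add: K_def)
    qed
    then obtain z where z: "z \<in> N" "0 < cmod (\<Sum>x\<in>F. w x * ch x z)" by auto
    then obtain n where "1 / real (Suc n) < cmod (\<Sum>x\<in>F. w x * ch x z)"
      using reals_Archimedean[OF z(2)] by (auto simp: inverse_eq_divide)
    then have "w \<in> U (z, n)" by (simp add: U_def)
    then show "w \<in> (\<Union>i\<in>N \<times> UNIV. U i)" using z(1) by blast
  qed
  ultimately obtain I where I: "I \<subseteq> N \<times> UNIV" "finite I" "K \<subseteq> (\<Union>i\<in>I. U i)"
    using compactE_image[OF K, of "N \<times> UNIV" U] by metis
  obtain z0 where z0: "z0 \<in> N" using assms(3) by auto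
  define m where "m = Max (insert 0 (snd ` I))"
  have m: "n \<le> m" if "(z, n) \<in> I" for z n
    unfolding m_def using I(2) that by (intro Max_ge) (auto intro: rev_image_eqI)
  show thesis
  proof (rule that[of "1 / real (Suc m)" "insert z0 (fst ` I)"])
    fix w :: "'x \<Rightarrow> complex"
    define s where "s = (\<Sum>x\<in>F. cmod (w x))"
    have s0: "0 \<le> s" by (simp add: s_def sum_nonneg)
    show "\<exists>z\<in>insert z0 (fst ` I). 1 / real (Suc m) * (\<Sum>x\<in>F. cmod (w x))
        \<le> cmod (\<Sum>x\<in>F. w x * ch x z)"
    proof (cases "s = 0")
      case True
      then show ?thesis by (intro bexI[of _ z0]) (simp_all add: s_def)
    next
      case False
      then have s: "0 < s" using s0 by simp
      define v where "v x = (if x \<in> F then w x / of_real s else 0)" for x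
      have sv: "(\<Sum>x\<in>F. v x * ch x z) = (\<Sum>x\<in>F. w x * ch x z) / of_real s" for z
        unfolding sum_divide_distrib by (rule sum.cong) (auto simp: v_def)
      have "(\<Sum>x\<in>F. cmod (v x)) = (\<Sum>x\<in>F. cmod (w x)) / s"
        unfolding sum_divide_distrib using s by (intro sum.cong) (auto simp: v_def norm_divide)
      then have v1: "(\<Sum>x\<in>F. cmod (v x)) = 1" using s by (simp add: s_def)
      have "cmod (v x) \<le> 1" if "x \<in> F" for x
        using member_le_sum[of x F "\<lambda>x. cmod (v x)"] that F v1 by simp
      then have "v \<in> K" using v1 by (auto simp: K_def K0_def v_def)
      then obtain z n where zn: "(z, n) \<in> I" "1 / real (Suc n) < cmod (\<Sum>x\<in>F. v x * ch x z)"
        using I(3) by (auto simp: U_def)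
      have "1 / real (Suc m) \<le> 1 / real (Suc n)" using m[OF zn(1)] by (simp add: frac_le)
      also have "\<dots> \<le> cmod (\<Sum>x\<in>F. w x * ch x z) / s" using zn(2) s
        by (simp add: sv norm_divide)
      finally have "1 / real (Suc m) * s \<le> cmod (\<Sum>x\<in>F. w x * ch x z)" using s
        by (simp only: pos_le_divide_eq)
      moreover have "z \<in> insert z0 (fst ` I)" using zn(1) by (auto intro: rev_image_eqI)
      ultimately show ?thesis unfolding s_def by (rule bexI)
    qed
  qed (use I z0 in auto)
qed

text \<open>
  The integral is a supremum over simple functions, and \<open>a\<^sup>2\<close> times the indicator of \<open>B\<close> is one of those
  below the integrand.
\<close>
lemma L2_norm_on_lower_bound:
  assumes B: "B \<in> sets M" "B \<subseteq> N" and a: "0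
      \<le> a" "\<And>z. z \<in> B \<Longrightarrow> a \<le> cmod (f z)"
    and m: "0 \<le> m" "ennreal m \<le> emeasure M B"
  shows "ennreal (a * sqrt m) \<le> L2_norm_on M N f"
proof -
  define I where "I = (\<integral>\<^sup>+ z \<in> N. ennreal ((cmod (f z))\<^sup>2) \<partial>M)"
  have "ennreal (a\<^sup>2) * ennreal m \<le> ennreal (a\<^sup>2) * emeasure M B" using m
    by (intro mult_left_mono) auto
  also have "\<dots> = (\<integral>\<^sup>+ z. ennreal (a\<^sup>2) * indicator B z \<partial>M)"
    using B(1) by (simp add: nn_integral_cmult_indicator)
  also have "\<dots> \<le> I" unfolding I_def
    using B(2) a by (intro nn_integral_mono) (auto split: split_indicator intro!: ennreal_leI power_mono)
  finally have I: "ennreal (a\<^sup>2 * m) \<le> I" using m a by (simp add: ennreal_mult)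
  show ?thesis
  proof (cases "I = \<infinity>")
    case True
    then show ?thesis by (simp add: L2_norm_on_def I_def[symmetric])
  next
    case False
    then have "a\<^sup>2 * m \<le> enn2real I" using enn2real_mono[OF I] m a by (simp add: less_top)
    then have "sqrt (a\<^sup>2 * m) \<le> sqrt (enn2real I)" by simp
    then have "a * sqrt m \<le> sqrt (enn2real I)" using a by (simp add: real_sqrt_mult)
    then show ?thesis using False by (simp add: L2_norm_on_def I_def[symmetric] ennreal_leI)
  qed
qed

lemma born_amplitude_lower_bound:
  assumes lam: "lam \<in> Lam CARD('n::finite)"
  shows "\<exists>b>0. \<forall>(w :: int^'n \<Rightarrow> complex) F k \<omega>. finite F \<longrightarrow> (\<forall>x. w x \<noteq> 0 \<longrightarrow> x \<in> F) \<longrightarrow> norm \<omega> = 1 \<longrightarrow>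
    b * cmod (\<Sum>x\<in>F. w x * chr x (kappa (- \<omega>) lam - k))
        \<le> cmod (born_amplitude lam w (k, \<omega>))"
proof -
  obtain B where B: "0 < B" "\<And>x :: real^'n. phi x = lam \<Longrightarrow>
    0 < sqrt \<bar>total_curvature phi x\<bar> * norm (grad phi x) \<and>
    sqrt \<bar>total_curvature phi x\<bar> * norm (grad phi x) \<le> B"
    by (rule amplitude_denominator_bounded[OF lam]) blast
  define a where "a = sqrt (2 * pi) * (2 * pi) powr (- (real CARD('n) / 2))"
  have a: "0 < a" by (simp add: a_def)
  show ?thesis
  proof (intro exI[of _ "a / B"] conjI allI impI)
    show "0 < a / B" using a B by simp
    fix w :: "int^'n \<Rightarrow> complex" and F k and \<omega> :: "real^'n"
    assume F: "finite F" and supp: "\<forall>x. w x \<noteq> 0 \<longrightarrow> x \<in> F" and \<omega>: "norm \<omega> = 1"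
    obtain q where q: "kappa \<omega> lam = abs_torus q" by (rule abs_torus_surj)
    have ph: "phi q = lam" using kappa_spec(1)[OF lam \<omega>] by (simp add: q Gam_def torus_phi.abs_eq)
    define den where "den = sqrt \<bar>total_curvature phi q\<bar> * norm (grad phi q)"
    have den: "0 < den" "den \<le> B" using B(2)[OF ph] by (auto simp: den_def)
    define \<Sigma> where "\<Sigma> = (\<Sum>x\<in>F. w x * chr x (kappa (- \<omega>) lam - k))"
    have v: "vhat w (kappa (- \<omega>) lam - k)
        = of_real ((2 * pi) powr (- (real CARD('n) / 2))) * \<Sigma>"
      unfolding \<Sigma>_def using supp by (intro vhat_eq_sum[OF F]) blast
    have e: "cmod (exp (- (\<i> * of_real t))) = 1" for t by (simp add: norm_exp_eq_Re)
    have "born_amplitude lam w (k, \<omega>)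
        = - (of_real (sqrt (2 * pi)) * (of_real ((2 * pi) powr (- (real CARD('n) / 2))) * \<Sigma>)
        * exp (- (\<i> * of_real ((real CARD('n) - 1 + 2) * pi / 4)))) / of_real den"
      by (simp add: born_amplitude_def Let_def v curv_def q torus_total_curvature.abs_eq torus_grad_phi.abs_eq den_def)
    then have "cmod (born_amplitude lam w (k, \<omega>)) = a * cmod \<Sigma> / den"
      using den by (simp only: norm_divide norm_minus_cancel norm_mult norm_of_real e a_def) (simp add: mult_ac)
    moreover have "a / B * cmod \<Sigma> \<le> a * cmod \<Sigma> / den"
      using den a by (simp add: frac_le mult_nonneg_nonneg)
    ultimately show "a / B * cmod (\<Sum>x\<in>F. w x * chr x (kappa (- \<omega>) lam - k))
        \<le> cmod (born_amplitude lam w (k, \<omega>))"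
      by (simp add: \<Sigma>_def)
  qed
qed

lemma born_amplitude_diff:
  assumes "finite F" "\<And>x. v1 x \<noteq> 0 \<Longrightarrow>
      x \<in> F" "\<And>x. v2 x \<noteq> 0 \<Longrightarrow> x \<in> F"
  shows "born_amplitude lam v2 z - born_amplitude lam v1 z = born_amplitude lam (\<lambda>x. v2 x - v1 x) z"
proof -
  have supp: "x \<in> F" if "v2 x - v1 x \<noteq> 0" for x
    using that assms(2,3)[of x] by (cases "v1 x = 0") auto
  have diff: "vhat (\<lambda>x. v2 x - v1 x) p = vhat v2 p - vhat v1 p" for p
    using vhat_eq_sum[of F "\<lambda>x. v2 x - v1 x" p] vhat_eq_sum[of F v1 p] vhat_eq_sum[of F v2 p] assms supp
    by (simp add: left_diff_distrib sum_subtractf right_diff_distrib)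
  have alg: "- (a * y * e) / d - - (a * x * e) / d = - (a * (y - x) * e) / d" for a x y e d :: complex
    by (simp add: divide_inverse algebra_simps)
  show ?thesis
    by (cases z) (simp only: born_amplitude_def Let_def prod.case alg diff)
qed

text \<open>
  Finitely many continuous functions vary
    by at most \<open>e\<close> in a neighbourhood, which contains a product of open
  sets; intersecting the factors with the surface and the sphere gives a box of positive measure.
\<close>
lemma uniform_box:
  fixes O' :: "('n::finite torus \<times> (real^'n)) set"
  assumes lam: "lam \<in> Lam CARD('n)" and O': "open O'" "(k, \<omega>) \<in> O'" and k: "k \<in> Gam lam" and \<omega>: "norm \<omega> = 1"
    and F: "finite F" and e: "0 < e"
  obtains B where "B \<in> sets (Gam_measure lam \<Otimes>\<^sub>M sphere_measure)" "B \<subseteq> (Gam lam \<times> sphere 0 1) \<inter> O'"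
    "0 < emeasure (Gam_measure lam \<Otimes>\<^sub>M sphere_measure) B"
    "\<And>x k' \<omega>'. x \<in> F \<Longrightarrow> (k', \<omega>') \<in> B \<Longrightarrow>
      cmod (chr x (kappa (- \<omega>') lam - k') - chr x (kappa (- \<omega>) lam - k)) \<le> e"
proof -
  let ?S = "sphere 0 1 :: (real^'n) set"
  interpret SM: finite_measure "sphere_measure :: (real^'n) measure" by (rule finite_sphere_measure)
  define ch where "ch x z = chr x (kappa (- snd z) lam - fst z)" for x :: "int^'n" and z :: "'n torus \<times> (real^'n)"
  define h where "h z = (\<Sum>x\<in>F. cmod (ch x z - ch x (k, \<omega>)))" for z
  have cont_ch: "continuous_on (UNIV \<times> ?S) (ch x)" for x
    unfolding ch_def chr_minus
    by (intro continuous_intros continuous_on_compose2[OF continuous_on_chr_kappa[OF lam]]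
        continuous_on_compose2[OF continuous_on_chr[of UNIV]]) auto
  have "continuous_on (UNIV \<times> ?S) h" unfolding h_def by (intro continuous_intros cont_ch)
  then have "openin (top_of_set (UNIV \<times> ?S)) ((UNIV \<times> ?S) \<inter> h -` {..<e})"
    by (rule continuous_openin_preimage_gen) simp
  then obtain T where T: "open T" "(UNIV \<times> ?S) \<inter> h -` {..<e} = (UNIV \<times> ?S) \<inter> T"
    by (auto simp: openin_open)
  have "(k, \<omega>) \<in> (UNIV \<times> ?S) \<inter> h -` {..<e}" using \<omega> e by (simp add: h_def)
  then have "(k, \<omega>) \<in> O' \<inter> T" using T O' by auto
  then obtain U V where UV: "open U" "open V" "(k, \<omega>) \<in> U \<times> V" "U \<times> V \<subseteq> O' \<inter> T"
    using open_prod_elim[of "O' \<inter> T"] O' T by (metis open_Int)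
  define B where "B = (U \<inter> Gam lam) \<times> (V \<inter> ?S)"
  have BU: "U \<inter> Gam lam \<in> sets (Gam_measure lam)" using UV(1) closed_Gam[of lam]
    by (simp, intro sets.Int borel_open borel_closed)
  have BV: "V \<inter> ?S \<in> sets sphere_measure"
    unfolding sphere_measure_def sets_restrict_space using UV(2) by auto
  show thesis
  proof (rule that[of B])
    show "B \<in> sets (Gam_measure lam \<Otimes>\<^sub>M sphere_measure)" unfolding B_def
      by (rule pair_measureI[OF BU BV])
    show "B \<subseteq> (Gam lam \<times> sphere 0 1) \<inter> O'" using UV(4) by (auto simp: B_def)
    have "emeasure (Gam_measure lam \<Otimes>\<^sub>M sphere_measure) B
        = emeasure (Gam_measure lam) (U \<inter> Gam lam) * emeasure sphere_measure (V \<inter> ?S)"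
      unfolding B_def by (rule SM.emeasure_pair_measure_Times[OF BU BV])
    moreover have "0 < emeasure (Gam_measure lam) (U \<inter> Gam lam)"
      using UV k by (intro Gam_measure_pos[of U k lam] lam) auto
    moreover have "0 < emeasure sphere_measure (V \<inter> ?S)" using UV \<omega>
      by (intro sphere_measure_pos) auto
    ultimately show "0 < emeasure (Gam_measure lam \<Otimes>\<^sub>M sphere_measure) B"
      by (simp add: ennreal_zero_less_mult_iff)
    fix x k' \<omega>' assume x: "x \<in> F" and "(k', \<omega>') \<in> B"
    then have "(k', \<omega>') \<in> (UNIV \<times> ?S) \<inter> T" using UV(4) by (auto simp: B_def)
    then have "h (k', \<omega>') < e" unfolding T(2)[symmetric] by simp
    moreover have "cmod (ch x (k', \<omega>') - ch x (k, \<omega>)) \<le> h (k', \<omega>')"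
      unfolding h_def using x F by (intro member_le_sum) auto
    ultimately show "cmod (chr x (kappa (- \<omega>') lam - k') - chr x (kappa (- \<omega>) lam - k)) \<le> e"
      by (simp add: ch_def)
  qed
qed

theorem theoremA11:
  fixes lam :: real
    and D :: "(real^'n::finite) set"
    and N :: "('n torus \<times> (real^'n)) set"
    and k :: "'n torus" and \<omega> :: "real^'n"
  assumes "CARD('n) \<ge> 2"
    and "lam \<in> Lam CARD('n)"
    and "open D" and "bounded D" and "{x. ivec x \<in> D} \<noteq> {}"
    and "k \<in> Gam lam" and "\<omega> \<in> sphere 0 1"
    and "openin (top_of_set (Gam lam \<times> sphere 0 1)) N" and "(k, \<omega>) \<in> N"
    and "closure N \<subseteq> (\<Union>\<zeta>\<in>Lam CARD('n). Gam \<zeta> \<times> sphere 0 1)"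
  shows "\<exists>C::real. C > 0 \<and>
    (\<forall>v1 v2 :: int^'n \<Rightarrow> complex.
       (\<forall>x. v1 x \<noteq> 0 \<longrightarrow> ivec x \<in> D) \<longrightarrow> (\<forall>x. v2 x \<noteq> 0 \<longrightarrow> ivec x \<in> D) \<longrightarrow>
       ennreal (L2_set (\<lambda>x. cmod (v2 x - v1 x)) {x. ivec x \<in> D})
         \<le> ennreal C * L2_norm_on (Gam_measure lam \<Otimes>\<^sub>M sphere_measure) N
             (\<lambda>z. born_amplitude lam v2 z - born_amplitude lam v1 z))"
proof -
  let ?M = "Gam_measure lam \<Otimes>\<^sub>M (sphere_measure :: (real^'n) measure)"
  define F where "F = {x :: int^'n. ivec x \<in> D}"
  have F: "finite F" unfolding F_def by (rule finite_ivec_vimage) fact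
  note lam = \<open>lam \<in> Lam CARD('n)\<close>
  obtain O' where O': "open O'" "N = (Gam lam \<times> sphere 0 1) \<inter> O'"
    using assms(8) by (auto simp: openin_open)
  define ch where "ch x z = chr x (kappa (- snd z) lam - fst z)" for x :: "int^'n" and z :: "'n torus \<times> (real^'n)"
  have inj: "w x = 0" if "\<And>z. z \<in> N \<Longrightarrow>
      (\<Sum>x\<in>F. w x * ch x z) = 0" "x \<in> F" for w x
  proof (rule amplitude_determines_potential[OF assms(1) lam O'(1) _ assms(6) _ F _ that(2)])
    show "(\<Sum>x\<in>F. w x * chr x (kappa (- \<omega>) lam - k)) = 0"
      if "(k, \<omega>) \<in> O'" "k \<in> Gam lam" "norm \<omega> = 1" for k \<omega>
      using \<open>\<And>z. z \<in> N \<Longrightarrow>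
          (\<Sum>x\<in>F. w x * ch x z) = 0\<close>[of "(k, \<omega>)"] that by (simp add: O'(2) ch_def)
  qed (use assms(7,9) O'(2) in auto)
  have "N \<noteq> {}" using assms(9) by auto
  obtain c P where cP: "0 < c" "finite P" "P \<subseteq> N" "P \<noteq> {}"
    "\<And>w. \<exists>z\<in>P. c * (\<Sum>x\<in>F. cmod (w x)) \<le> cmod (\<Sum>x\<in>F. w x * ch x z)"
  proof (rule finite_sampling_set[where F = F and N = N and ch = ch, OF F])
    show "w x = 0" if "\<And>z. z \<in> N \<Longrightarrow> (\<Sum>x\<in>F. w x * ch x z) = 0" "x \<in> F" for w x
      by (rule inj[OF that])
    show "N \<noteq> {}" by fact
  qed (rule that)
  have "\<exists>B. B \<in> sets ?M \<and> B \<subseteq> N \<and> 0 < emeasure ?M B \<and>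
      (\<forall>x\<in>F. \<forall>z'\<in>B. cmod (ch x z' - ch x z) \<le> c / 2)" if "z \<in> P" for z
  proof -
    obtain k \<omega> where z: "z = (k, \<omega>)" by (cases z)
    have zN: "(k, \<omega>) \<in> O'" "k \<in> Gam lam" "norm \<omega> = 1" using that cP(3) O'(2)
      by (auto simp: z)
    obtain B where B: "B \<in> sets ?M" "B \<subseteq> (Gam lam \<times> sphere 0 1) \<inter> O'" "0 < emeasure ?M B"
      "\<And>x k' \<omega>'. x \<in> F \<Longrightarrow> (k', \<omega>') \<in> B \<Longrightarrow>
        cmod (chr x (kappa (- \<omega>') lam - k') - chr x (kappa (- \<omega>) lam - k)) \<le> c / 2"
      by (rule uniform_box[OF lam O'(1) zN F half_gt_zero[OF cP(1)]]) (rule that)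
    then show ?thesis unfolding O'(2) z ch_def by (intro exI[of _ B]) auto
  qed
  then obtain B where B: "\<And>z. z \<in> P \<Longrightarrow>
      B z \<in> sets ?M" "\<And>z. z \<in> P \<Longrightarrow> B z \<subseteq> N"
    "\<And>z. z \<in> P \<Longrightarrow> 0 < emeasure ?M (B z)"
    "\<And>z x z'. z \<in> P \<Longrightarrow> x \<in> F \<Longrightarrow>
        z' \<in> B z \<Longrightarrow> cmod (ch x z' - ch x z) \<le> c / 2"
    by metis
  \<comment> \<open>The measure of a box may be infinite; the minimum with 1 keeps the constant finite.\<close>
  define \<mu> where "\<mu> = Min ((\<lambda>z. min 1 (emeasure ?M (B z))) ` P)"
  have "\<mu> \<in> (\<lambda>z. min 1 (emeasure ?M (B z))) ` P" unfolding \<mu>_def using cP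
    by (intro Min_in) auto
  then have \<mu>: "0 < \<mu>" "\<mu> \<le> 1" using B(3) by auto
  have \<mu>le: "\<mu> \<le> emeasure ?M (B z)" if "z \<in> P" for z
  proof -
    have "\<mu> \<le> min 1 (emeasure ?M (B z))" unfolding \<mu>_def using cP that by (intro Min_le) auto
    then show ?thesis by simp
  qed
  define m where "m = enn2real \<mu>"
  have "\<mu> < top" using \<mu>(2) by (rule le_less_trans) simp
  then have m: "0 < m" "\<mu> = ennreal m" using \<mu>(1) by (auto simp: m_def enn2real_positive_iff)
  obtain b where b: "0 < b" "\<And>(w :: int^'n \<Rightarrow> complex) F k \<omega>. finite F \<Longrightarrow> \<forall>x. w x \<noteq> 0 \<longrightarrow> x \<in> F \<Longrightarrow> norm \<omega> = 1 \<Longrightarrow>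
    b * cmod (\<Sum>x\<in>F. w x * chr x (kappa (- \<omega>) lam - k))
        \<le> cmod (born_amplitude lam w (k, \<omega>))"
    using born_amplitude_lower_bound[OF lam] by blast
  define C where "C = 2 / (b * c * sqrt m)"
  have C: "0 < C" using b(1) cP(1) m(1) by (simp add: C_def)
  have "ennreal (L2_set (\<lambda>x. cmod (v2 x - v1 x)) F) \<le> ennreal C * L2_norm_on ?M N
             (\<lambda>z. born_amplitude lam v2 z - born_amplitude lam v1 z)"
    if v: "\<forall>x. v1 x \<noteq> 0 \<longrightarrow> ivec x \<in> D" "\<forall>x. v2 x \<noteq> 0 \<longrightarrow> ivec x \<in> D" for v1 v2 :: "int^'n \<Rightarrow> complex"
  proof -
    define w where "w x = v2 x - v1 x" for x
    have supp: "v1 x \<noteq> 0 \<Longrightarrow> x \<in> F" "v2 x \<noteq> 0 \<Longrightarrow> x \<in> F" for x using v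
      by (auto simp: F_def)
    then have wF: "\<forall>x. w x \<noteq> 0 \<longrightarrow> x \<in> F" unfolding w_def
      by (metis diff_self)
    define s where "s = (\<Sum>x\<in>F. cmod (w x))"
    have s: "0 \<le> s" by (simp add: s_def sum_nonneg)
    obtain z where z: "z \<in> P" "c * s \<le> cmod (\<Sum>x\<in>F. w x * ch x z)" using cP(5)[of w]
      by (auto simp: s_def)
    have low: "b * (c * s / 2) \<le> cmod (born_amplitude lam v2 z' - born_amplitude lam v1 z')" if z': "z' \<in> B z" for z'
    proof -
      obtain k' \<omega>' where z'': "z' = (k', \<omega>')" by (cases z')
      have n: "norm \<omega>' = 1" using B(2)[OF z(1)] z' O'(2) by (auto simp: z'')
      have "cmod (\<Sum>x\<in>F. w x * ch x z)
          \<le> cmod (\<Sum>x\<in>F. w x * ch x z') + cmod (\<Sum>x\<in>F. w x * (ch x z' - ch x z))"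
        using norm_triangle_ineq4[of "\<Sum>x\<in>F. w x * ch x z'" "\<Sum>x\<in>F. w x * (ch x z' - ch x z)"]
        by (simp add: right_diff_distrib sum_subtractf)
      also have "cmod (\<Sum>x\<in>F. w x * (ch x z' - ch x z)) \<le> (\<Sum>x\<in>F. cmod (w x) * (c / 2))"
        by (rule sum_norm_le) (unfold norm_mult, intro mult_left_mono B(4)[OF z(1) _ z'], simp_all)
      also have "\<dots> = c * s / 2" unfolding sum_distrib_right[symmetric] s_def by simp
      finally have "c * s / 2 \<le> cmod (\<Sum>x\<in>F. w x * ch x z')" using z(2) by simp
      then have "b * (c * s / 2) \<le> b * cmod (\<Sum>x\<in>F. w x * ch x z')" using b(1)
        by (intro mult_left_mono) auto
      also have "\<dots> \<le> cmod (born_amplitude lam w z')"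
        using b(2)[OF F wF n, of k'] by (simp add: z'' ch_def)
      finally show ?thesis using born_amplitude_diff[OF F supp] by (simp add: w_def[abs_def])
    qed
    have "ennreal (b * (c * s / 2) * sqrt m) \<le> L2_norm_on ?M N
             (\<lambda>z. born_amplitude lam v2 z - born_amplitude lam v1 z)"
      using m \<mu>le[OF z(1)] b(1) cP(1) s
      by (intro L2_norm_on_lower_bound[OF B(1,2)[OF z(1)] _ low]) auto
    then have "ennreal C * ennreal (b * (c * s / 2) * sqrt m) \<le> ennreal C * L2_norm_on ?M N
             (\<lambda>z. born_amplitude lam v2 z - born_amplitude lam v1 z)" by (intro mult_left_mono) auto
    moreover have "ennreal C * ennreal (b * (c * s / 2) * sqrt m) = ennreal s"
    proof -
      have "C * (b * (c * s / 2) * sqrt m) = s" using b(1) cP(1) m(1) by (simp add: C_def)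
      moreover have "0 \<le> b * (c * s / 2) * sqrt m" using b(1) cP(1) m(1) s by simp
      ultimately show ?thesis using C ennreal_mult[of C "b * (c * s / 2) * sqrt m"]
        by (simp only: less_imp_le)
    qed
    moreover have "L2_set (\<lambda>x. cmod (v2 x - v1 x)) F \<le> s"
      unfolding s_def w_def by (rule L2_set_le_sum) simp
    ultimately show ?thesis using ennreal_leI[of "L2_set (\<lambda>x. cmod (v2 x - v1 x)) F" s] by simp
  qed
  then show ?thesis using C unfolding F_def by (intro exI[of _ C]) simp
qed

end
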